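(* Let $p$ be a prime, let $\mathcal{C}$ be a collection of $p$-subgroups in a finite group $G$, and let $S$ be a Sylow $p$-subgroup of $G$. (1) Suppose that $\mathcal{C}$ is closed under passage to $p$-overgroups (that is, every $p$-subgroup of $G$ containing a member of $\mathcal{C}$ is in $\mathcal{C}$). Then the canonical functor $E\mathbf{O}_{\mathcal{C}}\to\mathcal{C}$ induces an $S$-homotopy equivalence on nerves. (2) Suppose that $\mathcal{C}$ is closed under passage to nontrivial subgroups. Then the canonical functor $E\mathbf{A}_{\mathcal{C}}\to\mathcal{C}$ induces an $S$-homotopy equivalence on nerves.
   Context: A collection $\mathcal{C}$ of subgroups of $G$ is a set of subgroups closed under $G$-conjugation; it is a poset under inclusion with $G$ acting by conjugation. $E\mathbf{O}_{\mathcal{C}}$ is the category with objects the pairs $(G/H,x)$, where $H\in\mathcal{C}$ and $x\in G/H$; morphisms $(G/H,x)\to(G/H',x')$ are the $G$-maps $G/H\to G/H'$ sending $x$ to $x'$. $G$ acts by $g\cdot(G/H,x)=(G/H,gx)$. The canonical functor $E\mathbf{O}_{\mathcal{C}}\to\mathcal{C}$ sends $(G/H,x)$ to the stabilizer $G_x$. $E\mathbf{A}_{\mathcal{C}}$ is the category with objects the monomorphisms $i:H\to G$ with $H\in\mathcal{C}$ and $i(H)\in\mathcal{C}$; morphisms from $i:H\to G$ to $i':H'\to G$ are the homomorphisms $\varphi:H\to H'$ with $i=i'\circ\varphi$. $G$ acts by postcomposing $i$ with conjugation. The canonical functor $E\mathbf{A}_{\mathcal{C}}\to\mathcal{C}$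 sends $i$ to $i(H)$. An $S$-homotopy equivalence is an $S$-equivariant homotopy equivalence; for nerves of categories with $S$-action, an $S$-map is an $S$-homotopy equivalence if and only if it induces an ordinary homotopy equivalence on $H$-fixed points for all subgroups $H\le S$. *)

theory Defs
  imports
    "HOL-Algebra.Group_Action"
    "HOL-Algebra.Left_Coset"
    "HOL-Homology.Simplices"
    "HOL-Computational_Algebra.Primes"
begin

section \<open>Small categories, functors and nerves\<close>

text \<open>Hom-sets at different pairs of objects need not be disjoint, hence composition and the
  arrow part of a functor take the objects involved as arguments:
  \<open>cmp C x y z g f\<close> is the composite of \<open>f : x \<rightarrow> y\<close> and \<open>g : y \<rightarrow> z\<close>.\<close>

record ('o, 'm) category =
  objs :: "'o set"
  arrs :: "'o \<Rightarrow> 'o \<Rightarrow> 'm set"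
  ident :: "'o \<Rightarrow> 'm"
  cmp :: "'o \<Rightarrow> 'o \<Rightarrow> 'o \<Rightarrow> 'm \<Rightarrow> 'm \<Rightarrow> 'm"

record ('o, 'm, 'p, 'n) cat_functor =
  fobj :: "'o \<Rightarrow> 'p"
  farr :: "'o \<Rightarrow> 'o \<Rightarrow> 'm \<Rightarrow> 'n"

definition is_category :: "('o, 'm) category \<Rightarrow> bool" where
  "is_category C \<longleftrightarrow>
     (\<forall>x\<in>objs C. ident C x \<in> arrs C x x) \<and>
     (\<forall>x\<in>objs C. \<forall>y\<in>objs C. \<forall>z\<in>objs C. \<forall>f\<in>arrs C x y. \<forall>g\<in>arrs C y z.
        cmp C x y z g f \<in> arrs C x z) \<and>
     (\<forall>x\<in>objs C. \<forall>y\<in>objs C. \<forall>f\<in>arrs C x y.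
        cmp C x x y f (ident C x) = f \<and> cmp C x y y (ident C y) f = f) \<and>
     (\<forall>w\<in>objs C. \<forall>x\<in>objs C. \<forall>y\<in>objs C. \<forall>z\<in>objs C.
        \<forall>f\<in>arrs C w x. \<forall>g\<in>arrs C x y. \<forall>h\<in>arrs C y z.
        cmp C w x z (cmp C x y z h g) f = cmp C w y z h (cmp C w x y g f))"

definition is_functor ::
  "('o, 'm) category \<Rightarrow> ('p, 'n) category \<Rightarrow> ('o, 'm, 'p, 'n) cat_functor \<Rightarrow> bool" where
  "is_functor C D F \<longleftrightarrow>
     (\<forall>x\<in>objs C. fobj F x \<in> objs D) \<and>
     (\<forall>x\<in>objs C. \<forall>y\<in>objs C. \<forall>f\<in>arrs C x y. farr F x y f \<in> arrs D (fobj F x) (fobj F y)) \<and>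
     (\<forall>x\<in>objs C. farr F x x (ident C x) = ident D (fobj F x)) \<and>
     (\<forall>x\<in>objs C. \<forall>y\<in>objs C. \<forall>z\<in>objs C. \<forall>f\<in>arrs C x y. \<forall>g\<in>arrs C y z.
        farr F x z (cmp C x y z g f) =
        cmp D (fobj F x) (fobj F y) (fobj F z) (farr F y z g) (farr F x y f))"

text \<open>A simplicial set: \<open>simps X n\<close> is the set of \<open>n\<close>-simplices, and for monotone
  \<open>\<alpha> : {0..m} \<rightarrow> {0..n}\<close> the operator \<open>\<alpha>\<^sup>* : X\<^sub>n \<rightarrow> X\<^sub>m\<close> is \<open>oper X m \<alpha>\<close>.\<close>

record 'x sset =
  simps :: "nat \<Rightarrow> 'x set"
  oper :: "nat \<Rightarrow> (nat \<Rightarrow> nat) \<Rightarrow> 'x \<Rightarrow> 'x"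

abbreviation ord_pairs :: "nat \<Rightarrow> (nat \<times> nat) set" where
  "ord_pairs n \<equiv> {(i, j). i \<le> j \<and> j \<le> n}"

text \<open>An \<open>n\<close>-simplex of the nerve is a functor from the poset \<open>{0 < \<dots> < n}\<close> to \<open>C\<close>, with
  object part \<open>a\<close> and arrow part \<open>f\<close>.\<close>

definition nerve_simps ::
  "('o, 'm) category \<Rightarrow> nat \<Rightarrow> ((nat \<Rightarrow> 'o) \<times> (nat \<times> nat \<Rightarrow> 'm)) set" where
  "nerve_simps C n = {(a, f).
     a \<in> {..n} \<rightarrow>\<^sub>E objs C \<and>
     f \<in> (\<Pi>\<^sub>E (i, j)\<in>ord_pairs n. arrs C (a i) (a j)) \<and>
     (\<forall>i\<le>n. f (i, i) = ident C (a i)) \<and>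
     (\<forall>i j k. i \<le> j \<and> j \<le> k \<and> k \<le> n \<longrightarrow>
        cmp C (a i) (a j) (a k) (f (j, k)) (f (i, j)) = f (i, k))}"

definition nerve ::
  "('o, 'm) category \<Rightarrow> ((nat \<Rightarrow> 'o) \<times> (nat \<times> nat \<Rightarrow> 'm)) sset" where
  "nerve C = \<lparr> simps = nerve_simps C,
     oper = (\<lambda>m \<alpha> (a, f). (\<lambda>i\<in>{..m}. a (\<alpha> i), \<lambda>(i, j)\<in>ord_pairs m. f (\<alpha> i, \<alpha> j))) \<rparr>"

definition nerve_map ::
  "('o, 'm, 'p, 'n) cat_functor \<Rightarrow> nat \<Rightarrow>
     (nat \<Rightarrow> 'o) \<times> (nat \<times> nat \<Rightarrow> 'm) \<Rightarrow> (nat \<Rightarrow> 'p) \<times> (nat \<times> nat \<Rightarrow> 'n)" where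
  "nerve_map F n = (\<lambda>(a, f).
     (\<lambda>i\<in>{..n}. fobj F (a i), \<lambda>(i, j)\<in>ord_pairs n. farr F (a i) (a j) (f (i, j))))"


lemma nerve_map_simps:
  assumes "is_functor C D F" "x \<in> simps (nerve C) n"
  shows "nerve_map F n x \<in> simps (nerve D) n"
proof -
  obtain a f where x: "x = (a, f)" by fastforce
  have a: "a i \<in> objs C" if "i \<le> n" for i
    using assms(2) that by (auto simp: x nerve_def nerve_simps_def)
  have f: "f (i, j) \<in> arrs C (a i) (a j)" if "i \<le> j" "j \<le> n" for i j
    using assms(2) that by (auto simp: x nerve_def nerve_simps_def PiE_def Pi_def)
  have fid: "f (i, i) = ident C (a i)" if "i \<le> n" for i
    using assms(2) that by (auto simp: x nerve_def nerve_simps_def)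
  have fc: "cmp C (a i) (a j) (a k) (f (j, k)) (f (i, j)) = f (i, k)"
    if "i \<le> j" "j \<le> k" "k \<le> n" for i j k
    using assms(2) that by (auto simp: x nerve_def nerve_simps_def)
  define b where "b = (\<lambda>i\<in>{..n}. fobj F (a i))"
  define e where "e = (\<lambda>(i, j)\<in>ord_pairs n. farr F (a i) (a j) (f (i, j)))"
  have b: "b i = fobj F (a i)" if "i \<le> n" for i
    using that by (simp add: b_def)
  have e: "e (i, j) = farr F (a i) (a j) (f (i, j))" if "i \<le> j" "j \<le> n" for i j
    using that by (simp add: e_def)
  have "b \<in> {..n} \<rightarrow>\<^sub>E objs D"
    using assms(1) a by (auto simp: b_def is_functor_def)
  moreover have "e \<in> (\<Pi>\<^sub>E (i, j)\<in>ord_pairs n. arrs D (b i) (b j))"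
  proof (rule PiE_I)
    fix u assume "u \<in> ord_pairs n"
    then show "e u \<in> (case u of (i, j) \<Rightarrow> arrs D (b i) (b j))"
      using assms(1) a f by (auto simp: b e is_functor_def)
  qed (simp add: e_def)
  moreover have "e (i, i) = ident D (b i)" if "i \<le> n" for i
    using assms(1) a fid that by (simp add: b e is_functor_def)
  moreover have "cmp D (b i) (b j) (b k) (e (j, k)) (e (i, j)) = e (i, k)"
    if "i \<le> j" "j \<le> k" "k \<le> n" for i j k
  proof -
    have "i \<le> n" "j \<le> n" "i \<le> k" using that by auto
    then show ?thesis
      using assms(1) a f fc[OF that, symmetric] that by (simp add: b e is_functor_def)
  qed
  ultimately have "(b, e) \<in> nerve_simps D n"
    by (simp add: nerve_simps_def)
  then show ?thesis
    by (simp add: x nerve_def nerve_map_def b_def e_def)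
qed

lemma nerve_oper_simps:
  assumes "x \<in> simps (nerve C) n" "\<alpha> \<in> {..m} \<rightarrow> {..n}" "mono_on {..m} \<alpha>"
  shows "oper (nerve C) m \<alpha> x \<in> simps (nerve C) m"
proof -
  have "\<alpha> i \<le> \<alpha> j" if "i \<le> j" "j \<le> m" for i j
    using assms(3) that by (auto simp: mono_on_def)
  moreover have "\<alpha> i \<le> n" if "i \<le> m" for i
    using assms(2) that by auto
  ultimately show ?thesis
    using assms(1) by (auto simp: nerve_def nerve_simps_def PiE_def Pi_def)
qed

lemma nerve_map_oper:
  assumes "\<alpha> \<in> {..m} \<rightarrow> {..n}" "mono_on {..m} \<alpha>"
  shows "nerve_map F m (oper (nerve C) m \<alpha> x) = oper (nerve D) m \<alpha> (nerve_map F n x)"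
proof -
  have "\<alpha> i \<le> \<alpha> j" if "i \<le> j" "j \<le> m" for i j
    using assms(2) that by (auto simp: mono_on_def)
  moreover have "\<alpha> i \<le> n" if "i \<le> m" for i
    using assms(1) that by auto
  ultimately show ?thesis
    by (cases x) (auto simp: nerve_def nerve_map_def fun_eq_iff restrict_def)
qed


section \<open>Geometric realization\<close>

definition quotient_topology :: "'a topology \<Rightarrow> ('a \<Rightarrow> 'b) \<Rightarrow> 'b topology" where
  "quotient_topology X q =
     topology (\<lambda>U. U \<subseteq> q ` topspace X \<and> openin X {x \<in> topspace X. q x \<in> U})"

lemma openin_quotient_topology:
  "openin (quotient_topology X q) U \<longleftrightarrow>
     U \<subseteq> q ` topspace X \<and> openin X {x \<in> topspace X. q x \<in> U}"
proof -
  have "istopology (\<lambda>U. U \<subseteq> q ` topspace X \<and> openin X {x \<in> topspace X. q x \<in> U})"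
  proof -
    have 1: "{x \<in> topspace X. q x \<in> S \<inter> T} =
        {x \<in> topspace X. q x \<in> S} \<inter> {x \<in> topspace X. q x \<in> T}" for S T
      by auto
    have 2: "{x \<in> topspace X. q x \<in> \<Union>\<K>} = (\<Union>K\<in>\<K>. {x \<in> topspace X. q x \<in> K})" for \<K>
      by auto
    show ?thesis
      unfolding istopology_def 1 2 by (auto intro!: openin_Int openin_Union)
  qed
  then show ?thesis
    by (simp add: quotient_topology_def topology_inverse')
qed

lemma topspace_quotient_topology [simp]: "topspace (quotient_topology X q) = q ` topspace X"
proof -
  have *: "{x \<in> topspace X. q x \<in> q ` topspace X} = topspace X"
    by auto
  have "openin (quotient_topology X q) (q ` topspace X)"
    by (simp only: openin_quotient_topology * openin_topspace subset_refl simp_thms)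
  then show ?thesis
    by (meson openin_quotient_topology openin_subset openin_topspace subset_antisym)
qed

lemma quotient_map_quotient_topology: "quotient_map X (quotient_topology X q) q"
  by (auto simp: quotient_map_def openin_quotient_topology)

text \<open>The disjoint union of the spaces \<open>X\<^sub>n \<times> \<Delta>\<^sup>n\<close> with \<open>X\<^sub>n\<close> discrete, one copy of the
  standard \<open>n\<close>-simplex for each \<open>x \<in> X\<^sub>n\<close>.\<close>

definition simplex_sum :: "'x sset \<Rightarrow> ((nat \<times> 'x) \<times> (nat \<Rightarrow> real)) topology" where
  "simplex_sum X =
     sum_topology (\<lambda>(n, x). subtopology (powertop_real UNIV) (standard_simplex n))
       {(n, x). x \<in> simps X n}"

text \<open>In barycentric coordinates, the affine map \<open>\<Delta>\<^sup>m \<rightarrow> \<Delta>\<^sup>n\<close> sending vertex \<open>i\<close> to \<open>\<alpha> i\<close>.\<close>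

definition simplex_push :: "nat \<Rightarrow> (nat \<Rightarrow> nat) \<Rightarrow> (nat \<Rightarrow> real) \<Rightarrow> nat \<Rightarrow> real" where
  "simplex_push m \<alpha> t = (\<lambda>j. \<Sum>i\<in>{i. i \<le> m \<and> \<alpha> i = j}. t i)"

inductive glue ::
  "'x sset \<Rightarrow> (nat \<times> 'x) \<times> (nat \<Rightarrow> real) \<Rightarrow> (nat \<times> 'x) \<times> (nat \<Rightarrow> real) \<Rightarrow> bool"
  for X where
  "x \<in> simps X n \<Longrightarrow> \<alpha> \<in> {..m} \<rightarrow> {..n} \<Longrightarrow> mono_on {..m} \<alpha> \<Longrightarrow> t \<in> standard_simplex m \<Longrightarrow>
     glue X ((m, oper X m \<alpha> x), t) ((n, x), simplex_push m \<alpha> t)"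

definition glue_class ::
  "'x sset \<Rightarrow> (nat \<times> 'x) \<times> (nat \<Rightarrow> real) \<Rightarrow> ((nat \<times> 'x) \<times> (nat \<Rightarrow> real)) set" where
  "glue_class X u = {v. equivclp (glue X) u v}"

definition realization :: "'x sset \<Rightarrow> ((nat \<times> 'x) \<times> (nat \<Rightarrow> real)) set topology" where
  "realization X = quotient_topology (simplex_sum X) (glue_class X)"

text \<open>The map \<open>[x, t] \<mapsto> [\<phi> x, t]\<close> into the realization of \<open>Y\<close> induced by a simplicial map
  \<open>\<phi>\<close>; all members of a class \<open>c\<close> have equivalent images, so the union is a single class.\<close>

definition realization_map ::
  "'y sset \<Rightarrow> (nat \<Rightarrow> 'x \<Rightarrow> 'y) \<Rightarrow> ((nat \<times> 'x) \<times> (nat \<Rightarrow> real)) set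
     \<Rightarrow> ((nat \<times> 'y) \<times> (nat \<Rightarrow> real)) set" where
  "realization_map Y \<phi> c = (\<Union>((n, x), t)\<in>c. glue_class Y ((n, \<phi> n x), t))"


lemma glue_class_eq_iff: "glue_class X u = glue_class X v \<longleftrightarrow> equivclp (glue X) u v"
proof
  assume "glue_class X u = glue_class X v"
  moreover have "v \<in> glue_class X v"
    by (simp add: glue_class_def)
  ultimately have "v \<in> glue_class X u"
    by (simp only:)
  then show "equivclp (glue X) u v"
    by (simp add: glue_class_def)
next
  assume *: "equivclp (glue X) u v"
  have "equivclp (glue X) u w \<longleftrightarrow> equivclp (glue X) v w" for w
    using * equivclp_sym[OF *] equivclp_trans[of "glue X"] by blast
  then show "glue_class X u = glue_class X v"
    by (simp add: glue_class_def)
qed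

lemma realization_map_glue_class:
  assumes simps: "\<And>n x. x \<in> simps X n \<Longrightarrow> \<phi> n x \<in> simps Y n"
    and oper: "\<And>m n \<alpha> x. x \<in> simps X n \<Longrightarrow> \<alpha> \<in> {..m} \<rightarrow> {..n} \<Longrightarrow> mono_on {..m} \<alpha> \<Longrightarrow>
        \<phi> m (oper X m \<alpha> x) = oper Y m \<alpha> (\<phi> n x)"
  shows "realization_map Y \<phi> (glue_class X ((n, x), t)) = glue_class Y ((n, \<phi> n x), t)"
proof -
  define F where "F = (\<lambda>((n, x), t :: nat \<Rightarrow> real). ((n, \<phi> n x), t))"
  have glue: "glue Y (F u) (F v)" if "glue X u v" for u v
    using that
  proof cases
    case (1 x n \<alpha> m t)
    then show ?thesis
      using glue.intros[of "\<phi> n x" Y n \<alpha> m t] by (simp add: F_def oper simps)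
  qed
  have eq: "equivclp (glue Y) (F u) (F v)" if "equivclp (glue X) u v" for u v
    using that
    by (induction rule: equivclp_induct) (auto dest: glue intro: equivclp_into_equivclp)
  have "realization_map Y \<phi> c = (\<Union>u\<in>c. glue_class Y (F u))" for c
    by (force simp: realization_map_def F_def)
  moreover have "glue_class Y (F u) = glue_class Y (F ((n, x), t))"
    if "u \<in> glue_class X ((n, x), t)" for u
    using that eq by (metis glue_class_def glue_class_eq_iff mem_Collect_eq)
  moreover have "((n, x), t) \<in> glue_class X ((n, x), t)"
    by (simp add: glue_class_def)
  ultimately have "realization_map Y \<phi> (glue_class X ((n, x), t)) = glue_class Y (F ((n, x), t))"
    by blast
  then show ?thesis
    by (simp add: F_def)
qed


section \<open>Equivariant homotopy equivalences\<close>

text \<open>In the following, \<open>\<mu>\<close> and \<open>\<nu>\<close> give the action of (at least) the elements of \<open>S\<close>.\<close>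

definition equivariant_on ::
  "'g set \<Rightarrow> 'a set \<Rightarrow> ('g \<Rightarrow> 'a \<Rightarrow> 'a) \<Rightarrow> ('g \<Rightarrow> 'b \<Rightarrow> 'b) \<Rightarrow> ('a \<Rightarrow> 'b) \<Rightarrow> bool" where
  "equivariant_on S A \<mu> \<nu> f \<longleftrightarrow> (\<forall>g\<in>S. \<forall>x\<in>A. f (\<mu> g x) = \<nu> g (f x))"

definition equivariant_homotopy_equivalence ::
  "'g set \<Rightarrow> 'a topology \<Rightarrow> ('g \<Rightarrow> 'a \<Rightarrow> 'a) \<Rightarrow> 'b topology \<Rightarrow> ('g \<Rightarrow> 'b \<Rightarrow> 'b) \<Rightarrow> ('a \<Rightarrow> 'b) \<Rightarrow> bool"
  where
  "equivariant_homotopy_equivalence S X \<mu> Y \<nu> f \<longleftrightarrow>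
     continuous_map X Y f \<and> equivariant_on S (topspace X) \<mu> \<nu> f \<and>
     (\<exists>h. continuous_map Y X h \<and> equivariant_on S (topspace Y) \<nu> \<mu> h \<and>
        homotopic_with (equivariant_on S (topspace X) \<mu> \<mu>) X X (h \<circ> f) id \<and>
        homotopic_with (equivariant_on S (topspace Y) \<nu> \<nu>) Y Y (f \<circ> h) id)"

text \<open>Here \<open>S\<close> acts on the categories \<open>C\<close> and \<open>D\<close> by the endofunctors \<open>\<mu> g\<close> and \<open>\<nu> g\<close>.\<close>

definition nerve_equivariant_homotopy_equivalence ::
  "'g set \<Rightarrow> ('o, 'm) category \<Rightarrow> ('g \<Rightarrow> ('o, 'm, 'o, 'm) cat_functor) \<Rightarrow>
     ('p, 'n) category \<Rightarrow> ('g \<Rightarrow> ('p, 'n, 'p, 'n) cat_functor) \<Rightarrow>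
     ('o, 'm, 'p, 'n) cat_functor \<Rightarrow> bool" where
  "nerve_equivariant_homotopy_equivalence S C \<mu> D \<nu> F \<longleftrightarrow>
     equivariant_homotopy_equivalence S
       (realization (nerve C)) (\<lambda>g. realization_map (nerve C) (nerve_map (\<mu> g)))
       (realization (nerve D)) (\<lambda>g. realization_map (nerve D) (nerve_map (\<nu> g)))
       (realization_map (nerve D) (nerve_map F))"


section \<open>Collections of subgroups\<close>

definition p_subgroup :: "nat \<Rightarrow> 'a set \<Rightarrow> ('a, 'b) monoid_scheme \<Rightarrow> bool" where
  "p_subgroup p H G \<longleftrightarrow> subgroup H G \<and> (\<exists>n. card H = p ^ n)"

definition sylow_subgroup :: "nat \<Rightarrow> 'a set \<Rightarrow> ('a, 'b) monoid_scheme \<Rightarrow> bool" where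
  "sylow_subgroup p S G \<longleftrightarrow> subgroup S G \<and> card S = p ^ multiplicity p (order G)"

definition conjugate_set :: "('a, 'b) monoid_scheme \<Rightarrow> 'a \<Rightarrow> 'a set \<Rightarrow> 'a set" where
  "conjugate_set G g H = g <#\<^bsub>G\<^esub> H #>\<^bsub>G\<^esub> (inv\<^bsub>G\<^esub> g)"

definition collection :: "('a, 'b) monoid_scheme \<Rightarrow> 'a set set \<Rightarrow> bool" where
  "collection G \<C> \<longleftrightarrow>
     (\<forall>H\<in>\<C>. subgroup H G) \<and> (\<forall>H\<in>\<C>. \<forall>g\<in>carrier G. conjugate_set G g H \<in> \<C>)"

definition closed_p_overgroups :: "nat \<Rightarrow> ('a, 'b) monoid_scheme \<Rightarrow> 'a set set \<Rightarrow> bool" where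
  "closed_p_overgroups p G \<C> \<longleftrightarrow> (\<forall>H\<in>\<C>. \<forall>K. p_subgroup p K G \<and> H \<subseteq> K \<longrightarrow> K \<in> \<C>)"

definition closed_nontrivial_subgroups :: "('a, 'b) monoid_scheme \<Rightarrow> 'a set set \<Rightarrow> bool" where
  "closed_nontrivial_subgroups G \<C> \<longleftrightarrow>
     (\<forall>H\<in>\<C>. \<forall>K. subgroup K G \<and> K \<subseteq> H \<and> K \<noteq> {\<one>\<^bsub>G\<^esub>} \<longrightarrow> K \<in> \<C>)"

text \<open>The collection as a poset under inclusion, with \<open>G\<close> acting by conjugation.\<close>

definition poset_cat :: "'a set set \<Rightarrow> ('a set, unit) category" where
  "poset_cat \<C> = \<lparr> objs = \<C>, arrs = (\<lambda>H K. {u. H \<subseteq> K}),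
     ident = (\<lambda>H. ()), cmp = (\<lambda>H K L g f. ()) \<rparr>"

definition poset_act ::
  "('a, 'b) monoid_scheme \<Rightarrow> 'a \<Rightarrow> ('a set, unit, 'a set, unit) cat_functor" where
  "poset_act G g = \<lparr> fobj = conjugate_set G g, farr = (\<lambda>H K u. u) \<rparr>"

text \<open>The \<open>G\<close>-set \<open>G/H\<close> is \<open>lcosets\<^bsub>G\<^esub> H\<close>, with \<open>g\<close> sending the coset \<open>x\<close> to \<open>g <#\<^bsub>G\<^esub> x\<close>.\<close>

definition EO :: "('a, 'b) monoid_scheme \<Rightarrow> 'a set set \<Rightarrow>
    ('a set set \<times> 'a set, 'a set \<Rightarrow> 'a set) category" where
  "EO G \<C> = \<lparr>
     objs = {(lcosets\<^bsub>G\<^esub> H, x) | H x. H \<in> \<C> \<and> x \<in> lcosets\<^bsub>G\<^esub> H},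
     arrs = (\<lambda>(X, x) (Y, y). {\<phi> \<in> X \<rightarrow>\<^sub>E Y.
        (\<forall>g\<in>carrier G. \<forall>z\<in>X. \<phi> (g <#\<^bsub>G\<^esub> z) = g <#\<^bsub>G\<^esub> \<phi> z) \<and> \<phi> x = y}),
     ident = (\<lambda>(X, x). \<lambda>z\<in>X. z),
     cmp = (\<lambda>(X, x) _ _ \<psi> \<phi>. compose X \<psi> \<phi>) \<rparr>"

definition EO_act :: "('a, 'b) monoid_scheme \<Rightarrow> 'a \<Rightarrow>
    ('a set set \<times> 'a set, 'a set \<Rightarrow> 'a set, 'a set set \<times> 'a set, 'a set \<Rightarrow> 'a set) cat_functor" where
  "EO_act G g = \<lparr> fobj = (\<lambda>(X, x). (X, g <#\<^bsub>G\<^esub> x)), farr = (\<lambda>_ _ \<phi>. \<phi>) \<rparr>"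

definition EO_to_poset :: "('a, 'b) monoid_scheme \<Rightarrow>
    ('a set set \<times> 'a set, 'a set \<Rightarrow> 'a set, 'a set, unit) cat_functor" where
  "EO_to_poset G = \<lparr> fobj = (\<lambda>(X, x). stabilizer G (\<lambda>g z. g <#\<^bsub>G\<^esub> z) x), farr = (\<lambda>_ _ _. ()) \<rparr>"

text \<open>An object \<open>i : H \<rightarrow> G\<close> is the pair \<open>(H, i)\<close> with \<open>i\<close> extensional on \<open>H\<close>.\<close>

definition EA :: "('a, 'b) monoid_scheme \<Rightarrow> 'a set set \<Rightarrow>
    ('a set \<times> ('a \<Rightarrow> 'a), 'a \<Rightarrow> 'a) category" where
  "EA G \<C> = \<lparr>
     objs = {(H, i). H \<in> \<C> \<and> i \<in> mon (G\<lparr>carrier := H\<rparr>) G \<and> i \<in> extensional H \<and> i ` H \<in> \<C>},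
     arrs = (\<lambda>(H, i) (K, j). {\<phi> \<in> hom (G\<lparr>carrier := H\<rparr>) (G\<lparr>carrier := K\<rparr>).
        \<phi> \<in> extensional H \<and> (\<forall>h\<in>H. i h = j (\<phi> h))}),
     ident = (\<lambda>(H, i). \<lambda>h\<in>H. h),
     cmp = (\<lambda>(H, i) _ _ \<psi> \<phi>. compose H \<psi> \<phi>) \<rparr>"

definition EA_act :: "('a, 'b) monoid_scheme \<Rightarrow> 'a \<Rightarrow>
    ('a set \<times> ('a \<Rightarrow> 'a), 'a \<Rightarrow> 'a, 'a set \<times> ('a \<Rightarrow> 'a), 'a \<Rightarrow> 'a) cat_functor" where
  "EA_act G g = \<lparr> fobj = (\<lambda>(H, i). (H, \<lambda>h\<in>H. g \<otimes>\<^bsub>G\<^esub> i h \<otimes>\<^bsub>G\<^esub> inv\<^bsub>G\<^esub> g)), farr = (\<lambda>_ _ \<phi>. \<phi>) \<rparr>"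

definition EA_to_poset :: "('a set \<times> ('a \<Rightarrow> 'a), 'a \<Rightarrow> 'a, 'a set, unit) cat_functor" where
  "EA_to_poset = \<lparr> fobj = (\<lambda>(H, i). i ` H), farr = (\<lambda>_ _ _. ()) \<rparr>"


subsection \<open>Well-formedness\<close>

lemma is_category_poset_cat: "is_category (poset_cat \<C>)"
  by (auto simp: is_category_def poset_cat_def)

context group
begin

lemma lcoset_act_closed:
  assumes "subgroup H G" "g \<in> carrier G" "x \<in> lcosets H"
  shows "g <# x \<in> lcosets H"
  using assms subgroup.subset[OF assms(1)] by (fastforce simp: LCOSETS_def lcos_m_assoc)

lemma is_category_EO:
  assumes "collection G \<C>"
  shows "is_category (EO G \<C>)"
proof -
  have *: "g <# x \<in> lcosets H" if "H \<in> \<C>" "g \<in> carrier G" "x \<in> lcosets H" for H g x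
    using assms that lcoset_act_closed by (auto simp: collection_def)
  show ?thesis
    unfolding is_category_def EO_def
    by (auto simp: * compose_def PiE_def extensional_def Pi_def restrict_def fun_eq_iff)
qed

lemma is_category_EA:
  assumes "collection G \<C>"
  shows "is_category (EA G \<C>)"
proof -
  have *: "x \<otimes> y \<in> H" if "H \<in> \<C>" "x \<in> H" "y \<in> H" for H x y
    using assms that by (auto simp: collection_def subgroup.m_closed)
  show ?thesis
    unfolding is_category_def EA_def
    by (auto simp: * compose_def hom_def extensional_def Pi_def restrict_def fun_eq_iff)
qed

lemma conjugate_set_iff:
  assumes "H \<subseteq> carrier G" "g \<in> carrier G" "x \<in> carrier G"
  shows "x \<in> conjugate_set G g H \<longleftrightarrow> inv g \<otimes> x \<otimes> g \<in> H"
proof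
  assume "x \<in> conjugate_set G g H"
  then obtain h where h: "h \<in> H" "x = g \<otimes> h \<otimes> inv g"
    by (auto simp: conjugate_set_def l_coset_def r_coset_def)
  then have "inv g \<otimes> x \<otimes> g = h"
    using assms by (metis inv_solve_left inv_solve_right subsetD m_closed inv_closed m_assoc l_inv r_one)
  then show "inv g \<otimes> x \<otimes> g \<in> H" using h by simp
next
  assume *: "inv g \<otimes> x \<otimes> g \<in> H"
  have "x = g \<otimes> (inv g \<otimes> x \<otimes> g) \<otimes> inv g"
    using assms by (metis inv_solve_left inv_solve_right m_closed inv_closed m_assoc)
  then show "x \<in> conjugate_set G g H"
    using * by (auto simp: conjugate_set_def l_coset_def r_coset_def)
qed

lemma stabilizer_lcoset:
  assumes H: "subgroup H G" and a: "a \<in> carrier G"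
  shows "stabilizer G (\<lambda>g z. g <# z) (a <# H) = conjugate_set G a H"
proof -
  interpret subgroup H G by fact
  have "g <# (a <# H) = a <# H \<longleftrightarrow> inv a \<otimes> g \<otimes> a \<in> H" if g: "g \<in> carrier G" for g
  proof -
    have "g <# (a <# H) = (g \<otimes> a) <# H"
      using a g by (simp add: lcos_m_assoc subset)
    moreover have "(g \<otimes> a) <# H = a <# H \<longleftrightarrow> g \<otimes> a \<in> a <# H"
      using a g H lcos_self[of "g \<otimes> a" H] l_repr_independence[of "g \<otimes> a" a H] by auto
    moreover have "g \<otimes> a \<in> a <# H \<longleftrightarrow> inv a \<otimes> (g \<otimes> a) \<in> H"
      using a g is_group lcos_module_imp lcos_module_rev by blast
    ultimately show ?thesis
      using a g by (simp add: m_assoc)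
  qed
  moreover have "conjugate_set G a H \<subseteq> carrier G"
    using a subset by (auto simp: conjugate_set_def l_coset_def r_coset_def)
  ultimately show ?thesis
    using conjugate_set_iff[OF subset a] by (auto simp only: stabilizer_def set_eq_iff mem_Collect_eq subset_iff)
qed

lemma is_functor_EO_to_poset:
  assumes "collection G \<C>"
  shows "is_functor (EO G \<C>) (poset_cat \<C>) (EO_to_poset G)"
proof -
  have 1: "fobj (EO_to_poset G) x \<in> \<C>" if *: "x \<in> objs (EO G \<C>)" for x
  proof -
    obtain H c where x: "H \<in> \<C>" "c \<in> lcosets H" "x = (lcosets H, c)"
      using * by (auto simp: EO_def)
    obtain a where "a \<in> carrier G" "c = a <# H"
      using x(2) by (auto simp: LCOSETS_def)
    then show ?thesis
      using assms x by (simp add: collection_def EO_to_poset_def stabilizer_lcoset)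
  qed
  have 2: "fobj (EO_to_poset G) x \<subseteq> fobj (EO_to_poset G) y"
    if "x \<in> objs (EO G \<C>)" "\<phi> \<in> arrs (EO G \<C>) x y" for x y \<phi>
  proof
    fix g assume g: "g \<in> fobj (EO_to_poset G) x"
    have "snd x \<in> fst x"
      using that(1) by (auto simp: EO_def)
    moreover have "\<forall>g\<in>carrier G. \<forall>z\<in>fst x. \<phi> (g <# z) = g <# \<phi> z" "\<phi> (snd x) = snd y"
      using that(2) by (simp_all add: EO_def split_beta)
    moreover have "g \<in> carrier G" "g <# snd x = snd x"
      using g by (simp_all add: EO_to_poset_def stabilizer_def split_beta)
    ultimately have "g <# snd y = snd y"
      by metis
    with \<open>g \<in> carrier G\<close> show "g \<in> fobj (EO_to_poset G) y"
      by (simp add: EO_to_poset_def stabilizer_def split_beta)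
  qed
  show ?thesis
    unfolding is_functor_def using 1 2 by (simp add: poset_cat_def)
qed

lemma is_functor_EA_to_poset: "is_functor (EA G \<C>) (poset_cat \<C>) EA_to_poset"
proof -
  have 1: "fobj EA_to_poset x \<in> \<C>" if "x \<in> objs (EA G \<C>)" for x
    using that by (auto simp: EA_def EA_to_poset_def)
  have 2: "fobj EA_to_poset x \<subseteq> fobj EA_to_poset y" if "\<phi> \<in> arrs (EA G \<C>) x y" for x y \<phi>
  proof -
    have "\<phi> \<in> fst x \<rightarrow> fst y" "\<forall>h\<in>fst x. snd x h = snd y (\<phi> h)"
      using that by (auto simp: EA_def hom_def split_beta)
    then have "snd x ` fst x \<subseteq> snd y ` fst y"
      by (auto simp: Pi_iff)
    then show ?thesis
      by (simp add: EA_to_poset_def split_beta)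
  qed
  show ?thesis
    unfolding is_functor_def using 1 2 by (simp add: poset_cat_def)
qed

lemma is_functor_EO_act:
  assumes "collection G \<C>" "g \<in> carrier G"
  shows "is_functor (EO G \<C>) (EO G \<C>) (EO_act G g)"
proof -
  have 1: "g <# x \<in> lcosets H" if "H \<in> \<C>" "x \<in> lcosets H" for H x
    using assms that lcoset_act_closed by (auto simp: collection_def)
  show ?thesis
    using 1 assms by (auto simp: is_functor_def EO_def EO_act_def; blast)
qed

lemma is_functor_EA_act:
  assumes "collection G \<C>" "g \<in> carrier G"
  shows "is_functor (EA G \<C>) (EA G \<C>) (EA_act G g)"
proof -
  have 2: "(\<lambda>h. g \<otimes> i h \<otimes> inv g) ` H = conjugate_set G g (i ` H)" for H i
    by (auto simp: conjugate_set_def l_coset_def r_coset_def)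
  have 1: "(\<lambda>h\<in>H. g \<otimes> i h \<otimes> inv g) \<in> mon (G\<lparr>carrier := H\<rparr>) G" 
    if "H \<in> \<C>" "i \<in> mon (G\<lparr>carrier := H\<rparr>) G" for H i
  proof -
    have H: "subgroup H G" using assms that by (auto simp: collection_def)
    have i: "i \<in> H \<rightarrow> carrier G" using that by (auto simp: mon_def hom_def)
    have *: "inv g \<otimes> (g \<otimes> z) = z" if "z \<in> carrier G" for z
      using that assms(2) by (simp flip: m_assoc)
    show ?thesis
      using that H i assms(2)
      by (auto simp: mon_def hom_def inj_on_def Pi_def subgroup.m_closed m_assoc *)
  qed
  show ?thesis
    using 1 assms
    by (auto simp: is_functor_def EA_def EA_act_def 2 collection_def hom_def Pi_def)
qed

lemma conjugate_set_conjugate_set: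
  assumes "H \<subseteq> carrier G" "g \<in> carrier G" "k \<in> carrier G"
  shows "conjugate_set G g (conjugate_set G k H) = conjugate_set G (g \<otimes> k) H"
proof -
  have "conjugate_set G l K \<subseteq> carrier G" if "l \<in> carrier G" "K \<subseteq> carrier G" for l K
    using that by (auto simp: conjugate_set_def l_coset_def r_coset_def)
  then have sub: "conjugate_set G g (conjugate_set G k H) \<subseteq> carrier G" "conjugate_set G (g \<otimes> k) H \<subseteq> carrier G"
     "conjugate_set G k H \<subseteq> carrier G"
    using assms by auto
  have "x \<in> conjugate_set G g (conjugate_set G k H) \<longleftrightarrow> x \<in> conjugate_set G (g \<otimes> k) H"
    if "x \<in> carrier G" for x
    using assms that sub(3) by (simp add: conjugate_set_iff inv_mult_group m_assoc)
  then show ?thesis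
    using sub by blast
qed

lemma EO_to_poset_equivariant:
  assumes "collection G \<C>" "g \<in> carrier G" "x \<in> objs (EO G \<C>)"
  shows "fobj (EO_to_poset G) (fobj (EO_act G g) x) = fobj (poset_act G g) (fobj (EO_to_poset G) x)"
proof -
  obtain H a where H: "subgroup H G" and a: "a \<in> carrier G" and x: "x = (lcosets H, a <# H)"
    using assms by (auto simp: EO_def LCOSETS_def collection_def)
  have "g <# (a <# H) = (g \<otimes> a) <# H"
    using a assms(2) subgroup.subset[OF H] by (simp add: lcos_m_assoc)
  then show ?thesis
    using a H assms(2) subgroup.subset[OF H]
    by (simp add: x EO_to_poset_def EO_act_def poset_act_def stabilizer_lcoset
        conjugate_set_conjugate_set)
qed

lemma EA_to_poset_equivariant:
  "fobj EA_to_poset (fobj (EA_act G g) x) = fobj (poset_act G g) (fobj EA_to_poset x)"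
proof -
  have "conjugate_set G g K = (\<lambda>k. g \<otimes> k \<otimes> inv g) ` K" for K
    unfolding conjugate_set_def l_coset_def r_coset_def by blast
  then show ?thesis
    by (simp add: EA_to_poset_def EA_act_def poset_act_def split_beta image_image cong: image_cong_simp)
qed

lemma is_functor_poset_act:
  assumes "collection G \<C>" "g \<in> carrier G"
  shows "is_functor (poset_cat \<C>) (poset_cat \<C>) (poset_act G g)"
  using assms
  by (auto simp: is_functor_def poset_cat_def poset_act_def collection_def conjugate_set_def
      l_coset_def r_coset_def)

end

end

theory Submission
  imports Defs "HOL-Analysis.Analysis"
begin

text \<open>Both categories are preorders whose functor to the poset \<open>\<C>\<close> is fully faithful, and a point of
  the realized nerve of a preorder is the same thing as a monotone step function on \<open>[0, 1)\<close>.  To a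
  chain \<open>\<sigma>\<close> in \<open>\<C>\<close> with stabilizer \<open>N\<close> in \<open>S\<close> one attaches the subgroup \<open>(min \<sigma>) N\<close>, respectively the
  centralizer of \<open>N\<close> in \<open>max \<sigma>\<close>; it lies in \<open>\<C>\<close>, is antitone (monotone) in \<open>\<sigma>\<close>, contains
  \<open>min \<sigma>\<close> (is contained in \<open>max \<sigma>\<close>), and since it contains (is centralized by) \<open>N\<close> it lifts to an
  \<open>S\<close>-equivariant choice of objects \<open>F \<sigma>\<close>.  A step function \<open>v\<close> in \<open>\<C>\<close> determines the decreasing
  family of chains of those members on which \<open>v\<close> spends more than a given time, and applying \<open>F\<close> to
  this family gives the homotopy inverse.  Keeping a step function on \<open>[0, l)\<close> and replacing its
  restriction to \<open>[l, 1)\<close> in this way is an equivariant homotopy to the identity, as \<open>l\<close> runs from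
  \<open>0\<close> to \<open>1\<close>; in the second case the two parts of the interval are exchanged.\<close>

section \<open>Points of the nerve of a preorder as monotone step functions\<close>

text \<open>A section over single members is obstructed by isotropy: an object of
  \<open>EO G \<C>\<close> is fixed exactly by the subgroup it lies over, an object of
  \<open>EA G \<C>\<close> exactly by the centralizer of its image, while a member \<open>H\<close>
  is fixed by its whole normalizer. Enlarging \<open>H\<close> by its normalizer \<open>N\<close> in
  \<open>S\<close>, or shrinking \<open>H\<close> to the centralizer of \<open>N\<close> in it,
  repairs the isotropy but loses monotonicity in \<open>H\<close>. On chains monotonicity returns,
  because a longer chain has a smaller stabilizer; so the construction lives on the barycentric
  subdivision, and sorting values by time spent is a variant of the usual identification of a
  realization with that of its subdivision. The prime enters twice, to keep the new subgroups in
  \<C>: the product of a \<open>p\<close>-subgroup with a \<open>p\<close>-subgroup normalizing it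
  is a \<open>p\<close>-subgroup, and a \<open>p\<close>-group acting on a nontrivial
  \<open>p\<close>-group fixes a nontrivial element. An explicit inverse with explicit homotopies
  replaces an argument by fixed points and fibers, and step functions make these maps independent of
  the representing simplex.\<close>

definition thin :: "('o, 'm) category \<Rightarrow> bool" where
  "thin D \<longleftrightarrow> is_category D \<and>
     (\<forall>x\<in>objs D. \<forall>y\<in>objs D. \<forall>f\<in>arrs D x y. \<forall>g\<in>arrs D x y. f = g)"

definition leq :: "('o, 'm) category \<Rightarrow> 'o \<Rightarrow> 'o \<Rightarrow> bool" where
  "leq D x y \<longleftrightarrow> arrs D x y \<noteq> {}"

text \<open>Thinness leaves no freedom in the chosen arrows, so a simplex of the nerve amounts to
  its list of vertices.\<close>

definition chain_simplex ::
  "('o, 'm) category \<Rightarrow> nat \<Rightarrow> (nat \<Rightarrow> 'o) \<Rightarrow> (nat \<Rightarrow> 'o) \<times> (nat \<times> nat \<Rightarrow> 'm)" where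
  "chain_simplex D n a =
     (\<lambda>i\<in>{..n}. a i, \<lambda>(i, j)\<in>ord_pairs n. SOME m. m \<in> arrs D (a i) (a j))"

lemma chain_simplex_in_nerve:
  assumes "thin D" "\<And>i. i \<le> n \<Longrightarrow> a i \<in> objs D"
    and "\<And>i j. i \<le> j \<Longrightarrow> j \<le> n \<Longrightarrow> leq D (a i) (a j)"
  shows "chain_simplex D n a \<in> simps (nerve D) n"
proof -
  define e where "e i j = (SOME m. m \<in> arrs D (a i) (a j))" for i j
  have e: "e i j \<in> arrs D (a i) (a j)" if "i \<le> j" "j \<le> n" for i j
    using assms(3)[OF that] by (simp only: leq_def e_def some_in_eq not_False_eq_True)
  have cat: "is_category D"
    using assms(1) by (simp add: thin_def)
  have unique: "f = g" if "f \<in> arrs D (a i) (a j)" "g \<in> arrs D (a i) (a j)" "i \<le> n" "j \<le> n" for f g i j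
    using assms(1) assms(2)[of i] assms(2)[of j] that unfolding thin_def by blast
  have "ident D (a i) \<in> arrs D (a i) (a i)" if "i \<le> n" for i
    using cat assms(2) that by (auto simp: is_category_def)
  then have 1: "e i i = ident D (a i)" if "i \<le> n" for i
    using unique e that by blast
  have 2: "cmp D (a i) (a j) (a k) (e j k) (e i j) = e i k" if "i \<le> j" "j \<le> k" "k \<le> n" for i j k
  proof (rule unique)
    show "cmp D (a i) (a j) (a k) (e j k) (e i j) \<in> arrs D (a i) (a k)"
      using cat assms(2) e that unfolding is_category_def by (meson le_trans)
  qed (use e that in auto)
  show ?thesis
    unfolding chain_simplex_def e_def[symmetric] nerve_def nerve_simps_def
    using assms(2) e 1 2 by auto
qed

lemma nerve_simps_D:
  assumes "x \<in> simps (nerve D) n"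
  shows "i \<le> n \<Longrightarrow> fst x i \<in> objs D"
    and "i \<le> j \<Longrightarrow> j \<le> n \<Longrightarrow> leq D (fst x i) (fst x j)"
proof -
  obtain a f where "x = (a, f)" and a: "a \<in> {..n} \<rightarrow>\<^sub>E objs D"
    and f: "f \<in> (\<Pi>\<^sub>E (i, j)\<in>ord_pairs n. arrs D (a i) (a j))"
    using assms by (auto simp: nerve_def nerve_simps_def)
  then show "i \<le> n \<Longrightarrow> fst x i \<in> objs D"
    by auto
  show "leq D (fst x i) (fst x j)" if "i \<le> j" "j \<le> n"
    using PiE_mem[OF f, of "(i, j)"] that \<open>x = (a, f)\<close> by (auto simp: leq_def)
qed

lemma nerve_simps_eqI:
  assumes D: "thin D" and x: "x \<in> simps (nerve D) n" and y: "y \<in> simps (nerve D) n"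
    and eq: "\<And>i. i \<le> n \<Longrightarrow> fst x i = fst y i"
  shows "x = y"
proof -
  obtain a f where x': "x = (a, f)" "a \<in> {..n} \<rightarrow>\<^sub>E objs D"
    "f \<in> (\<Pi>\<^sub>E (i, j)\<in>ord_pairs n. arrs D (a i) (a j))"
    using x by (auto simp: nerve_def nerve_simps_def)
  obtain b g where y': "y = (b, g)" "b \<in> {..n} \<rightarrow>\<^sub>E objs D"
    "g \<in> (\<Pi>\<^sub>E (i, j)\<in>ord_pairs n. arrs D (b i) (b j))"
    using y by (auto simp: nerve_def nerve_simps_def)
  have ab: "a = b"
    using eq by (intro PiE_ext[OF x'(2) y'(2)]) (auto simp: x' y')
  have "f = g"
  proof (rule PiE_ext[OF x'(3) y'(3)[folded ab]])
    fix u assume u: "u \<in> ord_pairs n"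
    then obtain i j where ij: "u = (i, j)" "i \<le> j" "j \<le> n"
      by auto
    then have "a i \<in> objs D" "a j \<in> objs D"
      using x'(2) by auto
    moreover have "f u \<in> arrs D (a i) (a j)" "g u \<in> arrs D (a i) (a j)"
      using PiE_mem[OF x'(3) u] PiE_mem[OF y'(3) u] by (simp_all add: ij ab)
    ultimately show "f u = g u"
      using D unfolding thin_def by blast
  qed
  then show ?thesis
    by (simp add: x' y' ab)
qed

section \<open>Barycentric coordinates as lengths of consecutive intervals\<close>

definition bracket :: "(nat \<Rightarrow> real) \<Rightarrow> real \<Rightarrow> nat" where
  "bracket t s = (LEAST i. s < sum t {..i})"

lemma standard_simplexD:
  assumes "t \<in> standard_simplex n"
  shows "0 \<le> t i" "sum t {..n} = 1" "i > n \<Longrightarrow> t i = 0"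
  using assms by (auto simp: standard_simplex_def)

lemma partial_sum_mono:
  fixes t :: "nat \<Rightarrow> real"
  assumes "\<And>i. 0 \<le> t i" "i \<le> j"
  shows "sum t {..<i} \<le> sum t {..<j}"
  using assms by (intro sum_mono2) auto

lemma bracket_eqI:
  assumes "\<And>i. 0 \<le> t i" "sum t {..<i} \<le> s" "s < sum t {..i}"
  shows "bracket t s = i"
  unfolding bracket_def
proof (rule Least_equality)
  show "i \<le> j" if "s < sum t {..j}" for j
  proof (rule ccontr)
    assume "\<not> i \<le> j"
    then have "sum t {..<Suc j} \<le> sum t {..<i}"
      by (intro partial_sum_mono assms) auto
    then show False
      using that assms by (simp add: lessThan_Suc_atMost)
  qed
qed fact

lemma bracket_bounds:
  assumes t: "t \<in> standard_simplex n" and s: "0 \<le> s" "s < 1"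
  shows "bracket t s \<le> n" "sum t {..<bracket t s} \<le> s" "s < sum t {..bracket t s}"
proof -
  have n: "s < sum t {..n}"
    using standard_simplexD[OF t] s by simp
  show "bracket t s \<le> n"
    unfolding bracket_def by (rule Least_le) (rule n)
  show "s < sum t {..bracket t s}"
    unfolding bracket_def by (rule LeastI) (rule n)
  show "sum t {..<bracket t s} \<le> s"
  proof (cases "bracket t s")
    case (Suc k)
    then have "\<not> s < sum t {..k}"
      unfolding bracket_def using not_less_Least[of k "\<lambda>i. s < sum t {..i}"] by auto
    then show ?thesis
      by (simp add: Suc lessThan_Suc_atMost)
  qed (use s in auto)
qed

lemma bracket_ge_iff:
  assumes t: "t \<in> standard_simplex n" and s: "0 \<le> s" "s < 1"
  shows "i \<le> bracket t s \<longleftrightarrow> sum t {..<i} \<le> s"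
proof
  assume "i \<le> bracket t s"
  then show "sum t {..<i} \<le> s"
    using partial_sum_mono[of t i "bracket t s"] bracket_bounds(2)[OF assms] standard_simplexD(1)[OF t]
    by auto
next
  assume *: "sum t {..<i} \<le> s"
  show "i \<le> bracket t s"
  proof (rule ccontr)
    assume "\<not> i \<le> bracket t s"
    then have "sum t {..<Suc (bracket t s)} \<le> sum t {..<i}"
      by (intro partial_sum_mono standard_simplexD[OF t]) auto
    then show False
      using * bracket_bounds(3)[OF assms] by (simp add: lessThan_Suc_atMost)
  qed
qed

lemma bracket_mono:
  assumes "t \<in> standard_simplex n" "0 \<le> s" "s \<le> s'" "s' < 1"
  shows "bracket t s \<le> bracket t s'"
  using bracket_ge_iff[OF assms(1), of s' "bracket t s"] bracket_bounds(2)[OF assms(1), of s] assms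
  by auto

text \<open>The interval \<open>[0, 1)\<close> is cut into consecutive pieces of lengths
  \<open>t 0, ..., t n\<close>, and each time carries the vertex owning its piece. A vertex of
  weight zero owns nothing and leaves no trace.\<close>

definition step :: "(nat \<times> ((nat \<Rightarrow> 'o) \<times> 'f)) \<times> (nat \<Rightarrow> real) \<Rightarrow> real \<Rightarrow> 'o" where
  "step u = (\<lambda>s\<in>{0..<1}. fst (snd (fst u)) (bracket (snd u) s))"

lemma step_apply:
  "0 \<le> s \<Longrightarrow> s < 1 \<Longrightarrow> step ((n, x), t) s = fst x (bracket t s)"
  by (simp add: step_def)

abbreviation points :: "'x sset \<Rightarrow> ((nat \<times> 'x) \<times> (nat \<Rightarrow> real)) set" where
  "points X \<equiv> topspace (simplex_sum X)"

lemma points_iff: "((n, x), t) \<in> points X \<longleftrightarrow> x \<in> simps X n \<and> t \<in> standard_simplex n"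
  by (auto simp: simplex_sum_def)

lemma step_in_objs:
  assumes "((n, x), t) \<in> points (nerve D)" "0 \<le> s" "s < 1"
  shows "step ((n, x), t) s \<in> objs D"
  using assms nerve_simps_D(1)[of x D n] bracket_bounds(1)[of t n s]
  by (simp add: points_iff step_apply)

lemma step_mono:
  assumes "((n, x), t) \<in> points (nerve D)" "0 \<le> s" "s \<le> s'" "s' < 1"
  shows "leq D (step ((n, x), t) s) (step ((n, x), t) s')"
  using assms nerve_simps_D(2)[of x D n] bracket_bounds(1)[of t n s'] bracket_mono[of t n s s']
  by (simp add: points_iff step_apply)

lemma sum_simplex_push:
  assumes "finite J"
  shows "sum (simplex_push m \<alpha> t) J = sum t {i. i \<le> m \<and> \<alpha> i \<in> J}"
proof -
  have "sum (simplex_push m \<alpha> t) J = (\<Sum>j\<in>J. sum t {i \<in> {i. i \<le> m \<and> \<alpha> i \<in> J}. \<alpha> i = j})"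
    unfolding simplex_push_def by (intro sum.cong refl arg_cong[of _ _ "sum t"]) auto
  also have "\<dots> = sum t {i. i \<le> m \<and> \<alpha> i \<in> J}"
    by (rule sum.group) (use assms in auto)
  finally show ?thesis .
qed

text \<open>Pushing coordinates along a monotone map merges neighbouring pieces with the same image
  and inserts empty pieces for missed vertices; no time changes its vertex.\<close>

lemma step_glue:
  assumes "glue (nerve D) u v"
  shows "step u = step v"
  using assms
proof cases
  case (1 x n \<alpha> m t)
  have "step u s = step v s" if s: "0 \<le> s" "s < 1" for s
  proof -
    define i where "i = bracket t s"
    have i: "i \<le> m" "sum t {..<i} \<le> s" "s < sum t {..i}"
      unfolding i_def by (rule bracket_bounds[OF 1(6) s])+
    have mono: "\<alpha> k \<le> \<alpha> l" if "k \<le> l" "l \<le> m" for k l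
      using 1(5) that by (auto simp: mono_on_def)
    have tnn: "0 \<le> t k" for k
      using standard_simplexD[OF 1(6)] by simp
    \<comment> \<open>By monotonicity \<open>\<alpha> k < \<alpha> i\<close> forces
      \<open>k < i\<close>, and \<open>k \<le> i\<close> gives
      \<open>\<alpha> k \<le> \<alpha> i\<close>; these two inclusions are the two bounds.\<close>
    have "bracket (simplex_push m \<alpha> t) s = \<alpha> i"
    proof (rule bracket_eqI)
      have "sum t {k. k \<le> m \<and> \<alpha> k \<in> {..<\<alpha> i}} \<le> sum t {..<i}"
        by (rule sum_mono2) (use mono tnn in \<open>auto, metis linorder_not_less\<close>)
      then show "sum (simplex_push m \<alpha> t) {..<\<alpha> i} \<le> s"
        using i by (simp add: sum_simplex_push)
      have "sum t {..i} \<le> sum t {k. k \<le> m \<and> \<alpha> k \<in> {..\<alpha> i}}"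
        by (rule sum_mono2) (use mono tnn i in auto)
      then show "s < sum (simplex_push m \<alpha> t) {..\<alpha> i}"
        using i by (simp add: sum_simplex_push)
    qed (simp add: simplex_push_def sum_nonneg tnn)
    then show ?thesis
      using s i by (cases x) (simp add: 1 step_def i_def[symmetric] nerve_def)
  qed
  then show ?thesis
    by (intro ext) (simp add: step_def)
qed

lemma step_equivclp:
  assumes "equivclp (glue (nerve D)) u v"
  shows "step u = step v"
  using assms by (induction rule: equivclp_induct) (auto dest: step_glue)

text \<open>Cutting the pieces further only repeats vertices and drops those of weight zero: the
  sampled simplex is the pullback of \<open>x\<close> along \<open>\<alpha>\<close>, and the new
  lengths push forward to \<open>t\<close>. Every partial sum has to be a cut point, so that no new
  piece straddles two vertices.\<close>

lemma step_refine:
  assumes D: "thin D" and x: "x \<in> simps (nerve D) n" and t: "t \<in> standard_simplex n"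
    and b: "strict_mono_on {..Suc m} b" "b 0 = 0" "b (Suc m) = (1::real)"
    and sub: "\<And>i. sum t {..i} \<in> b ` {..Suc m}"
  shows "equivclp (glue (nerve D))
      ((m, chain_simplex D m (\<lambda>j. step ((n, x), t) (b j))), \<lambda>j. if j \<le> m then b (Suc j) - b j else 0)
      ((n, x), t)"
proof -
  define w where "w = (\<lambda>j. if j \<le> m then b (Suc j) - b j else 0)"
  define \<alpha> where "\<alpha> j = bracket t (b j)" for j
  have less: "b i < b j" if "i < j" "j \<le> Suc m" for i j
    using b(1) that by (auto simp: strict_mono_on_def)
  have b01: "0 \<le> b j" "b j < 1" if "j \<le> m" for j
    using less[of 0 j] less[of j "Suc m"] that b by (cases "j = 0"; force)+
  have leq: "b i \<le> b j" if "i \<le> j" "j \<le> Suc m" for i j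
    using less[of i j] that by (cases "i = j") auto
  have \<alpha>: "\<alpha> \<in> {..m} \<rightarrow> {..n}" "mono_on {..m} \<alpha>"
    using bracket_bounds(1)[OF t] bracket_mono[OF t] b01 leq by (auto simp: \<alpha>_def mono_on_def)
  have wsum: "sum w {..<k} = b k" if "k \<le> Suc m" for k
    using that by (induction k) (auto simp: w_def b)
  have w: "w \<in> standard_simplex m"
  proof -
    have "sum w {..m} = 1"
      using wsum[of "Suc m"] b by (simp add: lessThan_Suc_atMost)
    moreover have "0 \<le> w j \<and> w j \<le> 1" for j
      using less[of j "Suc j"] b01[of j] leq[of "Suc j" "Suc m"] b by (auto simp: w_def)
    ultimately show ?thesis
      by (auto simp: standard_simplex_def w_def)
  qed
  have push: "simplex_push m \<alpha> w = t"
  proof -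
    \<comment> \<open>Coordinates are recovered from their partial sums. The pieces before the cut
      \<open>b r = sum t {..i}\<close> are exactly those that \<open>\<alpha>\<close> sends into
      \<open>{..i}\<close>.\<close>
    have cum: "sum (simplex_push m \<alpha> w) {..i} = sum t {..i}" for i
    proof -
      obtain r where r: "r \<le> Suc m" "sum t {..i} = b r"
        using sub[of i] by auto
      have "{j. j \<le> m \<and> \<alpha> j \<in> {..i}} = {..<r}"
      proof -
        have "\<alpha> j \<le> i \<longleftrightarrow> j < r" if "j \<le> m" for j
        proof -
          have "\<alpha> j \<le> i \<longleftrightarrow> \<not> Suc i \<le> \<alpha> j"
            by auto
          also have "\<dots> \<longleftrightarrow> b j < b r"
            unfolding \<alpha>_def using bracket_ge_iff[OF t b01[OF that]] r(2)
            by (simp add: lessThan_Suc_atMost not_le)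
          also have "\<dots> \<longleftrightarrow> j < r"
            using less[of j r] leq[of r j] r that by (metis le_SucI linorder_not_less)
          finally show ?thesis .
        qed
        then show ?thesis
          using r by (auto simp: less_Suc_eq_le)
      qed
      then show ?thesis
        using r wsum by (simp add: sum_simplex_push)
    qed
    show ?thesis
    proof
      fix i
      show "simplex_push m \<alpha> w i = t i"
      proof (cases i)
        case 0
        then show ?thesis using cum[of 0] by simp
      next
        case (Suc k)
        then show ?thesis using cum[of k] cum[of "Suc k"] by simp
      qed
    qed
  qed
  have "oper (nerve D) m \<alpha> x \<in> simps (nerve D) m"
    by (rule nerve_oper_simps[OF x \<alpha>])
  moreover have "chain_simplex D m (\<lambda>j. step ((n, x), t) (b j)) \<in> simps (nerve D) m"
    using x t b01 leq
    by (intro chain_simplex_in_nerve D step_in_objs step_mono) (auto simp: points_iff)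
  ultimately have "chain_simplex D m (\<lambda>j. step ((n, x), t) (b j)) = oper (nerve D) m \<alpha> x"
    by (intro nerve_simps_eqI[OF D])
      (auto simp: chain_simplex_def step_apply b01 \<alpha>_def nerve_def split_beta)
  moreover have "glue (nerve D) ((m, oper (nerve D) m \<alpha> x), w) ((n, x), simplex_push m \<alpha> w)"
    by (rule glue.intros[OF x \<alpha> w])
  ultimately show ?thesis
    unfolding w_def[symmetric] push by auto
qed

text \<open>Both points are refined along the union of their cut points. The two refinements
  coincide literally, since vertices and coordinates then depend only on the step function and the
  cuts.\<close>

lemma step_inj:
  assumes D: "thin D" and u: "u \<in> points (nerve D)" and v: "v \<in> points (nerve D)"
    and eq: "step u = step v"
  shows "equivclp (glue (nerve D)) u v"
proof -
  obtain n x t where u': "u = ((n, x), t)" by (metis surj_pair)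
  obtain n' x' t' where v': "v = ((n', x'), t')" by (metis surj_pair)
  have x: "x \<in> simps (nerve D) n" and t: "t \<in> standard_simplex n"
    using u by (auto simp: u' points_iff)
  have x': "x' \<in> simps (nerve D) n'" and t': "t' \<in> standard_simplex n'"
    using v by (auto simp: v' points_iff)
  have sums: "sum t {..i} \<in> (\<lambda>i. sum t {..i}) ` {..n} \<and> 0 \<le> sum t {..i} \<and> sum t {..i} \<le> 1"
    if t: "t \<in> standard_simplex n" for t n i
  proof -
    note tt = standard_simplexD[OF t]
    have "sum t {..i} = 1" if "i > n"
    proof -
      have "sum t {..n} = sum t {..i}"
        using that tt by (intro sum.mono_neutral_left) auto
      then show ?thesis using tt by simp
    qed
    moreover have "sum t {..i} \<le> 1" if "i \<le> n"
    proof -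
      have "sum t {..i} \<le> sum t {..n}"
        using that tt by (intro sum_mono2) auto
      then show ?thesis using tt by simp
    qed
    moreover have "0 \<le> sum t {..i}"
      using tt by (simp add: sum_nonneg)
    moreover have "sum t {..i} = sum t {..min i n}"
      using \<open>i > n \<Longrightarrow> sum t {..i} = 1\<close> tt(2) by (cases "i \<le> n") (auto simp: min_def)
    then have "sum t {..i} \<in> (\<lambda>i. sum t {..i}) ` {..n}"
      by (rule image_eqI) simp
    ultimately show ?thesis
      by (cases "i \<le> n") auto
  qed
  define B where "B = {0, 1} \<union> (\<lambda>i. sum t {..i}) ` {..n} \<union> (\<lambda>i. sum t' {..i}) ` {..n'}"
  have B: "finite B" "B \<subseteq> {0..1}" "0 \<in> B" "1 \<in> B"
    using sums[OF t] sums[OF t'] by (auto simp: B_def)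
  define l where "l = sorted_list_of_set B"
  have l: "set l = B" "sorted_wrt (<) l"
    using B by (auto simp: l_def)
  have len: "length l = card B"
    using B by (simp add: l_def)
  have "card B \<ge> 2"
    using card_mono[of B "{0, 1}"] B by auto
  \<comment> \<open>The cut points include 0 and 1; \<open>m + 2\<close> of them bound the
    \<open>m + 1\<close> pieces of an \<open>m\<close>-simplex.\<close>
  define m where "m = card B - 2"
  have m: "length l = Suc (Suc m)"
    using len \<open>card B \<ge> 2\<close> by (simp add: m_def)
  have lim: "{..Suc m} = {..<length l}"
    using m by auto
  have bl: "(!) l ` {..Suc m} = B"
    unfolding lim l(1)[symmetric] set_conv_nth by auto
  have sm: "strict_mono_on {..Suc m} ((!) l)"
    using l(2) m by (auto simp: strict_mono_on_def sorted_wrt_iff_nth_less)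
  have b0: "l ! 0 = 0"
  proof -
    obtain i where i: "i \<le> Suc m" "l ! i = 0"
      using B(3) bl by (metis atMost_iff imageE)
    moreover have "0 \<le> l ! 0"
      using B(2) bl by auto
    ultimately show ?thesis
      using strict_mono_onD[OF sm, of 0 i] by (cases "i = 0") auto
  qed
  have b1: "l ! Suc m = 1"
  proof -
    obtain i where i: "i \<le> Suc m" "l ! i = 1"
      using B(4) bl by (metis atMost_iff imageE)
    moreover have "l ! Suc m \<le> 1"
      using B(2) bl by auto
    ultimately show ?thesis
      using strict_mono_onD[OF sm, of i "Suc m"] by (cases "i = Suc m") auto
  qed
  have "sum t {..i} \<in> (!) l ` {..Suc m}" "sum t' {..i} \<in> (!) l ` {..Suc m}" for i
    using sums[OF t, of i] sums[OF t', of i] unfolding bl B_def by auto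
  note refine = step_refine[OF D x t sm b0 b1 this(1)] step_refine[OF D x' t' sm b0 b1 this(2)]
  show ?thesis
    unfolding u' v'
    by (rule equivclp_trans[OF equivclp_sym[OF refine(1)] refine(2)[folded eq[unfolded u' v']]])
qed

section \<open>Points of the realization identified with their step functions\<close>

definition val :: "((nat \<times> ((nat \<Rightarrow> 'o) \<times> 'f)) \<times> (nat \<Rightarrow> real)) set \<Rightarrow> real \<Rightarrow> 'o" where
  "val c = step (SOME u. u \<in> c)"

text \<open>As \<open>val\<close> is injective for a thin category, a point can be named by its step
  function. Outside the realizable functions the value is arbitrary.\<close>

definition pt :: "('o, 'm) category \<Rightarrow> (real \<Rightarrow> 'o) \<Rightarrow>
    ((nat \<times> ((nat \<Rightarrow> 'o) \<times> (nat \<times> nat \<Rightarrow> 'm))) \<times> (nat \<Rightarrow> real)) set" where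
  "pt D = inv_into (topspace (realization (nerve D))) val"

definition realizable :: "('o, 'm) category \<Rightarrow> (real \<Rightarrow> 'o) \<Rightarrow> bool" where
  "realizable D K \<longleftrightarrow> K \<in> step ` points (nerve D)"

lemma topspace_realization: "topspace (realization X) = glue_class X ` points X"
  by (simp add: realization_def)

lemma val_glue_class: "val (glue_class (nerve D) u) = step u"
proof -
  have "u \<in> glue_class (nerve D) u"
    by (simp add: glue_class_def)
  then have "(SOME v. v \<in> glue_class (nerve D) u) \<in> glue_class (nerve D) u"
    by (rule someI)
  then have "equivclp (glue (nerve D)) u (SOME v. v \<in> glue_class (nerve D) u)"
    by (simp add: glue_class_def)
  from step_equivclp[OF this] show ?thesis
    by (simp add: val_def)
qed

lemma inj_on_val: "thin D \<Longrightarrow> inj_on val (topspace (realization (nerve D)))"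
  by (auto simp: inj_on_def topspace_realization val_glue_class glue_class_eq_iff intro: step_inj)

lemma pt_step:
  assumes "thin D" "u \<in> points (nerve D)"
  shows "pt D (step u) = glue_class (nerve D) u"
proof -
  have "glue_class (nerve D) u \<in> topspace (realization (nerve D))"
    using assms(2) by (auto simp: topspace_realization)
  from inv_into_f_f[OF inj_on_val[OF assms(1)] this] show ?thesis
    by (simp add: pt_def val_glue_class)
qed

lemma pt_val: "thin D \<Longrightarrow> c \<in> topspace (realization (nerve D)) \<Longrightarrow> pt D (val c) = c"
  by (simp add: pt_def inj_on_val)

lemma realizable_pt:
  assumes "thin D" "realizable D K"
  shows "pt D K \<in> topspace (realization (nerve D))" "val (pt D K) = K"
  using assms by (auto simp: realizable_def pt_step topspace_realization val_glue_class)

lemma val_in_objs: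
  assumes "c \<in> topspace (realization (nerve D))" "0 \<le> s" "s < 1"
  shows "val c s \<in> objs D"
proof -
  obtain n x t where "((n, x), t) \<in> points (nerve D)" "c = glue_class (nerve D) ((n, x), t)"
    using assms(1) by (auto simp: topspace_realization)
  then show ?thesis
    using step_in_objs assms by (simp add: val_glue_class)
qed

text \<open>In terms of step functions an induced map is postcomposition with the object part, which
  turns later equivariance claims into checks at each time \<open>s\<close>.\<close>

lemma realization_map_nerve_map:
  assumes F: "is_functor C D F" and c: "c \<in> topspace (realization (nerve C))"
  shows "realization_map (nerve D) (nerve_map F) c \<in> topspace (realization (nerve D))"
    and "val (realization_map (nerve D) (nerve_map F) c) = (\<lambda>s\<in>{0..<1}. fobj F (val c s))"
proof -
  obtain n x t where xt: "((n, x), t) \<in> points (nerve C)" and c: "c = glue_class (nerve C) ((n, x), t)"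
    using c by (auto simp: topspace_realization)
  have x: "x \<in> simps (nerve C) n" and t: "t \<in> standard_simplex n"
    using xt by (auto simp: points_iff)
  have eq: "realization_map (nerve D) (nerve_map F) c = glue_class (nerve D) ((n, nerve_map F n x), t)"
    unfolding c
    by (rule realization_map_glue_class) (use F in \<open>auto intro: nerve_map_simps nerve_map_oper\<close>)
  show "realization_map (nerve D) (nerve_map F) c \<in> topspace (realization (nerve D))"
    unfolding eq topspace_realization
    by (rule imageI) (use nerve_map_simps[OF F x] t in \<open>simp add: points_iff\<close>)
  have "step ((n, nerve_map F n x), t) s = fobj F (step ((n, x), t) s)" if "0 \<le> s" "s < 1" for s
    using that bracket_bounds(1)[OF t that] by (cases x) (simp add: step_apply nerve_map_def)
  then have "step ((n, nerve_map F n x), t) = (\<lambda>s\<in>{0..<1}. fobj F (step ((n, x), t) s))"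
    by (intro ext) (simp add: step_def)
  then show "val (realization_map (nerve D) (nerve_map F) c) = (\<lambda>s\<in>{0..<1}. fobj F (val c s))"
    unfolding eq by (simp only: val_glue_class c)
qed

section \<open>Continuity of maps out of and into a realization\<close>

abbreviation simplex_space :: "nat \<Rightarrow> (nat \<Rightarrow> real) topology" where
  "simplex_space n \<equiv> subtopology (powertop_real UNIV) (standard_simplex n)"

lemma continuous_map_glue_class:
  assumes "x \<in> simps X n"
  shows "continuous_map (simplex_space n) (realization X) (\<lambda>t. glue_class X ((n, x), t))"
proof -
  have "continuous_map (simplex_space n) (simplex_sum X) (\<lambda>t. ((n, x), t))"
    unfolding simplex_sum_def
    using continuous_map_component_injection[of "(n, x)" "{(n, x). x \<in> simps X n}"
        "\<lambda>(n, x). simplex_space n"] assms by simp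
  moreover have "continuous_map (simplex_sum X) (realization X) (glue_class X)"
    unfolding realization_def by (rule quotient_imp_continuous_map[OF quotient_map_quotient_topology])
  ultimately show ?thesis
    using continuous_map_compose[of _ _ "\<lambda>t. ((n, x), t)" _ "glue_class X"] by (simp add: o_def)
qed

lemma continuous_map_snd_summand:
  assumes "i \<in> I"
  shows "continuous_map (subtopology (sum_topology X I) ({i} \<times> topspace (X i))) (X i) snd"
proof -
  have "openin (subtopology (sum_topology X I) ({i} \<times> topspace (X i)))
      {u \<in> topspace (subtopology (sum_topology X I) ({i} \<times> topspace (X i))). snd u \<in> U}"
    if U: "openin (X i) U" for U
  proof -
    have "openin (sum_topology X I) ({i} \<times> U)"
    proof -
      have "{x. j = i \<and> x \<in> U} = (if j = i then U else {})" for j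
        by auto
      then show ?thesis
        using assms openin_subset[OF U] U by (auto simp: openin_sum_topology)
    qed
    moreover have "{u \<in> topspace (subtopology (sum_topology X I) ({i} \<times> topspace (X i))). snd u \<in> U} =
        ({i} \<times> topspace (X i)) \<inter> ({i} \<times> U)"
      using assms openin_subset[OF U] by auto
    ultimately show ?thesis
      by (metis openin_subtopology_Int2)
  qed
  then show ?thesis
    by (auto simp: continuous_map_def)
qed

text \<open>A product of a quotient map with a locally compact Hausdorff space is again a quotient
  map. Hence a homotopy on a realization may be tested on one simplex at a time.\<close>

lemma continuous_map_prod_realization:
  fixes X :: "'x sset"
  assumes Z: "locally_compact_space Z" "Hausdorff_space Z"
    and f: "\<And>n x. x \<in> simps X n \<Longrightarrow> continuous_map (prod_topology Z (simplex_space n)) W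
        (\<lambda>(z, t). f (z, glue_class X ((n, x), t)))"
  shows "continuous_map (prod_topology Z (realization X)) W f"
proof -
  define I where "I = {(n, x). x \<in> simps X n}"
  define g where "g = f \<circ> (\<lambda>(z, u). (z, glue_class X u))"
  have q: "quotient_map (prod_topology Z (simplex_sum X)) (prod_topology Z (realization X))
      (\<lambda>(z, u). (z, glue_class X u))"
    unfolding realization_def
    by (rule quotient_map_prod_right) (use Z quotient_map_quotient_topology in auto)
  define T where "T i = topspace Z \<times> ({i} \<times> standard_simplex (fst i))" for i :: "nat \<times> 'x"
  \<comment> \<open>The summands of the simplex sum are open, so the restrictions to the sets
    \<open>T i\<close> paste.\<close>
  have "continuous_map (prod_topology Z (simplex_sum X)) W g"
  proof (rule pasting_lemma[where I = I and T = T and f = "\<lambda>i. g"])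
    fix i assume i: "i \<in> I"
    have "openin (simplex_sum X) ({i} \<times> standard_simplex (fst i))"
    proof -
      have "{x. j = i \<and> x \<in> standard_simplex (fst i)} = (if j = i then standard_simplex (fst i) else {})" for j
        by auto
      moreover have "openin (simplex_space n) (standard_simplex n)" for n
        by (metis openin_topspace topspace_standard_simplex)
      ultimately show ?thesis
        using i by (auto simp: simplex_sum_def openin_sum_topology I_def)
    qed
    then show "openin (prod_topology Z (simplex_sum X)) (T i)"
      unfolding T_def by (simp add: openin_prod_Times_iff)
    obtain n x where nx: "i = (n, x)" "x \<in> simps X n"
      using i by (auto simp: I_def)
    have "continuous_map (subtopology (simplex_sum X) ({i} \<times> standard_simplex (fst i)))
        (simplex_space n) snd"
      using continuous_map_snd_summand[of i I "\<lambda>(n, x). simplex_space n"] i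
      by (simp add: simplex_sum_def I_def nx)
    moreover have "subtopology (prod_topology Z (simplex_sum X)) (T i) =
        prod_topology Z (subtopology (simplex_sum X) ({i} \<times> standard_simplex (fst i)))"
      unfolding T_def by (simp add: subtopology_Times)
    ultimately have "continuous_map (subtopology (prod_topology Z (simplex_sum X)) (T i))
        (prod_topology Z (simplex_space n)) (\<lambda>(z, u). (z, snd u))"
      by (simp add: continuous_map_prod_top)
    from continuous_map_compose[OF this f[OF nx(2)]]
    show "continuous_map (subtopology (prod_topology Z (simplex_sum X)) (T i)) W g"
    proof (rule continuous_map_eq)
      fix v assume "v \<in> topspace (subtopology (prod_topology Z (simplex_sum X)) (T i))"
      then show "((\<lambda>(z, t). f (z, glue_class X ((n, x), t))) \<circ> (\<lambda>(z, u). (z, snd u))) v = g v"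
        by (auto simp: T_def g_def nx)
    qed
  next
    fix v assume "v \<in> topspace (prod_topology Z (simplex_sum X))"
    then show "\<exists>j. j \<in> I \<and> v \<in> T j \<and> g v = g v"
      by (auto simp: simplex_sum_def I_def T_def)
  qed auto
  with q show ?thesis
    unfolding g_def by (rule continuous_compose_quotient_map)
qed

text \<open>On each of the finitely many closed sets where the breakpoints \<open>\<beta> k\<close> come in a fixed order,
  the step function is given by one simplex with continuously varying coordinates.\<close>

lemma piecewise_step_continuous:
  fixes \<beta> :: "'k \<Rightarrow> 'y \<Rightarrow> real" and \<Psi> :: "'k set \<Rightarrow> 'o" and I :: "'k set" and D :: "('o, 'm) category"
  defines "A y s \<equiv> {k \<in> I. \<beta> k y \<le> s}"
  defines "K y \<equiv> \<lambda>s\<in>{0..<1}. \<Psi> (A y s)"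
  assumes D: "thin D" and I: "finite I"
    and cont: "\<And>k. k \<in> I \<Longrightarrow> continuous_map Y euclideanreal (\<beta> k)"
    and range: "\<And>k y. k \<in> I \<Longrightarrow> y \<in> topspace Y \<Longrightarrow> 0 \<le> \<beta> k y \<and> \<beta> k y \<le> 1"
    and obj: "\<And>y s. y \<in> topspace Y \<Longrightarrow> 0 \<le> s \<Longrightarrow> s < 1 \<Longrightarrow> \<Psi> (A y s) \<in> objs D"
    and mono: "\<And>y y' s s'. y \<in> topspace Y \<Longrightarrow> y' \<in> topspace Y \<Longrightarrow>
        0 \<le> s \<Longrightarrow> s < 1 \<Longrightarrow> 0 \<le> s' \<Longrightarrow> s' < 1 \<Longrightarrow>
        (\<And>k l. k \<in> I \<Longrightarrow> l \<in> I \<Longrightarrow> \<beta> k y < \<beta> l y \<Longrightarrow> \<beta> k y' \<le> \<beta> l y') \<Longrightarrow>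
        A y s \<subseteq> A y' s' \<Longrightarrow> leq D (\<Psi> (A y s)) (\<Psi> (A y' s'))"
  shows "continuous_map Y (realization (nerve D)) (\<lambda>y. pt D (K y))"
    and "y \<in> topspace Y \<Longrightarrow> realizable D (K y)"
proof -
  define R where "R = {r. set r = I \<and> distinct r}"
  have "finite R"
    using finite_subset_distinct[OF I] by (rule rev_finite_subset) (auto simp: R_def)
  \<comment> \<open>A list \<open>r\<close> is a possible order of the breakpoints. The ends 0 and 1
    are put in at the indices \<open>0\<close> and \<open>length r + 1\<close>, whence the shift
    \<open>j - 1\<close> and a simplex of dimension \<open>length r\<close>.\<close>
  define \<gamma> where "\<gamma> r j y = (if j = 0 then 0 else if j \<le> length r then \<beta> (r ! (j - 1)) y else 1)"
    for r j y
  define P where "P r = {y \<in> topspace Y. \<forall>j\<le>length r. \<gamma> r j y \<le> \<gamma> r (Suc j) y}" for r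
  define \<tau> where "\<tau> r y j = (if j \<le> length r then \<gamma> r (Suc j) y - \<gamma> r j y else 0)" for r y j
  have \<gamma>_cont: "continuous_map Y euclideanreal (\<gamma> r j)" if "r \<in> R" for r j
  proof -
    have "r ! (j - 1) \<in> I" if "j \<noteq> 0" "j \<le> length r"
      using that \<open>r \<in> R\<close> by (auto simp: R_def)
    then show ?thesis
      unfolding \<gamma>_def using cont by auto
  qed
  have P_closed: "closedin Y (P r)" if r: "r \<in> R" for r
  proof -
    have "closedin Y {y \<in> topspace Y. \<gamma> r (Suc j) y - \<gamma> r j y \<in> {0..}}" for j
      by (rule closedin_continuous_map_preimage[where Y = euclideanreal])
        (auto intro!: continuous_map_diff \<gamma>_cont r)
    then have "closedin Y (\<Inter>j\<le>length r. {y \<in> topspace Y. \<gamma> r (Suc j) y - \<gamma> r j y \<in> {0..}})"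
      by (intro closedin_INT) auto
    also have "(\<Inter>j\<le>length r. {y \<in> topspace Y. \<gamma> r (Suc j) y - \<gamma> r j y \<in> {0..}}) = P r"
      by (auto simp: P_def)
    finally show ?thesis .
  qed
  have \<gamma>_mono: "\<gamma> r i y \<le> \<gamma> r j y" if "y \<in> P r" "i \<le> j" "j \<le> Suc (length r)" for r i j y
    using that(2,3) by (induction j rule: dec_induct) (use that(1) in \<open>force simp: P_def\<close>)+
  have cover: "\<exists>r\<in>R. y \<in> P r" if y: "y \<in> topspace Y" for y
  proof -
    obtain l where l: "set l = I" "distinct l"
      using finite_distinct_list[OF I] by blast
    define r where "r = sort_key (\<lambda>k. \<beta> k y) l"
    have r: "r \<in> R" "sorted (map (\<lambda>k. \<beta> k y) r)"
      using l by (auto simp: r_def R_def)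
    have "\<gamma> r j y \<le> \<gamma> r (Suc j) y" if "j \<le> length r" for j
    proof (cases "j = 0 \<or> j = length r")
      case True
      have "0 \<le> \<beta> (r ! i) y \<and> \<beta> (r ! i) y \<le> 1" if "i < length r" for i
        using that r y by (intro range) (auto simp: R_def)
      from this[of 0] this[of "length r - 1"] show ?thesis
        using True by (cases "r = []") (auto simp: \<gamma>_def Suc_le_eq)
    next
      case False
      then show ?thesis
        using sorted_nth_mono[OF r(2), of "j - 1" j] that by (auto simp: \<gamma>_def)
    qed
    then show ?thesis
      using r y by (auto simp: P_def)
  qed
  have \<tau>_sum: "sum (\<tau> r y) {..<k} = \<gamma> r k y" if "k \<le> Suc (length r)" for r y k
    using that by (induction k) (auto simp: \<tau>_def, simp add: \<gamma>_def)
  have \<tau>: "\<tau> r y \<in> standard_simplex (length r)" if y: "y \<in> P r" for r y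
  proof -
    have "sum (\<tau> r y) {..length r} = 1"
      using \<tau>_sum[of "Suc (length r)" r y] by (simp add: lessThan_Suc_atMost \<gamma>_def)
    moreover have "0 \<le> \<tau> r y j \<and> \<tau> r y j \<le> 1" for j
      using \<gamma>_mono[OF y, of j "Suc j"] \<gamma>_mono[OF y, of 0 j] \<gamma>_mono[OF y, of "Suc j" "Suc (length r)"]
      by (auto simp: \<tau>_def \<gamma>_def split: if_splits)
    ultimately show ?thesis
      by (auto simp: standard_simplex_def \<tau>_def)
  qed
  have A_take: "A y s = set (take j r)"
    if r: "r \<in> R" and y: "y \<in> P r" and j: "j \<le> length r" "\<gamma> r j y \<le> s" "s < \<gamma> r (Suc j) y" for r y j s
  proof -
    have "\<beta> (r ! i) y \<le> s \<longleftrightarrow> i < j" if i: "i < length r" for i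
    proof -
      have "\<beta> (r ! i) y = \<gamma> r (Suc i) y"
        using i by (simp add: \<gamma>_def)
      moreover have "\<gamma> r (Suc i) y \<le> \<gamma> r j y" if "i < j"
        using \<gamma>_mono[OF y, of "Suc i" j] that j by auto
      moreover have "\<gamma> r (Suc j) y \<le> \<gamma> r (Suc i) y" if "j \<le> i"
        using \<gamma>_mono[OF y, of "Suc j" "Suc i"] that i by auto
      ultimately show ?thesis
        using j by (metis dual_order.trans linorder_not_less)
    qed
    moreover have "I = (!) r ` {..<length r}"
      using r by (auto simp: R_def set_conv_nth)
    ultimately show ?thesis
      using j unfolding nth_image[OF j(1), symmetric] by (auto simp: A_def)
  qed
  \<comment> \<open>A prefix of \<open>r\<close> whose interval is empty throughout
    \<open>P r\<close> need not be a state that occurs, and \<open>\<Psi>\<close> of it need not be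
    an object. \<open>\<rho>\<close> replaces such an index by the closest earlier one in
    \<open>E r\<close>, or by the least one if there is none earlier; its coordinate vanishes on
    \<open>P r\<close>, so the step function does not change.\<close>
  define E where "E r = {j. j \<le> length r \<and> (\<exists>y\<in>P r. \<gamma> r j y < \<gamma> r (Suc j) y)}" for r
  define \<rho> where "\<rho> r j = Max {i \<in> E r. i \<le> max j (Min (E r))}" for r j
  define x where "x r = chain_simplex D (length r) (\<lambda>j. \<Psi> (set (take (\<rho> r j) r)))" for r
  have E: "E r \<noteq> {}" "finite (E r)" if ne: "P r \<noteq> {}" for r
  proof -
    show "finite (E r)"
      by (rule finite_subset[of _ "{..length r}"]) (auto simp: E_def)
    obtain y where y: "y \<in> P r"
      using ne by blast
    show "E r \<noteq> {}"
    proof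
      assume "E r = {}"
      then have "\<gamma> r (Suc j) y \<le> \<gamma> r j y" if "j \<le> length r" for j
        using that y by (force simp: E_def)
      then have "\<gamma> r k y \<le> 0" if "k \<le> Suc (length r)" for k
        using that by (induction k) (auto simp: \<gamma>_def[of r 0], force)
      from this[of "Suc (length r)"] show False
        by (simp add: \<gamma>_def)
    qed
  qed
  have \<rho>: "\<rho> r j \<in> E r" "i \<le> j \<Longrightarrow> \<rho> r i \<le> \<rho> r j" "j \<in> E r \<Longrightarrow> \<rho> r j = j" if ne: "P r \<noteq> {}" for r i j
  proof -
    have fin: "finite {i \<in> E r. i \<le> max j (Min (E r))}" for j
      using E[OF ne] by auto
    have min: "Min (E r) \<in> {i \<in> E r. i \<le> max j (Min (E r))}" for j
      using E[OF ne] by auto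
    have "\<rho> r j \<in> {i \<in> E r. i \<le> max j (Min (E r))}"
      unfolding \<rho>_def by (rule Max_in[OF fin]) (use min in blast)
    then show "\<rho> r j \<in> E r"
      by simp
    show "\<rho> r i \<le> \<rho> r j" if "i \<le> j"
      unfolding \<rho>_def
    proof (rule Max_mono[OF _ _ fin])
      show "{k \<in> E r. k \<le> max i (Min (E r))} \<subseteq> {k \<in> E r. k \<le> max j (Min (E r))}"
        using that by auto
      show "{k \<in> E r. k \<le> max i (Min (E r))} \<noteq> {}"
        using min[of i] by blast
    qed
    show "\<rho> r j = j" if "j \<in> E r"
    proof -
      have "max j (Min (E r)) = j"
        using Min_le[OF E(2)[OF ne] that] by simp
      then show ?thesis
        unfolding \<rho>_def using fin[of j] that by (intro Max_eqI) auto
    qed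
  qed
  have x: "x r \<in> simps (nerve D) (length r)" if r: "r \<in> R" and ne: "P r \<noteq> {}" for r
    unfolding x_def
  proof (rule chain_simplex_in_nerve[OF D])
    have *: "\<exists>y s. y \<in> P r \<and> 0 \<le> s \<and> s < 1 \<and> set (take (\<rho> r j) r) = A y s" for j
    proof -
      obtain y where y: "y \<in> P r" "\<gamma> r (\<rho> r j) y < \<gamma> r (Suc (\<rho> r j)) y" "\<rho> r j \<le> length r"
        using \<rho>(1)[OF ne, of j] by (auto simp: E_def)
      have "0 \<le> \<gamma> r (\<rho> r j) y" "\<gamma> r (Suc (\<rho> r j)) y \<le> 1"
        using \<gamma>_mono[OF y(1), of 0 "\<rho> r j"] \<gamma>_mono[OF y(1), of "Suc (\<rho> r j)" "Suc (length r)"] y(3)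
        by (auto simp: \<gamma>_def[of r 0] \<gamma>_def[of r "Suc (length r)"])
      then show ?thesis
        using A_take[OF r y(1) y(3) order_refl y(2)] y by (intro exI[of _ y] exI[of _ "\<gamma> r (\<rho> r j) y"]) auto
    qed
    have P_top: "P r \<subseteq> topspace Y"
      by (auto simp: P_def)
    show "\<Psi> (set (take (\<rho> r j) r)) \<in> objs D" for j
      using *[of j] obj P_top by auto
    fix i j :: nat assume "i \<le> j"
    obtain y s where y: "y \<in> P r" "0 \<le> s" "s < 1" "set (take (\<rho> r i) r) = A y s"
      using * by blast
    obtain y' s' where y': "y' \<in> P r" "0 \<le> s'" "s' < 1" "set (take (\<rho> r j) r) = A y' s'"
      using * by blast
    \<comment> \<open>Two vertices may be realized only at different points of \<open>P r\<close>,
      so their comparison needs monotonicity across points whose breakpoint orders do not conflict;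
      a common order \<open>r\<close> guarantees this.\<close>
    have "\<beta> k y' \<le> \<beta> l y'" if kl: "k \<in> I" "l \<in> I" and less: "\<beta> k y < \<beta> l y" for k l
    proof -
      obtain a b where ab: "a < length r" "b < length r" "k = r ! a" "l = r ! b"
        using kl r by (auto simp: R_def in_set_conv_nth)
      have \<beta>: "\<beta> k z = \<gamma> r (Suc a) z" "\<beta> l z = \<gamma> r (Suc b) z" for z
        using ab by (auto simp: \<gamma>_def)
      have "a \<le> b"
        using \<gamma>_mono[OF y(1), of "Suc b" "Suc a"] less ab(1,2) by (cases "a \<le> b") (auto simp: \<beta>)
      then show ?thesis
        using \<gamma>_mono[OF y'(1), of "Suc a" "Suc b"] ab(1,2) by (simp add: \<beta>)
    qed
    moreover have "set (take (\<rho> r i) r) \<subseteq> set (take (\<rho> r j) r)"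
      using \<rho>(2)[OF ne \<open>i \<le> j\<close>] by (rule set_take_subset_set_take)
    ultimately show "leq D (\<Psi> (set (take (\<rho> r i) r))) (\<Psi> (set (take (\<rho> r j) r)))"
      unfolding y(4) y'(4) using y y' P_top by (intro mono) auto
  qed
  have step_K: "step ((length r, x r), \<tau> r y) = K y" if r: "r \<in> R" and y: "y \<in> P r" for r y
  proof -
    have "step ((length r, x r), \<tau> r y) s = \<Psi> (A y s)" if s: "0 \<le> s" "s < 1" for s
    proof -
      define j where "j = bracket (\<tau> r y) s"
      have j: "j \<le> length r" "sum (\<tau> r y) {..<j} \<le> s" "s < sum (\<tau> r y) {..<Suc j}"
        using bracket_bounds[OF \<tau>[OF y] s] by (simp_all add: j_def lessThan_Suc_atMost)
      then have j': "\<gamma> r j y \<le> s" "s < \<gamma> r (Suc j) y"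
        by (simp_all add: \<tau>_sum del: sum.lessThan_Suc)
      then have "\<gamma> r j y < \<gamma> r (Suc j) y"
        by linarith
      then have "j \<in> E r"
        using j(1) y by (auto simp: E_def)
      then have "\<rho> r j = j"
        using \<rho>(3) y by blast
      then show ?thesis
        using A_take[OF r y j(1) j'] s j(1)
        by (simp add: step_apply j_def[symmetric] x_def chain_simplex_def)
    qed
    then show ?thesis
      by (intro ext) (simp add: K_def step_def)
  qed
  have in_points: "((length r, x r), \<tau> r y) \<in> points (nerve D)" if "r \<in> R" "y \<in> P r" for r y
    using x \<tau> that by (auto simp: points_iff)
  show "realizable D (K y)" if "y \<in> topspace Y"
    using cover[OF that] step_K in_points by (force simp: realizable_def image_iff)
  show "continuous_map Y (realization (nerve D)) (\<lambda>y. pt D (K y))"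
  proof (rule pasting_lemma_closed[where I = R and T = P and f = "\<lambda>r y. pt D (K y)"])
    fix r assume r: "r \<in> R"
    show "continuous_map (subtopology Y (P r)) (realization (nerve D)) (\<lambda>y. pt D (K y))"
    proof (cases "P r = {}")
      case True
      then show ?thesis
        by (simp add: continuous_map_def)
    next
      case False
      have "continuous_map (subtopology Y (P r)) euclideanreal (\<lambda>y. \<tau> r y j)" for j
      proof (cases "j \<le> length r")
        case True
        have "continuous_map (subtopology Y (P r)) euclideanreal (\<lambda>y. \<gamma> r (Suc j) y - \<gamma> r j y)"
          by (intro continuous_map_diff continuous_map_from_subtopology \<gamma>_cont r)
        then show ?thesis
          using True by (simp add: \<tau>_def)
      qed (simp add: \<tau>_def)
      then have "continuous_map (subtopology Y (P r)) (simplex_space (length r)) (\<tau> r)"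
        using \<tau> by (auto simp: continuous_map_in_subtopology continuous_map_componentwise_UNIV)
      from continuous_map_compose[OF this continuous_map_glue_class[OF x[OF r False]]]
      show ?thesis
      proof (rule continuous_map_eq)
        fix y assume "y \<in> topspace (subtopology Y (P r))"
        then have "y \<in> P r"
          by simp
        then show "((\<lambda>t. glue_class (nerve D) ((length r, x r), t)) \<circ> \<tau> r) y = pt D (K y)"
          using pt_step[OF D in_points[OF r]] step_K[OF r] by simp
      qed
    qed
  qed (use \<open>finite R\<close> P_closed cover in auto)
qed

section \<open>Sweeping a step function\<close>

definition window :: "bool \<Rightarrow> real \<Rightarrow> real set" where
  "window d l = (if d then {l..<1} else {0..<l})"

text \<open>Measured on the function itself, the mass does not depend on the simplex that represents
  the point.\<close>

definition mass :: "bool \<Rightarrow> real \<Rightarrow> (real \<Rightarrow> 'c) \<Rightarrow> 'c \<Rightarrow> real" where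
  "mass d l v c = measure lborel {s \<in> window d l. v s = c}"

definition threshold :: "'c set \<Rightarrow> bool \<Rightarrow> real \<Rightarrow> (real \<Rightarrow> 'c) \<Rightarrow> 'c \<Rightarrow> real" where
  "threshold \<C> d l v c =
     (if d then min 1 (l + card \<C> * mass d l v c) else max 0 (l - card \<C> * mass d l v c))"

text \<open>With growing \<open>s\<close> the set shrinks for \<open>d\<close> and grows otherwise.
  Applying \<open>F\<close>, which is antitone in the first case and monotone in the second, gives
  an increasing function of \<open>s\<close> in both.\<close>

definition level :: "'c set \<Rightarrow> bool \<Rightarrow> real \<Rightarrow> (real \<Rightarrow> 'c) \<Rightarrow> real \<Rightarrow> 'c set" where
  "level \<C> d l v s = {c \<in> \<C>. (threshold \<C> d l v c \<le> s) \<noteq> d}"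

text \<open>\<open>d\<close> selects between the two dual situations.  As at most \<open>card \<C>\<close> values share the length of
  the window, some value occupies at least a \<open>1 / card \<C>\<close> fraction of it; scaling by \<open>card \<C>\<close> thus
  keeps \<open>level\<close> nonempty and avoids a normalization that would break down as the window shrinks.\<close>

definition sweep :: "'c set \<Rightarrow> bool \<Rightarrow> ('c set \<Rightarrow> 'p) \<Rightarrow> ('o \<Rightarrow> 'c) \<Rightarrow> ('o \<Rightarrow> 'p) \<Rightarrow>
    real \<Rightarrow> (real \<Rightarrow> 'o) \<Rightarrow> real \<Rightarrow> 'p" where
  "sweep \<C> d F \<pi> j l u =
     (\<lambda>s\<in>{0..<1}. if (l \<le> s) = d then F (level \<C> d l (\<lambda>s. \<pi> (u s)) s) else j (u s))"

text \<open>The length of the part of the \<open>i\<close>-th interval inside the window, written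
  with \<open>max\<close> and \<open>min\<close> so that it is visibly continuous in
  \<open>l\<close> and \<open>t\<close>.\<close>

definition piece :: "bool \<Rightarrow> real \<Rightarrow> (nat \<Rightarrow> real) \<Rightarrow> nat \<Rightarrow> real" where
  "piece d l t i =
     (if d then max l (sum t {..<Suc i}) - max l (sum t {..<i})
      else min l (sum t {..<Suc i}) - min l (sum t {..<i}))"

lemma bracket_eq_iff:
  assumes t: "t \<in> standard_simplex n" and s: "0 \<le> s" "s < 1"
  shows "bracket t s = i \<longleftrightarrow> sum t {..<i} \<le> s \<and> s < sum t {..<Suc i}"
  using bracket_ge_iff[OF assms, of i] bracket_ge_iff[OF assms, of "Suc i"] by linarith

lemma partial_sum_bounds:
  assumes "t \<in> standard_simplex n"
  shows "0 \<le> sum t {..<i}" "sum t {..<i} \<le> sum t {..<Suc i}" "sum t {..<i} \<le> 1"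
proof -
  note t = standard_simplexD[OF assms]
  show "0 \<le> sum t {..<i}"
    using t by (simp add: sum_nonneg)
  show "sum t {..<i} \<le> sum t {..<Suc i}"
    using t by simp
  have "sum t {..<i} \<le> sum t {..<max i (Suc n)}"
    using t by (intro partial_sum_mono) auto
  also have "\<dots> = sum t {..n}"
    using t(3) by (intro sum.mono_neutral_right) auto
  finally show "sum t {..<i} \<le> 1"
    using t by simp
qed

text \<open>This is what makes masses continuous: on a fixed simplex the set of vertices labelled
  \<open>c\<close> is constant, and only the lengths of their clipped intervals vary.\<close>

lemma mass_step:
  assumes t: "t \<in> standard_simplex n" and l: "0 \<le> l" "l \<le> 1"
    and v: "\<And>s. 0 \<le> s \<Longrightarrow> s < 1 \<Longrightarrow> v s = y (bracket t s)"
  shows "mass d l v c = (\<Sum>i | i \<le> n \<and> y i = c. piece d l t i)"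
proof -
  define J where "J = {i. i \<le> n \<and> y i = c}"
  define T where "T i = (if d then {max l (sum t {..<i})..<max l (sum t {..<Suc i})}
    else {min l (sum t {..<i})..<min l (sum t {..<Suc i})})" for i
  have T: "s \<in> T i \<longleftrightarrow> s \<in> window d l \<and> bracket t s = i" for s i
  proof (cases "0 \<le> s \<and> s < 1")
    case True
    then show ?thesis
      using bracket_eq_iff[OF t, of s i] partial_sum_bounds[OF t, of i]
      by (auto simp: T_def window_def)
  next
    case False
    then show ?thesis
      using l partial_sum_bounds[OF t, of i] partial_sum_bounds[OF t, of "Suc i"]
      by (auto simp: T_def window_def)
  qed
  have window: "s \<in> window d l \<Longrightarrow> 0 \<le> s \<and> s < 1" for s
    using l by (auto simp: window_def split: if_splits)
  have le: "max l (sum t {..<i}) \<le> max l (sum t {..<Suc i})"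
    "min l (sum t {..<i}) \<le> min l (sum t {..<Suc i})" for i
    using partial_sum_bounds(2)[OF t, of i] by linarith+
  have "{s \<in> window d l. v s = c} = (\<Union>i\<in>J. T i)"
    using T window v bracket_bounds(1)[OF t] by (auto simp: J_def)
  moreover have "measure lborel (\<Union>i\<in>J. T i) = (\<Sum>i\<in>J. measure lborel (T i))"
  proof (rule measure_finite_Union)
    show "disjoint_family_on T J"
      using T by (auto simp: disjoint_family_on_def)
    show "emeasure lborel (T i) \<noteq> \<infinity>" for i
      using le[of i] by (simp add: T_def del: sum.lessThan_Suc)
  qed (auto simp: J_def T_def)
  moreover have "measure lborel (T i) = piece d l t i" for i
    using le[of i] by (simp add: T_def piece_def del: sum.lessThan_Suc)
  ultimately show ?thesis
    by (simp add: mass_def J_def)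
qed

lemma mass_nonneg: "0 \<le> mass d l v c"
  by (simp add: mass_def)

lemma threshold_range:
  assumes "0 \<le> l" "l \<le> 1"
  shows "0 \<le> threshold \<C> d l v c" "threshold \<C> d l v c \<le> 1"
proof -
  have "0 \<le> card \<C> * mass d l v c"
    by (simp add: mass_nonneg)
  then show "0 \<le> threshold \<C> d l v c" "threshold \<C> d l v c \<le> 1"
    using assms by (cases d; simp add: threshold_def)+
qed

lemma mass_cong:
  assumes "0 \<le> l" "l \<le> 1" "\<And>s. 0 \<le> s \<Longrightarrow> s < 1 \<Longrightarrow> (v s = c) = (w s = c')"
  shows "mass d l v c = mass d l w c'"
  unfolding mass_def
proof (rule arg_cong[of _ _ "measure lborel"])
  have "0 \<le> s \<and> s < 1" if "s \<in> window d l" for s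
    using that assms(1,2) by (auto simp: window_def split: if_splits)
  then show "{s \<in> window d l. v s = c} = {s \<in> window d l. w s = c'}"
    using assms(3) by blast
qed

text \<open>A value not taken in the window has mass 0, so its threshold is \<open>l\<close> itself,
  and \<open>l\<close> lies on the excluding side of every \<open>s\<close> considered here.\<close>

lemma level_in_window:
  assumes c: "c \<in> level \<C> d l v s" and s: "(l \<le> s) = d" "0 \<le> s" "s < 1"
  shows "\<exists>s'\<in>window d l. v s' = c"
proof (rule ccontr)
  assume "\<not> ?thesis"
  then have "{s \<in> window d l. v s = c} = {}"
    by auto
  then have "mass d l v c = 0"
    by (simp only: mass_def measure_empty)
  then show False
    using c s by (cases d) (auto simp: level_def threshold_def)
qed

lemma level_nonempty:
  assumes t: "t \<in> standard_simplex n" and l: "0 \<le> l" "l \<le> 1"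
    and v: "\<And>s. 0 \<le> s \<Longrightarrow> s < 1 \<Longrightarrow> v s = y (bracket t s)"
    and y: "\<And>i. i \<le> n \<Longrightarrow> y i \<in> \<C>" and fin: "finite \<C>"
    and s: "(l \<le> s) = d" "0 \<le> s" "s < 1"
  shows "level \<C> d l v s \<noteq> {}"
proof -
  define L where "L = (if d then 1 - l else l)"
  have "mass d l v c = sum (piece d l t) {i \<in> {..n}. y i = c}" for c
    using mass_step[where v = v and y = y, OF t l v] by (simp only: atMost_iff)
  then have "(\<Sum>c\<in>\<C>. mass d l v c) = (\<Sum>c\<in>\<C>. sum (piece d l t) {i \<in> {..n}. y i = c})"
    by (rule sum.cong[OF refl])
  also have "\<dots> = sum (piece d l t) {..n}"
    by (rule sum.group) (use y fin in auto)
  also have "\<dots> = sum (piece d l t) {..<Suc n}"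
    by (simp only: lessThan_Suc_atMost)
  \<comment> \<open>The clipped partial sums telescope, so the pieces add up to the length
    \<open>L\<close> of the window.\<close>
  also have "\<dots> = L"
  proof -
    have 1: "sum t {..<Suc n} = 1"
      using standard_simplexD(2)[OF t] by (simp only: lessThan_Suc_atMost)
    show ?thesis
    proof (cases d)
      case True
      have "sum (piece d l t) {..<Suc n} = max l (sum t {..<Suc n}) - max l (sum t {..<0})"
        unfolding piece_def using True
        by (simp only: if_True sum_lessThan_telescope[of "\<lambda>i. max l (sum t {..<i})"])
      then show ?thesis
        using l 1 True by (simp add: L_def del: sum.lessThan_Suc)
    next
      case False
      have "sum (piece d l t) {..<Suc n} = min l (sum t {..<Suc n}) - min l (sum t {..<0})"
        unfolding piece_def using False
        by (simp only: if_False sum_lessThan_telescope[of "\<lambda>i. min l (sum t {..<i})"])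
      then show ?thesis
        using l 1 False by (simp add: L_def del: sum.lessThan_Suc)
    qed
  qed
  finally have sum: "(\<Sum>c\<in>\<C>. mass d l v c) = L" .
  have "\<C> \<noteq> {}"
    using y by auto
  then have card: "card \<C> > 0"
    using fin by (simp add: card_gt_0_iff)
  have "\<exists>c\<in>\<C>. L \<le> card \<C> * mass d l v c"
  proof (rule ccontr)
    assume "\<not> ?thesis"
    then have "(\<Sum>c\<in>\<C>. mass d l v c) < (\<Sum>c\<in>\<C>. L / card \<C>)"
      using card by (intro sum_strict_mono fin \<open>\<C> \<noteq> {}\<close>) (simp add: pos_less_divide_eq mult.commute not_le)
    then show False
      using sum card by simp
  qed
  then obtain c where "c \<in> \<C>" "L \<le> card \<C> * mass d l v c" ..
  then have "c \<in> level \<C> d l v s"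
    using s by (cases d) (auto simp: level_def threshold_def L_def)
  then show ?thesis
    by blast
qed

section \<open>Continuity and monotonicity of the sweep\<close>

definition chains :: "'a set set \<Rightarrow> 'a set set set" where
  "chains \<C> = {\<sigma>. \<sigma> \<subseteq> \<C> \<and> \<sigma> \<noteq> {} \<and> (\<forall>a\<in>\<sigma>. \<forall>b\<in>\<sigma>. a \<subseteq> b \<or> b \<subseteq> a)}"

text \<open>These are the only kinds of times at which a swept function can change: the start of a
  vertex, the split parameter, and the threshold of a value. The value at a time depends only on the
  set of breakpoints already passed, the form required by
  \<open>piecewise_step_continuous\<close>.\<close>

datatype 'c breakpoint = Vertex nat | Split | Weight 'c

text \<open>If \<open>\<Lambda>\<close> is the single parameter for which the window is all of \<open>[0, 1)\<close>, then \<open>j\<close> is irrelevant;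
  this case yields the homotopy inverse.\<close>

locale sweeping =
  fixes E :: "('o, 'm) category" and D :: "('p, 'n) category" and \<C> :: "'a set set"
    and \<pi> :: "'o \<Rightarrow> 'a set" and F :: "'a set set \<Rightarrow> 'p" and j :: "'o \<Rightarrow> 'p"
    and d :: bool and \<Lambda> :: "real set"
  assumes thin: "thin D" and finite: "finite \<C>"
    and \<pi>_in: "\<And>e. e \<in> objs E \<Longrightarrow> \<pi> e \<in> \<C>"
    and \<pi>_mono: "\<And>e e'. e \<in> objs E \<Longrightarrow> e' \<in> objs E \<Longrightarrow> leq E e e' \<Longrightarrow> \<pi> e \<subseteq> \<pi> e'"
    and F_in: "\<And>\<sigma>. \<sigma> \<in> chains \<C> \<Longrightarrow> F \<sigma> \<in> objs D"
    and F_mono: "\<And>\<sigma> \<tau>. \<sigma> \<in> chains \<C> \<Longrightarrow> \<tau> \<in> chains \<C> \<Longrightarrow> \<sigma> \<subseteq> \<tau> \<Longrightarrow>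
        if d then leq D (F \<tau>) (F \<sigma>) else leq D (F \<sigma>) (F \<tau>)"
    and \<Lambda>: "\<Lambda> \<subseteq> {0..1}" "compact \<Lambda>"
    and j_in: "\<And>e. \<Lambda> \<noteq> {if d then 0 else 1} \<Longrightarrow> e \<in> objs E \<Longrightarrow> j e \<in> objs D"
    and j_mono: "\<And>e e'. \<Lambda> \<noteq> {if d then 0 else 1} \<Longrightarrow> e \<in> objs E \<Longrightarrow> e' \<in> objs E \<Longrightarrow>
        leq E e e' \<Longrightarrow> leq D (j e) (j e')"
    and j_F: "\<And>e \<sigma>. \<Lambda> \<noteq> {if d then 0 else 1} \<Longrightarrow> e \<in> objs E \<Longrightarrow> \<sigma> \<in> chains \<C> \<Longrightarrow>
        (\<And>c. c \<in> \<sigma> \<Longrightarrow> if d then \<pi> e \<subseteq> c else c \<subseteq> \<pi> e) \<Longrightarrow>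
        if d then leq D (j e) (F \<sigma>) else leq D (F \<sigma>) (j e)"
begin

abbreviation "Sweep \<equiv> sweep \<C> d F \<pi> j"

context
  fixes n x
  assumes x: "x \<in> simps (nerve E) n"
begin

definition param_space :: "(real \<times> (nat \<Rightarrow> real)) topology" where
  "param_space = prod_topology (top_of_set \<Lambda>) (simplex_space n)"

definition breaks :: "'a set breakpoint set" where
  "breaks = Vertex ` {1..n} \<union> {Split} \<union> Weight ` \<C>"

definition position :: "'a set breakpoint \<Rightarrow> real \<times> (nat \<Rightarrow> real) \<Rightarrow> real" where
  "position k z = (case k of Vertex i \<Rightarrow> sum (snd z) {..<i} | Split \<Rightarrow> fst z
     | Weight c \<Rightarrow> threshold \<C> d (fst z) (\<lambda>s. \<pi> (step ((n, x), snd z) s)) c)"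

definition passed :: "real \<times> (nat \<Rightarrow> real) \<Rightarrow> real \<Rightarrow> 'a set breakpoint set" where
  "passed z s = {k \<in> breaks. position k z \<le> s}"

text \<open>Vertex 0 starts at time 0 and has no breakpoint, so the number of passed vertex
  breakpoints is the index of the active vertex.\<close>

definition state :: "'a set breakpoint set \<Rightarrow> 'p" where
  "state A = (if (Split \<in> A) = d then F {c \<in> \<C>. (Weight c \<in> A) \<noteq> d}
     else j (fst x (card {i \<in> {1..n}. Vertex i \<in> A})))"

lemma topspace_param: "z \<in> topspace param_space \<longleftrightarrow> fst z \<in> \<Lambda> \<and> snd z \<in> standard_simplex n"
  by (cases z) (simp add: param_space_def)

lemma step_x: "0 \<le> s \<Longrightarrow> s < 1 \<Longrightarrow> step ((n, x), t) s = fst x (bracket t s)"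
  by (rule step_apply)

lemma passed_simps:
  "Split \<in> passed z s \<longleftrightarrow> fst z \<le> s"
  "c \<in> \<C> \<Longrightarrow> Weight c \<in> passed z s \<longleftrightarrow> threshold \<C> d (fst z) (\<lambda>s. \<pi> (step ((n, x), snd z) s)) c \<le> s"
  "i \<in> {1..n} \<Longrightarrow> Vertex i \<in> passed z s \<longleftrightarrow> sum (snd z) {..<i} \<le> s"
  by (auto simp: passed_def breaks_def position_def)

lemma level_eq_passed:
  "{c \<in> \<C>. (Weight c \<in> passed z s) \<noteq> d} = level \<C> d (fst z) (\<lambda>s. \<pi> (step ((n, x), snd z) s)) s"
  unfolding level_def by (intro Collect_cong conj_cong refl) (simp only: passed_simps(2))

lemma card_passed:
  assumes "z \<in> topspace param_space" "0 \<le> s" "s < 1"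
  shows "card {i \<in> {1..n}. Vertex i \<in> passed z s} = bracket (snd z) s"
proof -
  have t: "snd z \<in> standard_simplex n"
    using assms by (simp add: topspace_param)
  have "Vertex i \<in> passed z s \<longleftrightarrow> i \<le> bracket (snd z) s" if "i \<in> {1..n}" for i
    unfolding passed_simps(3)[OF that] bracket_ge_iff[OF t assms(2,3)] ..
  then have "{i \<in> {1..n}. Vertex i \<in> passed z s} = {1..bracket (snd z) s}"
    using bracket_bounds(1)[OF t assms(2,3)] by auto
  then show ?thesis
    by simp
qed

lemma state_passed:
  assumes "z \<in> topspace param_space" "0 \<le> s" "s < 1"
  shows "state (passed z s) = Sweep (fst z) (step ((n, x), snd z)) s"
  unfolding state_def level_eq_passed card_passed[OF assms] passed_simps(1)
  using assms(2,3) by (simp add: sweep_def step_x)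

lemma vertex_in: "i \<le> n \<Longrightarrow> fst x i \<in> objs E"
  by (rule nerve_simps_D(1)[OF x])

lemma vertex_mono: "i \<le> k \<Longrightarrow> k \<le> n \<Longrightarrow> leq E (fst x i) (fst x k)"
  by (rule nerve_simps_D(2)[OF x])

lemma level_witness:
  assumes z: "z \<in> topspace param_space" and s: "(fst z \<le> s) = d" "0 \<le> s" "s < 1"
    and c: "c \<in> level \<C> d (fst z) (\<lambda>s. \<pi> (step ((n, x), snd z) s)) s"
  shows "\<exists>s'\<in>window d (fst z). 0 \<le> s' \<and> s' < 1 \<and> bracket (snd z) s' \<le> n \<and>
      c = \<pi> (fst x (bracket (snd z) s'))"
proof -
  obtain s' where s': "s' \<in> window d (fst z)" "\<pi> (step ((n, x), snd z) s') = c"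
    using level_in_window[OF c s] by auto
  have "fst z \<in> {0..1}" "snd z \<in> standard_simplex n"
    using z \<Lambda> by (auto simp: topspace_param)
  moreover from this s' have "0 \<le> s'" "s' < 1"
    by (auto simp: window_def split: if_splits)
  ultimately show ?thesis
    using s' bracket_bounds(1)[of "snd z" n s'] by (auto simp: step_x intro!: bexI[of _ s'])
qed

text \<open>Members of a level are values taken in the window, hence images under
  \<open>\<pi>\<close> of vertices of one simplex, and these are nested.\<close>

lemma level_chain:
  assumes z: "z \<in> topspace param_space" and s: "(fst z \<le> s) = d" "0 \<le> s" "s < 1"
  shows "level \<C> d (fst z) (\<lambda>s. \<pi> (step ((n, x), snd z) s)) s \<in> chains \<C>" (is "?L \<in> _")
proof -
  have "?L \<noteq> {}"
  proof (rule level_nonempty[where y = "\<lambda>i. \<pi> (fst x i)"])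
    show "snd z \<in> standard_simplex n" "0 \<le> fst z" "fst z \<le> 1"
      using z \<Lambda> by (auto simp: topspace_param)
  qed (use s finite vertex_in \<pi>_in step_x in auto)
  moreover have "a \<subseteq> b \<or> b \<subseteq> a" if ab: "a \<in> ?L" "b \<in> ?L" for a b
  proof -
    have "\<exists>i\<le>n. c = \<pi> (fst x i)" if "c \<in> ?L" for c
      using level_witness[OF z s that] by blast
    then obtain i k where "i \<le> n" "a = \<pi> (fst x i)" "k \<le> n" "b = \<pi> (fst x k)"
      using ab by meson
    then show ?thesis
      using \<pi>_mono vertex_in vertex_mono by (meson linear)
  qed
  ultimately show ?thesis
    by (auto simp: chains_def level_def)
qed

lemma continuous_position:
  assumes "k \<in> breaks"
  shows "continuous_map param_space euclideanreal (position k)"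
proof -
  have 1: "continuous_map param_space euclideanreal fst"
    unfolding param_space_def
    using continuous_map_fst continuous_map_into_fulltopology by blast
  have 2: "continuous_map param_space euclideanreal (\<lambda>z. sum (snd z) {..<i})" for i
  proof -
    have "continuous_map param_space (powertop_real UNIV) snd"
      unfolding param_space_def
      using continuous_map_snd continuous_map_into_fulltopology by blast
    then have "continuous_map param_space euclideanreal (\<lambda>z. snd z k)" for k
      by (simp add: continuous_map_componentwise_UNIV)
    then show ?thesis
      by (intro continuous_map_sum) auto
  qed
  have 3: "continuous_map param_space euclideanreal (\<lambda>z. piece d (fst z) (snd z) i)" for i
    unfolding piece_def
    by (cases d; simp only: if_True if_False;
        intro continuous_map_diff continuous_map_real_max continuous_map_real_min 1 2)
  have 4: "continuous_map param_space euclideanreal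
      (\<lambda>z. mass d (fst z) (\<lambda>s. \<pi> (step ((n, x), snd z) s)) c)" for c
  proof (rule continuous_map_eq)
    show "continuous_map param_space euclideanreal
        (\<lambda>z. \<Sum>i | i \<le> n \<and> \<pi> (fst x i) = c. piece d (fst z) (snd z) i)"
      by (intro continuous_map_sum 3) auto
    fix z assume "z \<in> topspace param_space"
    then have "0 \<le> fst z" "fst z \<le> 1" "snd z \<in> standard_simplex n"
      using \<Lambda> by (auto simp: topspace_param)
    then show "(\<Sum>i | i \<le> n \<and> \<pi> (fst x i) = c. piece d (fst z) (snd z) i) =
        mass d (fst z) (\<lambda>s. \<pi> (step ((n, x), snd z) s)) c"
      by (subst mass_step[where y = "\<lambda>i. \<pi> (fst x i)"]) (auto simp: step_x)
  qed
  show ?thesis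
  proof (cases k)
    case (Vertex i)
    then have "position k = (\<lambda>z. sum (snd z) {..<i})"
      by (simp add: position_def fun_eq_iff)
    then show ?thesis using 2 by simp
  next
    case Split
    then have "position k = fst"
      by (simp add: position_def fun_eq_iff)
    then show ?thesis using 1 by simp
  next
    case (Weight c)
    have "continuous_map param_space euclideanreal
      (\<lambda>z. threshold \<C> d (fst z) (\<lambda>s. \<pi> (step ((n, x), snd z) s)) c)"
    proof -
      have 5: "continuous_map param_space euclideanreal
          (\<lambda>z. card \<C> * mass d (fst z) (\<lambda>s. \<pi> (step ((n, x), snd z) s)) c)"
        by (rule continuous_map_real_mult_left[OF 4])
      have const: "continuous_map param_space euclideanreal (\<lambda>z. r)" for r
        by simp
      show ?thesis
        unfolding threshold_def
        using continuous_map_real_min[OF const[of 1] continuous_map_add[OF 1 5]]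
          continuous_map_real_max[OF const[of 0] continuous_map_diff[OF 1 5]]
        by (cases d) (simp_all only: if_True if_False)
    qed
    moreover have "position k = (\<lambda>z. threshold \<C> d (fst z) (\<lambda>s. \<pi> (step ((n, x), snd z) s)) c)"
      using Weight by (simp add: position_def fun_eq_iff)
    ultimately show ?thesis by simp
  qed
qed

lemma position_range:
  assumes "k \<in> breaks" "z \<in> topspace param_space"
  shows "0 \<le> position k z \<and> position k z \<le> 1"
proof -
  have "fst z \<in> {0..1}" and t: "snd z \<in> standard_simplex n"
    using assms(2) \<Lambda> by (auto simp: topspace_param)
  then show ?thesis
    using partial_sum_bounds[OF t] threshold_range by (cases k) (auto simp: position_def)
qed

lemma state_in:
  assumes z: "z \<in> topspace param_space" and s: "0 \<le> s" "s < 1"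
  shows "state (passed z s) \<in> objs D"
proof (cases "(fst z \<le> s) = d")
  case True
  then show ?thesis
    using level_chain[OF z True s] F_in by (simp add: state_passed z s sweep_def)
next
  case False
  \<comment> \<open>A time outside the window exists only if the parameter differs from the one with
    full window; thus the hypotheses on \<open>j\<close> become available.\<close>
  then have "\<Lambda> \<noteq> {if d then 0 else 1}"
    using s z by (auto simp: topspace_param split: if_splits)
  then show ?thesis
    using False j_in vertex_in bracket_bounds(1)[of "snd z" n s] z s
    by (simp add: state_passed sweep_def step_x topspace_param)
qed

text \<open>On either side of the split this is monotonicity of \<open>F\<close> or
  \<open>j\<close>. Across the split it is \<open>j_F\<close>, which needs every member of the chain
  to be comparable with the vertex on the other side. Two parameters are compared because a single
  simplex has to serve a whole region of parameters.\<close>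

lemma state_mono:
  assumes z: "z \<in> topspace param_space" and z': "z' \<in> topspace param_space"
    and s: "0 \<le> s" "s < 1" and s': "0 \<le> s'" "s' < 1"
    and compat: "\<And>k l. k \<in> breaks \<Longrightarrow> l \<in> breaks \<Longrightarrow> position k z < position l z \<Longrightarrow>
        position k z' \<le> position l z'"
    and sub: "passed z s \<subseteq> passed z' s'"
  shows "leq D (state (passed z s)) (state (passed z' s'))"
proof -
  have t: "snd z \<in> standard_simplex n" and t': "snd z' \<in> standard_simplex n"
    and l: "fst z \<in> {0..1}" "fst z' \<in> {0..1}"
    using z z' \<Lambda> by (auto simp: topspace_param)
  define i where "i = bracket (snd z) s"
  define i' where "i' = bracket (snd z') s'"
  have i: "i \<le> n" "i' \<le> n"
    using bracket_bounds(1) t t' s s' by (auto simp: i_def i'_def)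
  have state: "state (passed z s) = (if (Split \<in> passed z s) = d
      then F {c \<in> \<C>. (Weight c \<in> passed z s) \<noteq> d} else j (fst x i))"
    unfolding state_def card_passed[OF z s] i_def ..
  have state': "state (passed z' s') = (if (Split \<in> passed z' s') = d
      then F {c \<in> \<C>. (Weight c \<in> passed z' s') \<noteq> d} else j (fst x i'))"
    unfolding state_def card_passed[OF z' s'] i'_def ..
  \<comment> \<open>\<open>compat\<close> transfers strict inequalities only as weak ones: a vertex
    starting strictly before the split at \<open>z\<close> starts no later than the split at
    \<open>z'\<close>, and so has been reached at every time past the split there.\<close>
  have late: "b \<le> bracket (snd z') r'"
    if b: "b \<le> n" "sum (snd z) {..<b} < fst z" and r': "fst z' \<le> r'" "0 \<le> r'" "r' < 1" for b r'
  proof (cases "b = 0")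
    case False
    then have "Vertex b \<in> breaks" "Split \<in> breaks"
      using b by (auto simp: breaks_def)
    from compat[OF this] show ?thesis
      using b r' bracket_ge_iff[OF t'] by (auto simp: position_def)
  qed simp
  \<comment> \<open>Along \<open>sub\<close> the split can be gained but not lost, so each value of
    \<open>d\<close> leaves one mixed case.\<close>
  consider (FF) "(Split \<in> passed z s) = d" "(Split \<in> passed z' s') = d"
    | (up) d "Split \<notin> passed z s" "Split \<in> passed z' s'"
    | (down) "\<not> d" "Split \<notin> passed z s" "Split \<in> passed z' s'"
    | (jj) "(Split \<in> passed z s) \<noteq> d" "(Split \<in> passed z' s') \<noteq> d"
    using sub by blast
  then show ?thesis
  proof cases
    case FF
    then have L: "{c \<in> \<C>. (Weight c \<in> passed z s) \<noteq> d} \<in> chains \<C>"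
      and L': "{c \<in> \<C>. (Weight c \<in> passed z' s') \<noteq> d} \<in> chains \<C>"
      using level_chain[OF z _ s] level_chain[OF z' _ s'] unfolding level_eq_passed passed_simps(1)
      by blast+
    show ?thesis
    proof (cases d)
      case True
      then have "{c \<in> \<C>. (Weight c \<in> passed z' s') \<noteq> d} \<subseteq> {c \<in> \<C>. (Weight c \<in> passed z s) \<noteq> d}"
        using sub by blast
      from F_mono[OF L' L this] show ?thesis
        unfolding state state' using True FF by presburger
    next
      case False
      then have "{c \<in> \<C>. (Weight c \<in> passed z s) \<noteq> d} \<subseteq> {c \<in> \<C>. (Weight c \<in> passed z' s') \<noteq> d}"
        using sub by blast
      from F_mono[OF L L' this] show ?thesis
        unfolding state state' using False FF by presburger
    qed
  next
    case up
    then have s_less: "s < fst z" "fst z' \<le> s'"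
      unfolding passed_simps(1) by auto
    let ?L = "level \<C> d (fst z') (\<lambda>s. \<pi> (step ((n, x), snd z') s)) s'"
    have L: "?L \<in> chains \<C>"
      using level_chain[OF z' _ s'] up s_less by simp
    have ne: "\<Lambda> \<noteq> {if d then 0 else 1}"
      using s_less s z up by (auto simp: topspace_param)
    have "if d then \<pi> (fst x i) \<subseteq> c else c \<subseteq> \<pi> (fst x i)" if c: "c \<in> ?L" for c
    proof -
      obtain r where r: "r \<in> window d (fst z')" "0 \<le> r" "r < 1" "bracket (snd z') r \<le> n"
        "c = \<pi> (fst x (bracket (snd z') r))"
        using level_witness[OF z' _ s' c] up s_less by auto
      \<comment> \<open>At \<open>z\<close> vertex \<open>i\<close> starts by time \<open>s\<close>,
        strictly before the split; the members of the chain are values taken at \<open>z'\<close>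
        after the split.\<close>
      have "i \<le> bracket (snd z') r"
        using late[OF i(1)] bracket_bounds(2)[OF t s] s_less r up by (auto simp: i_def window_def)
      then show ?thesis
        using r up \<pi>_mono vertex_mono vertex_in i by auto
    qed
    from j_F[OF ne vertex_in[OF i(1)] L this] show ?thesis
      using up unfolding state state' level_eq_passed[symmetric] by simp
  next
    case down
    then have s_less: "s < fst z" "fst z' \<le> s'"
      unfolding passed_simps(1) by auto
    let ?L = "level \<C> d (fst z) (\<lambda>s. \<pi> (step ((n, x), snd z) s)) s"
    have L: "?L \<in> chains \<C>"
      using level_chain[OF z _ s] down s_less by simp
    have ne: "\<Lambda> \<noteq> {if d then 0 else 1}"
      using s_less s' z' down by (auto simp: topspace_param)
    have "if d then \<pi> (fst x i') \<subseteq> c else c \<subseteq> \<pi> (fst x i')" if c: "c \<in> ?L" for c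
    proof -
      obtain r where r: "r \<in> window d (fst z)" "0 \<le> r" "r < 1" "bracket (snd z) r \<le> n"
        "c = \<pi> (fst x (bracket (snd z) r))"
        using level_witness[OF z _ s c] down s_less by auto
      have "bracket (snd z) r \<le> i'"
        unfolding i'_def
        using late[OF r(4)] bracket_bounds(2)[OF t r(2,3)] s_less s' r down by (auto simp: window_def)
      then show ?thesis
        using r down \<pi>_mono vertex_mono vertex_in i by auto
    qed
    from j_F[OF ne vertex_in[OF i(2)] L this] show ?thesis
      using down unfolding state state' level_eq_passed[symmetric] by simp
  next
    case jj
    then have ne: "\<Lambda> \<noteq> {if d then 0 else 1}"
      using s z by (auto simp: passed_simps topspace_param split: if_splits)
    have "{k \<in> {1..n}. Vertex k \<in> passed z s} \<subseteq> {k \<in> {1..n}. Vertex k \<in> passed z' s'}"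
      using sub by auto
    from card_mono[OF _ this] have "i \<le> i'"
      unfolding card_passed[OF z s] card_passed[OF z' s'] i_def i'_def by simp
    then show ?thesis
      using jj ne j_mono vertex_mono vertex_in i by (simp add: state state')
  qed
qed

lemma sweep_simplex:
  shows "continuous_map param_space (realization (nerve D)) (\<lambda>z. pt D (Sweep (fst z) (step ((n, x), snd z))))"
    and "z \<in> topspace param_space \<Longrightarrow> realizable D (Sweep (fst z) (step ((n, x), snd z)))"
proof -
  have fin: "finite breaks"
    using finite by (simp add: breaks_def)
  have eq: "(\<lambda>s\<in>{0..<1}. state {k \<in> breaks. position k z \<le> s}) = Sweep (fst z) (step ((n, x), snd z))"
    if "z \<in> topspace param_space" for z
    using state_passed[OF that] by (intro ext) (simp add: restrict_def passed_def sweep_def)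
  have "continuous_map param_space (realization (nerve D))
      (\<lambda>z. pt D (\<lambda>s\<in>{0..<1}. state {k \<in> breaks. position k z \<le> s}))"
    by (rule piecewise_step_continuous(1)[OF thin fin])
      (rule continuous_position position_range state_in[unfolded passed_def]
        state_mono[unfolded passed_def]; assumption)+
  then show "continuous_map param_space (realization (nerve D))
      (\<lambda>z. pt D (Sweep (fst z) (step ((n, x), snd z))))"
    by (rule continuous_map_eq) (simp only: eq)
  show "realizable D (Sweep (fst z) (step ((n, x), snd z)))" if z: "z \<in> topspace param_space"
    unfolding eq[OF z, symmetric]
    by (rule piecewise_step_continuous(2)[OF thin fin _ _ _ _ z])
      (rule continuous_position position_range state_in[unfolded passed_def]
        state_mono[unfolded passed_def]; assumption)+
qed

end

lemma sweep_realizable: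
  assumes "l \<in> \<Lambda>" "c \<in> topspace (realization (nerve E))"
  shows "realizable D (Sweep l (val c))"
proof -
  obtain n x t where xt: "((n, x), t) \<in> points (nerve E)" and c: "c = glue_class (nerve E) ((n, x), t)"
    using assms(2) by (auto simp: topspace_realization)
  then show ?thesis
    using sweep_simplex(2)[of x n "(l, t)"] topspace_param[of x n "(l, t)"] assms(1)
    by (simp add: points_iff val_glue_class)
qed

lemma level_val_chain:
  assumes "l \<in> \<Lambda>" "c \<in> topspace (realization (nerve E))" "(l \<le> s) = d" "0 \<le> s" "s < 1"
  shows "level \<C> d l (\<lambda>s. \<pi> (val c s)) s \<in> chains \<C>"
proof -
  obtain n x t where xt: "((n, x), t) \<in> points (nerve E)" and c: "c = glue_class (nerve E) ((n, x), t)"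
    using assms(2) by (auto simp: topspace_realization)
  then show ?thesis
    using level_chain[of x n "(l, t)" s] topspace_param[of x n "(l, t)"] assms(1,3,4,5)
    by (simp add: points_iff val_glue_class)
qed

text \<open>Compactness of \<open>\<Lambda>\<close> supplies the local compactness that reduces the
  claim to single simplices.\<close>

lemma sweep_continuous:
  "continuous_map (prod_topology (top_of_set \<Lambda>) (realization (nerve E))) (realization (nerve D))
     (\<lambda>(l, c). pt D (Sweep l (val c)))"
proof (rule continuous_map_prod_realization)
  show "Hausdorff_space (top_of_set \<Lambda>)"
    by (intro Hausdorff_space_subtopology Hausdorff_space_euclidean)
  show "locally_compact_space (top_of_set \<Lambda>)"
    using \<Lambda> by (intro compact_imp_locally_compact_space) (simp add: compact_space_subtopology)
  fix n x assume x: "x \<in> simps (nerve E) n"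
  from sweep_simplex(1)[OF x]
  show "continuous_map (prod_topology (top_of_set \<Lambda>) (simplex_space n)) (realization (nerve D))
      (\<lambda>(z, t). case (z, glue_class (nerve E) ((n, x), t)) of (l, c) \<Rightarrow> pt D (Sweep l (val c)))"
    unfolding param_space_def[OF x] by (simp add: val_glue_class case_prod_unfold)
qed

end

section \<open>Equivariant equivalences over a finite poset\<close>

lemma continuous_realization_map:
  assumes F: "is_functor C D F"
  shows "continuous_map (realization (nerve C)) (realization (nerve D))
    (realization_map (nerve D) (nerve_map F))" (is "continuous_map ?X ?Y ?f")
proof -
  \<comment> \<open>A one-point factor turns the criterion for products into one for the realization
    alone.\<close>
  have cont: "continuous_map (prod_topology (top_of_set {0::real}) ?X) ?Y (\<lambda>(z, c). ?f c)"
  proof (rule continuous_map_prod_realization)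
    show "Hausdorff_space (top_of_set {0::real})"
      by (intro Hausdorff_space_subtopology Hausdorff_space_euclidean)
    show "locally_compact_space (top_of_set {0::real})"
      by (intro compact_imp_locally_compact_space) (simp add: compact_space_subtopology)
    fix n x assume x: "x \<in> simps (nerve C) n"
    have "?f (glue_class (nerve C) ((n, x), t)) = glue_class (nerve D) ((n, nerve_map F n x), t)" for t
      by (rule realization_map_glue_class) (use F in \<open>auto intro: nerve_map_simps nerve_map_oper\<close>)
    then show "continuous_map (prod_topology (top_of_set {0::real}) (simplex_space n)) ?Y
        (\<lambda>(z, t). case (z, glue_class (nerve C) ((n, x), t)) of (z, c) \<Rightarrow> ?f c)"
      using continuous_map_of_snd[THEN iffD2, OF disjI2,
          OF continuous_map_glue_class[OF nerve_map_simps[OF F x]]]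
      by (simp add: case_prod_unfold o_def)
  qed
  have "continuous_map ?X (prod_topology (top_of_set {0::real}) ?X) (\<lambda>c. (0, c))"
    by (simp add: continuous_map_pairwise o_def)
  from continuous_map_compose[OF this cont] show ?thesis
    by (simp add: o_def)
qed

lemma val_restrict:
  assumes "c \<in> topspace (realization (nerve D))"
  shows "(\<lambda>s\<in>{0..<1}. val c s) = val c"
proof -
  obtain n x t where "((n, x), t) \<in> points (nerve D)" "c = glue_class (nerve D) ((n, x), t)"
    using assms by (auto simp: topspace_realization)
  then show ?thesis
    by (intro ext) (simp add: val_glue_class step_def)
qed

lemma level_cong:
  assumes "0 \<le> l" "l \<le> 1" "\<And>s. 0 \<le> s \<Longrightarrow> s < 1 \<Longrightarrow> v s = w s"
  shows "level \<C> d l v s = level \<C> d l w s"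
proof -
  have "mass d l v = mass d l w"
    by (intro ext mass_cong assms) (simp add: assms(3))
  then show ?thesis
    by (simp only: level_def threshold_def)
qed

text \<open>Relabelling values by a permutation of \<open>\<C>\<close> preserves the time spent on
  them, so thresholds and levels are carried along. This is the source of equivariance of the
  sweep.\<close>

lemma level_image:
  assumes l: "0 \<le> l" "l \<le> 1" and v: "\<And>s. 0 \<le> s \<Longrightarrow> s < 1 \<Longrightarrow> v s \<in> \<C>"
    and w: "\<And>s. 0 \<le> s \<Longrightarrow> s < 1 \<Longrightarrow> w s = \<nu> (v s)" and \<nu>: "bij_betw \<nu> \<C> \<C>"
  shows "level \<C> d l w s = \<nu> ` level \<C> d l v s"
proof -
  have inj: "inj_on \<nu> \<C>" and img: "\<nu> ` \<C> = \<C>"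
    using \<nu> by (auto simp: bij_betw_def)
  have "threshold \<C> d l w (\<nu> c) = threshold \<C> d l v c" if "c \<in> \<C>" for c
  proof -
    have "mass d l w (\<nu> c) = mass d l v c"
      by (rule mass_cong[OF l]) (use v w inj that in \<open>auto simp: inj_on_eq_iff\<close>)
    then show ?thesis
      by (simp only: threshold_def)
  qed
  then have "\<nu> c \<in> level \<C> d l w s \<longleftrightarrow> c \<in> level \<C> d l v s" if "c \<in> \<C>" for c
    using that img unfolding level_def by auto
  moreover have "level \<C> d l w s \<subseteq> \<nu> ` \<C>" "level \<C> d l v s \<subseteq> \<C>"
    using img by (auto simp: level_def)
  ultimately show ?thesis
    by blast
qed

lemma leq_poset_cat: "leq (poset_cat \<C>) A B \<longleftrightarrow> A \<subseteq> B"
  by (auto simp: leq_def poset_cat_def)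

lemma objs_poset_cat [simp]: "objs (poset_cat \<C>) = \<C>"
  by (simp add: poset_cat_def)

lemma thin_poset_cat: "thin (poset_cat \<C>)"
  using is_category_poset_cat[of \<C>] by (auto simp: thin_def)

lemma leq_functor:
  assumes "is_functor C D F" "x \<in> objs C" "y \<in> objs C" "leq C x y"
  shows "leq D (fobj F x) (fobj F y)"
  using assms unfolding is_functor_def leq_def by blast

text \<open>With thinness, \<open>full\<close> makes \<open>P\<close> fully faithful; hence the
  lifts \<open>F \<sigma>\<close> need to be compared only after applying \<open>P\<close>.\<close>

locale equivariant_sweep =
  fixes E :: "('o, 'm) category" and \<C> :: "'a set set" and P :: "('o, 'm, 'a set, unit) cat_functor"
    and S :: "'g set" and \<mu> :: "'g \<Rightarrow> ('o, 'm, 'o, 'm) cat_functor"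
    and \<nu> :: "'g \<Rightarrow> ('a set, unit, 'a set, unit) cat_functor"
    and F :: "'a set set \<Rightarrow> 'o" and d :: bool
  assumes thin: "thin E" and fin: "finite \<C>"
    and P: "is_functor E (poset_cat \<C>) P"
    and full: "\<And>x y. x \<in> objs E \<Longrightarrow> y \<in> objs E \<Longrightarrow> fobj P x \<subseteq> fobj P y \<Longrightarrow> leq E x y"
    and \<mu>: "\<And>g. g \<in> S \<Longrightarrow> is_functor E E (\<mu> g)"
    and \<nu>: "\<And>g. g \<in> S \<Longrightarrow> is_functor (poset_cat \<C>) (poset_cat \<C>) (\<nu> g)"
    and \<nu>_inj: "\<And>g. g \<in> S \<Longrightarrow> inj_on (fobj (\<nu> g)) \<C>"
    and P_equivariant: "\<And>g x. g \<in> S \<Longrightarrow> x \<in> objs E \<Longrightarrow>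
        fobj P (fobj (\<mu> g) x) = fobj (\<nu> g) (fobj P x)"
    and F_in: "\<And>\<sigma>. \<sigma> \<in> chains \<C> \<Longrightarrow> F \<sigma> \<in> objs E"
    and F_equivariant: "\<And>g \<sigma>. g \<in> S \<Longrightarrow> \<sigma> \<in> chains \<C> \<Longrightarrow> F (fobj (\<nu> g) ` \<sigma>) = fobj (\<mu> g) (F \<sigma>)"
    and F_mono: "\<And>\<sigma> \<tau>. \<sigma> \<in> chains \<C> \<Longrightarrow> \<tau> \<in> chains \<C> \<Longrightarrow> \<sigma> \<subseteq> \<tau> \<Longrightarrow>
        if d then fobj P (F \<tau>) \<subseteq> fobj P (F \<sigma>) else fobj P (F \<sigma>) \<subseteq> fobj P (F \<tau>)"
    and F_bound: "\<And>\<sigma>. \<sigma> \<in> chains \<C> \<Longrightarrow>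
        if d then \<Inter>\<sigma> \<subseteq> fobj P (F \<sigma>) else fobj P (F \<sigma>) \<subseteq> \<Union>\<sigma>"
begin

abbreviation "\<pi> \<equiv> fobj P"
abbreviation "C \<equiv> poset_cat \<C>"
abbreviation "f \<equiv> realization_map (nerve C) (nerve_map P)"
abbreviation "m g \<equiv> realization_map (nerve E) (nerve_map (\<mu> g))"
abbreviation "n g \<equiv> realization_map (nerve C) (nerve_map (\<nu> g))"
abbreviation "X \<equiv> realization (nerve E)"
abbreviation "Y \<equiv> realization (nerve C)"

definition l0 :: real where "l0 = (if d then 0 else 1)"
text \<open>At \<open>l0\<close> the window is everything and \<open>F\<close> is applied at every
  time, so the \<open>undefined\<close> branch is never reached on \<open>[0, 1)\<close>.\<close>

definition h where "h c = pt E (sweep \<C> d F (\<lambda>c. c) (\<lambda>_. undefined) l0 (val c))"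

lemma l0_range: "0 \<le> l0" "l0 \<le> 1"
  by (simp_all add: l0_def)

lemma l0_active: "0 \<le> s \<Longrightarrow> s < 1 \<Longrightarrow> (l0 \<le> s) = d"
  by (simp add: l0_def)

lemma \<pi>_in: "x \<in> objs E \<Longrightarrow> \<pi> x \<in> \<C>"
  using P by (simp add: is_functor_def)

lemma \<pi>_mono: "x \<in> objs E \<Longrightarrow> y \<in> objs E \<Longrightarrow> leq E x y \<Longrightarrow> \<pi> x \<subseteq> \<pi> y"
  using leq_functor[OF P] by (simp add: leq_poset_cat)

lemma \<nu>_bij: "g \<in> S \<Longrightarrow> bij_betw (fobj (\<nu> g)) \<C> \<C>"
  using \<nu>[of g] \<nu>_inj[of g] fin endo_inj_surj[OF fin, of "fobj (\<nu> g)"]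
  by (auto simp: bij_betw_def is_functor_def)

lemma F_leq:
  assumes "\<sigma> \<in> chains \<C>" "\<tau> \<in> chains \<C>" "\<sigma> \<subseteq> \<tau>"
  shows "if d then leq E (F \<tau>) (F \<sigma>) else leq E (F \<sigma>) (F \<tau>)"
  using F_mono[OF assms] full F_in assms(1,2) by presburger

lemma \<pi>_F:
  assumes "\<sigma> \<in> chains \<C>" "\<And>c. c \<in> \<sigma> \<Longrightarrow> if d then B \<subseteq> c else c \<subseteq> B"
  shows "if d then B \<subseteq> \<pi> (F \<sigma>) else \<pi> (F \<sigma>) \<subseteq> B"
proof (cases d)
  case True
  then have "B \<subseteq> \<Inter>\<sigma>"
    using assms(2) by auto
  then show ?thesis
    using True F_bound[OF assms(1)] by auto
next
  case False
  then have "\<Union>\<sigma> \<subseteq> B"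
    using assms(2) by auto
  then show ?thesis
    using False F_bound[OF assms(1)] by auto
qed

text \<open>The sweeps with the identity for \<open>j\<close>, over \<open>E\<close> and over
  \<open>C\<close>, are the homotopies for the two composites; the sweep from \<open>C\<close> to
  \<open>E\<close> at the single parameter \<open>l0\<close> is the inverse.\<close>

sublocale EE: sweeping E E \<C> \<pi> F "\<lambda>x. x" d "{0..1}"
proof
  show "if d then leq E e (F \<sigma>) else leq E (F \<sigma>) e"
    if "e \<in> objs E" "\<sigma> \<in> chains \<C>" "\<And>c. c \<in> \<sigma> \<Longrightarrow> if d then \<pi> e \<subseteq> c else c \<subseteq> \<pi> e" for e \<sigma>
    using \<pi>_F[OF that(2,3)] full that(1) F_in[OF that(2)] by presburger
qed (use thin fin \<pi>_in \<pi>_mono F_in F_leq in auto)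

sublocale CC: sweeping C C \<C> "\<lambda>c. c" "\<lambda>\<sigma>. \<pi> (F \<sigma>)" "\<lambda>c. c" d "{0..1}"
proof
  show "if d then leq C e (\<pi> (F \<sigma>)) else leq C (\<pi> (F \<sigma>)) e"
    if "\<sigma> \<in> chains \<C>" "\<And>c. c \<in> \<sigma> \<Longrightarrow> if d then e \<subseteq> c else c \<subseteq> e" for e \<sigma>
    using \<pi>_F[OF that] by (simp add: leq_poset_cat)
  show "if d then leq C (\<pi> (F \<tau>)) (\<pi> (F \<sigma>)) else leq C (\<pi> (F \<sigma>)) (\<pi> (F \<tau>))"
    if "\<sigma> \<in> chains \<C>" "\<tau> \<in> chains \<C>" "\<sigma> \<subseteq> \<tau>" for \<sigma> \<tau>
    using F_mono[OF that] by (simp add: leq_poset_cat)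
qed (use thin_poset_cat fin \<pi>_in F_in in \<open>auto simp: leq_poset_cat\<close>)

sublocale CE: sweeping C E \<C> "\<lambda>c. c" F "\<lambda>_. undefined" d "{l0}"
proof
  show "if d then leq E (F \<tau>) (F \<sigma>) else leq E (F \<sigma>) (F \<tau>)"
    if "\<sigma> \<in> chains \<C>" "\<tau> \<in> chains \<C>" "\<sigma> \<subseteq> \<tau>" for \<sigma> \<tau>
    by (rule F_leq[OF that])
qed (use thin fin F_in in \<open>auto simp: leq_poset_cat l0_def\<close>)

lemma f_val:
  assumes "c \<in> topspace X"
  shows "f c \<in> topspace Y" "val (f c) = (\<lambda>s\<in>{0..<1}. \<pi> (val c s))"
  using realization_map_nerve_map[OF P assms] by auto

lemma m_val:
  assumes "g \<in> S" "c \<in> topspace X"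
  shows "m g c \<in> topspace X" "val (m g c) = (\<lambda>s\<in>{0..<1}. fobj (\<mu> g) (val c s))"
  using realization_map_nerve_map[OF \<mu>[OF assms(1)] assms(2)] by auto

lemma n_val:
  assumes "g \<in> S" "c \<in> topspace Y"
  shows "n g c \<in> topspace Y" "val (n g c) = (\<lambda>s\<in>{0..<1}. fobj (\<nu> g) (val c s))"
  using realization_map_nerve_map[OF \<nu>[OF assms(1)] assms(2)] by auto

lemma h_val:
  assumes "c \<in> topspace Y"
  shows "h c \<in> topspace X" "val (h c) = sweep \<C> d F (\<lambda>c. c) (\<lambda>_. undefined) l0 (val c)"
  using realizable_pt[OF thin CE.sweep_realizable[OF _ assms]] by (simp_all add: h_def)

lemma X_eqI: "c \<in> topspace X \<Longrightarrow> c' \<in> topspace X \<Longrightarrow> val c = val c' \<Longrightarrow> c = c'"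
  by (rule inj_onD[OF inj_on_val[OF thin]])

lemma Y_eqI: "c \<in> topspace Y \<Longrightarrow> c' \<in> topspace Y \<Longrightarrow> val c = val c' \<Longrightarrow> c = c'"
  by (rule inj_onD[OF inj_on_val[OF thin_poset_cat]])

lemma f_equivariant: "equivariant_on S (topspace X) m n f"
  unfolding equivariant_on_def
proof (intro ballI)
  fix g c assume g: "g \<in> S" and c: "c \<in> topspace X"
  show "f (m g c) = n g (f c)"
  proof (rule Y_eqI)
    show "val (f (m g c)) = val (n g (f c))"
      using g c by (simp add: f_val m_val n_val P_equivariant val_in_objs cong: restrict_cong)
  qed (simp_all add: f_val m_val n_val g c)
qed

lemma EE_equivariant:
  assumes g: "g \<in> S" and c: "c \<in> topspace X" and l: "l \<in> {0..1}"
  shows "sweep \<C> d F \<pi> (\<lambda>x. x) l (val (m g c)) =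
    (\<lambda>s\<in>{0..<1}. fobj (\<mu> g) (sweep \<C> d F \<pi> (\<lambda>x. x) l (val c) s))"
proof (rule ext)
  fix s
  show "sweep \<C> d F \<pi> (\<lambda>x. x) l (val (m g c)) s =
    (\<lambda>s\<in>{0..<1}. fobj (\<mu> g) (sweep \<C> d F \<pi> (\<lambda>x. x) l (val c) s)) s"
  proof (cases "0 \<le> s \<and> s < 1 \<and> (l \<le> s) = d")
    case True
    have "level \<C> d l (\<lambda>s. \<pi> (val (m g c) s)) s = fobj (\<nu> g) ` level \<C> d l (\<lambda>s. \<pi> (val c s)) s"
      using c g l by (intro level_image \<nu>_bij)
        (auto simp: m_val P_equivariant val_in_objs \<pi>_in)
    moreover have "level \<C> d l (\<lambda>s. \<pi> (val c s)) s \<in> chains \<C>"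
      using EE.level_val_chain[OF l c] True by blast
    ultimately show ?thesis
      using True g by (simp add: sweep_def F_equivariant)
  next
    case False
    then show ?thesis
      using g c by (auto simp: sweep_def m_val)
  qed
qed

lemma CC_equivariant:
  assumes g: "g \<in> S" and c: "c \<in> topspace Y" and l: "l \<in> {0..1}"
  shows "sweep \<C> d (\<lambda>\<sigma>. \<pi> (F \<sigma>)) (\<lambda>x. x) (\<lambda>x. x) l (val (n g c)) =
    (\<lambda>s\<in>{0..<1}. fobj (\<nu> g) (sweep \<C> d (\<lambda>\<sigma>. \<pi> (F \<sigma>)) (\<lambda>x. x) (\<lambda>x. x) l (val c) s))"
proof (rule ext)
  fix s
  show "sweep \<C> d (\<lambda>\<sigma>. \<pi> (F \<sigma>)) (\<lambda>x. x) (\<lambda>x. x) l (val (n g c)) s =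
    (\<lambda>s\<in>{0..<1}. fobj (\<nu> g) (sweep \<C> d (\<lambda>\<sigma>. \<pi> (F \<sigma>)) (\<lambda>x. x) (\<lambda>x. x) l (val c) s)) s"
  proof (cases "0 \<le> s \<and> s < 1 \<and> (l \<le> s) = d")
    case True
    have "level \<C> d l (val (n g c)) s = fobj (\<nu> g) ` level \<C> d l (val c) s"
      using c g l val_in_objs[OF c] by (intro level_image \<nu>_bij) (auto simp: n_val)
    moreover have "level \<C> d l (val c) s \<in> chains \<C>"
      using CC.level_val_chain[OF l c] True by blast
    ultimately show ?thesis
      using True g by (simp add: sweep_def F_equivariant P_equivariant F_in)
  next
    case False
    then show ?thesis
      using g c by (auto simp: sweep_def n_val)
  qed
qed

lemma h_equivariant: "equivariant_on S (topspace Y) n m h"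
  unfolding equivariant_on_def
proof (intro ballI)
  fix g c assume g: "g \<in> S" and c: "c \<in> topspace Y"
  show "h (n g c) = m g (h c)"
  proof (rule X_eqI)
    show "val (h (n g c)) = val (m g (h c))"
    proof (rule ext)
      fix s
      show "val (h (n g c)) s = val (m g (h c)) s"
      proof (cases "0 \<le> s \<and> s < 1")
        case True
        have "level \<C> d l0 (val (n g c)) s = fobj (\<nu> g) ` level \<C> d l0 (val c) s"
          using c g l0_range val_in_objs[OF c] by (intro level_image \<nu>_bij) (auto simp: n_val)
        moreover have "level \<C> d l0 (val c) s \<in> chains \<C>"
          using CE.level_val_chain[OF _ c] True l0_active by blast
        ultimately show ?thesis
          using True g c l0_active[of s] by (simp add: h_val n_val(1) m_val sweep_def F_equivariant)
      qed (use g c in \<open>auto simp: h_val n_val(1) m_val sweep_def\<close>)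
    qed
  qed (simp_all add: h_val m_val n_val g c)
qed

lemma h_continuous: "continuous_map Y X h"
proof -
  have "continuous_map Y (prod_topology (top_of_set {l0}) Y) (\<lambda>c. (l0, c))"
    by (simp add: continuous_map_pairwise o_def)
  from continuous_map_compose[OF this CE.sweep_continuous] show ?thesis
    by (simp add: o_def h_def[abs_def])
qed

text \<open>The sweep is the composite at \<open>l0\<close> and the identity at
  \<open>1 - l0\<close>. For \<open>d\<close> this is the required direction of time; otherwise the
  homotopy runs backwards and is reversed by symmetry.\<close>

lemma homotopic_id:
  fixes Z :: "'z topology"
  assumes k: "continuous_map (prod_topology (top_of_set {0..1}) Z) Z k"
    and k0: "\<And>x. x \<in> topspace Z \<Longrightarrow> k (l0, x) = q x"
    and k1: "\<And>x. x \<in> topspace Z \<Longrightarrow> k (1 - l0, x) = x"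
    and act: "\<And>g x. g \<in> S \<Longrightarrow> x \<in> topspace Z \<Longrightarrow> a g x \<in> topspace Z"
    and equiv: "\<And>g x l. g \<in> S \<Longrightarrow> x \<in> topspace Z \<Longrightarrow> l \<in> {0..1} \<Longrightarrow> k (l, a g x) = a g (k (l, x))"
  shows "homotopic_with (equivariant_on S (topspace Z) a a) Z Z q id"
proof -
  \<comment> \<open>The homotopy criterion wants a property that depends only on values on
    \<open>Z\<close>; \<open>act\<close> ensures this, as the translates of points of
    \<open>Z\<close> remain in \<open>Z\<close>.\<close>
  have cong: "equivariant_on S (topspace Z) a a r \<longleftrightarrow> equivariant_on S (topspace Z) a a r'"
    if "\<And>x. x \<in> topspace Z \<Longrightarrow> r x = r' x" for r r'
    using that act by (simp add: equivariant_on_def)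
  have eq: "equivariant_on S (topspace Z) a a (\<lambda>x. k (l, x))" if "l \<in> {0..1}" for l
    using equiv that by (simp add: equivariant_on_def)
  have iff: "homotopic_with (equivariant_on S (topspace Z) a a) Z Z r r' \<longleftrightarrow>
      (\<exists>h. continuous_map (prod_topology (top_of_set {0..1::real}) Z) Z h \<and>
        (\<forall>x\<in>topspace Z. h (0, x) = r x) \<and> (\<forall>x\<in>topspace Z. h (1, x) = r' x) \<and>
        (\<forall>t\<in>{0..1}. equivariant_on S (topspace Z) a a (\<lambda>x. h (t, x))))" for r r'
    by (rule homotopic_with) (rule cong, blast)
  show ?thesis
  proof (cases d)
    case True
    then have "l0 = 0"
      unfolding l0_def by simp
    then show ?thesis
      unfolding iff using k k0 k1 eq by (intro exI[of _ k]) simp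
  next
    case False
    then have "l0 = 1"
      unfolding l0_def by simp
    then have "homotopic_with (equivariant_on S (topspace Z) a a) Z Z id q"
      unfolding iff using k k0 k1 eq by (intro exI[of _ k]) simp
    then show ?thesis
      by (rule homotopic_with_symD)
  qed
qed

theorem homotopy_equivalence: "nerve_equivariant_homotopy_equivalence S E \<mu> C \<nu> P"
  unfolding nerve_equivariant_homotopy_equivalence_def equivariant_homotopy_equivalence_def
proof (intro conjI exI)
  show "continuous_map X Y f"
    by (rule continuous_realization_map[OF P])
  show "equivariant_on S (topspace X) m n f"
    by (rule f_equivariant)
  show "continuous_map Y X h"
    by (rule h_continuous)
  show "equivariant_on S (topspace Y) n m h"
    by (rule h_equivariant)
  have l01: "l0 \<in> {0..1}" "1 - l0 \<in> {0..1}"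
    using l0_range by auto
  have l1_active: "(1 - l0 \<le> s) \<noteq> d" if "0 \<le> s" "s < 1" for s
    using that by (auto simp: l0_def)
  note EE_pt = realizable_pt[OF thin EE.sweep_realizable]
  note CC_pt = realizable_pt[OF thin_poset_cat CC.sweep_realizable]
  show "homotopic_with (equivariant_on S (topspace X) m m) X X (h \<circ> f) id"
  proof (rule homotopic_id[OF EE.sweep_continuous])
    fix c assume c: "c \<in> topspace X"
    have "level \<C> d l0 (\<lambda>s. \<pi> (val c s)) s = level \<C> d l0 (val (f c)) s" for s
      using c by (intro level_cong l0_range) (simp add: f_val)
    then have "sweep \<C> d F \<pi> (\<lambda>x. x) l0 (val c) =
        sweep \<C> d F (\<lambda>c. c) (\<lambda>_. undefined) l0 (val (f c))"
      unfolding sweep_def by (intro restrict_ext) (simp add: l0_active)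
    then show "(case (l0, c) of (l, c) \<Rightarrow> pt E (sweep \<C> d F \<pi> (\<lambda>x. x) l (val c))) = (h \<circ> f) c"
      by (simp add: h_def)
    have "sweep \<C> d F \<pi> (\<lambda>x. x) (1 - l0) (val c) = (\<lambda>s\<in>{0..<1}. val c s)"
      unfolding sweep_def by (intro restrict_ext) (simp add: l1_active)
    then show "(case (1 - l0, c) of (l, c) \<Rightarrow> pt E (sweep \<C> d F \<pi> (\<lambda>x. x) l (val c))) = c"
      using c by (simp add: val_restrict pt_val thin)
    fix g assume g: "g \<in> S"
    show "m g c \<in> topspace X"
      by (rule m_val[OF g c])
    fix l :: real assume l: "l \<in> {0..1}"
    show "(case (l, m g c) of (l, c) \<Rightarrow> pt E (sweep \<C> d F \<pi> (\<lambda>x. x) l (val c))) =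
        m g (case (l, c) of (l, c) \<Rightarrow> pt E (sweep \<C> d F \<pi> (\<lambda>x. x) l (val c)))"
      unfolding prod.case
    proof (rule X_eqI)
      show "val (pt E (sweep \<C> d F \<pi> (\<lambda>x. x) l (val (m g c)))) =
          val (m g (pt E (sweep \<C> d F \<pi> (\<lambda>x. x) l (val c))))"
        unfolding m_val(2)[OF g EE_pt(1)[OF l c]] EE_pt(2)[OF l c] EE_pt(2)[OF l m_val(1)[OF g c]]
        by (rule EE_equivariant[OF g c l])
    qed (use EE_pt[OF l c] EE_pt[OF l m_val(1)[OF g c]] m_val(1)[OF g] in auto)
  qed
  show "homotopic_with (equivariant_on S (topspace Y) n n) Y Y (f \<circ> h) id"
  proof (rule homotopic_id[OF CC.sweep_continuous])
    fix c assume c: "c \<in> topspace Y"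
    have "sweep \<C> d (\<lambda>\<sigma>. \<pi> (F \<sigma>)) (\<lambda>x. x) (\<lambda>x. x) l0 (val c) = val (f (h c))"
      using c by (intro ext) (simp add: h_val f_val sweep_def l0_active restrict_def)
    then show "(case (l0, c) of (l, c) \<Rightarrow> pt C (sweep \<C> d (\<lambda>\<sigma>. \<pi> (F \<sigma>)) (\<lambda>x. x) (\<lambda>x. x) l (val c))) =
        (f \<circ> h) c"
      using pt_val[OF thin_poset_cat f_val(1)[OF h_val(1)[OF c]]] by simp
    have "sweep \<C> d (\<lambda>\<sigma>. \<pi> (F \<sigma>)) (\<lambda>x. x) (\<lambda>x. x) (1 - l0) (val c) = (\<lambda>s\<in>{0..<1}. val c s)"
      unfolding sweep_def by (intro restrict_ext) (simp add: l1_active)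
    then show "(case (1 - l0, c) of (l, c) \<Rightarrow> pt C (sweep \<C> d (\<lambda>\<sigma>. \<pi> (F \<sigma>)) (\<lambda>x. x) (\<lambda>x. x) l (val c))) = c"
      using c by (simp add: val_restrict pt_val thin_poset_cat)
    fix g assume g: "g \<in> S"
    show "n g c \<in> topspace Y"
      by (rule n_val[OF g c])
    fix l :: real assume l: "l \<in> {0..1}"
    show "(case (l, n g c) of (l, c) \<Rightarrow> pt C (sweep \<C> d (\<lambda>\<sigma>. \<pi> (F \<sigma>)) (\<lambda>x. x) (\<lambda>x. x) l (val c))) =
        n g (case (l, c) of (l, c) \<Rightarrow> pt C (sweep \<C> d (\<lambda>\<sigma>. \<pi> (F \<sigma>)) (\<lambda>x. x) (\<lambda>x. x) l (val c)))"
      unfolding prod.case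
    proof (rule Y_eqI)
      show "val (pt C (sweep \<C> d (\<lambda>\<sigma>. \<pi> (F \<sigma>)) (\<lambda>x. x) (\<lambda>x. x) l (val (n g c)))) =
          val (n g (pt C (sweep \<C> d (\<lambda>\<sigma>. \<pi> (F \<sigma>)) (\<lambda>x. x) (\<lambda>x. x) l (val c))))"
        unfolding n_val(2)[OF g CC_pt(1)[OF l c]] CC_pt(2)[OF l c] CC_pt(2)[OF l n_val(1)[OF g c]]
        by (rule CC_equivariant[OF g c l])
    qed (use CC_pt[OF l c] CC_pt[OF l n_val(1)[OF g c]] n_val(1)[OF g] in auto)
  qed
qed

end

section \<open>Finite \<open>p\<close>-groups\<close>

context group
begin

text \<open>Choose one representative per orbit, use \<open>base\<close> there, and transport along
  the orbit. Two elements carrying the representative to the same point differ by an element of its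
  stabilizer, which fixes the base value. Away from representatives the result may differ from
  \<open>base\<close>.\<close>

lemma equivariant_lift:
  assumes S: "subgroup S G"
    and a_in: "\<And>g x. g \<in> S \<Longrightarrow> x \<in> A \<Longrightarrow> a g x \<in> A"
    and a_one: "\<And>x. x \<in> A \<Longrightarrow> a \<one> x = x"
    and a_mult: "\<And>g h x. g \<in> S \<Longrightarrow> h \<in> S \<Longrightarrow> x \<in> A \<Longrightarrow> a (g \<otimes> h) x = a g (a h x)"
    and base: "\<And>x. x \<in> A \<Longrightarrow> base x \<in> B"
    and b_mult: "\<And>g h y. g \<in> S \<Longrightarrow> h \<in> S \<Longrightarrow> y \<in> B \<Longrightarrow> b (g \<otimes> h) y = b g (b h y)"
    and fixed: "\<And>g x. g \<in> S \<Longrightarrow> x \<in> A \<Longrightarrow> a g x = x \<Longrightarrow> b g (base x) = base x"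
  shows "\<exists>F. (\<forall>x\<in>A. \<exists>g\<in>S. \<exists>y\<in>A. x = a g y \<and> F x = b g (base y)) \<and>
    (\<forall>g\<in>S. \<forall>x\<in>A. F (a g x) = b g (F x))"
proof -
  interpret S: subgroup S G by fact
  define orb where "orb x = {a k x | k. k \<in> S}" for x
  define rep where "rep x = (SOME y. y \<in> orb x)" for x
  define to where "to x = (SOME g. g \<in> S \<and> x = a g (rep x))" for x
  define F where "F x = b (to x) (base (rep x))" for x
  have orb_act: "orb (a g x) = orb x" if "g \<in> S" "x \<in> A" for g x
  proof
    show "orb (a g x) \<subseteq> orb x"
      unfolding orb_def using that by (auto simp flip: a_mult)
    show "orb x \<subseteq> orb (a g x)"
    proof
      fix y assume "y \<in> orb x"
      then obtain k where k: "k \<in> S" "y = a k x"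
        by (auto simp: orb_def)
      have "a (k \<otimes> inv g) (a g x) = a (k \<otimes> inv g \<otimes> g) x"
        using that k by (intro a_mult[symmetric]) auto
      also have "\<dots> = y"
        using that k by (simp add: m_assoc)
      finally show "y \<in> orb (a g x)"
        using k that by (auto simp: orb_def intro!: exI[of _ "k \<otimes> inv g"])
    qed
  qed
  have rep: "rep x \<in> orb x" if "x \<in> A" for x
    unfolding rep_def by (rule someI[of _ "a \<one> x"]) (auto simp: orb_def)
  have rep_in: "rep x \<in> A" if "x \<in> A" for x
    using rep[OF that] a_in that by (auto simp: orb_def)
  have to: "to x \<in> S \<and> x = a (to x) (rep x)" if x: "x \<in> A" for x
  proof -
    obtain k where k: "k \<in> S" "rep x = a k x"
      using rep[OF x] by (auto simp: orb_def)
    have "a (inv k) (rep x) = a (inv k \<otimes> k) x"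
      unfolding k(2) using k x by (intro a_mult[symmetric]) auto
    then have "inv k \<in> S \<and> x = a (inv k) (rep x)"
      using k x by (simp add: a_one)
    then show ?thesis
      unfolding to_def by (rule someI)
  qed
  \<comment> \<open>The value is the same for every element carrying the representative to
    \<open>x\<close>, not only for the chosen \<open>to x\<close>.\<close>
  have key: "F x = b g (base (rep x))" if x: "x \<in> A" and g: "g \<in> S" "x = a g (rep x)" for x g
  proof -
    let ?h = "to x" and ?r = "rep x"
    have h: "?h \<in> S" "x = a ?h ?r"
      using to[OF x] by auto
    have "a (inv ?h \<otimes> g) ?r = a (inv ?h) (a g ?r)"
      using g h rep_in[OF x] by (intro a_mult) auto
    also have "\<dots> = a (inv ?h) (a ?h ?r)"
      using g h by simp
    also have "\<dots> = a (inv ?h \<otimes> ?h) ?r"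
      using h rep_in[OF x] by (intro a_mult[symmetric]) auto
    also have "\<dots> = ?r"
      using h rep_in[OF x] by (simp add: a_one)
    finally have "b (inv ?h \<otimes> g) (base ?r) = base ?r"
      using g h rep_in[OF x] by (intro fixed) auto
    then have "F x = b ?h (b (inv ?h \<otimes> g) (base ?r))"
      by (simp add: F_def)
    also have "\<dots> = b (?h \<otimes> (inv ?h \<otimes> g)) (base ?r)"
      using g h base[OF rep_in[OF x]] by (intro b_mult[symmetric]) auto
    also have "?h \<otimes> (inv ?h \<otimes> g) = g"
      using g h by (simp flip: m_assoc)
    finally show ?thesis .
  qed
  have "F (a g x) = b g (F x)" if g: "g \<in> S" and x: "x \<in> A" for g x
  proof -
    let ?h = "to x" and ?r = "rep x"
    have h: "?h \<in> S" "x = a ?h ?r"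
      using to[OF x] by auto
    have r: "rep (a g x) = ?r"
      using orb_act[OF g x] by (simp add: rep_def)
    have "a g x = a (g \<otimes> ?h) ?r"
      using a_mult[OF g h(1) rep_in[OF x]] h(2) by simp
    then have "F (a g x) = b (g \<otimes> ?h) (base ?r)"
      using key[OF a_in[OF g x], of "g \<otimes> ?h"] g h(1) r by simp
    also have "\<dots> = b g (b ?h (base ?r))"
      using g h base[OF rep_in[OF x]] by (intro b_mult) auto
    finally show ?thesis
      by (simp add: F_def)
  qed
  moreover have "\<exists>g\<in>S. \<exists>y\<in>A. x = a g y \<and> F x = b g (base y)" if "x \<in> A" for x
    using to[OF that] rep_in[OF that] by (auto simp: F_def)
  ultimately show ?thesis
    by blast
qed

section \<open>Conjugation and products of subgroups\<close>

lemma conjugate_set_image: "conjugate_set G g K = (\<lambda>k. g \<otimes> k \<otimes> inv g) ` K"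
  unfolding conjugate_set_def l_coset_def r_coset_def by blast

lemma conjugate_set_one: "K \<subseteq> carrier G \<Longrightarrow> conjugate_set G \<one> K = K"
  by (force simp: conjugate_set_image)

lemma conjugate_set_subset: "K \<subseteq> carrier G \<Longrightarrow> g \<in> carrier G \<Longrightarrow> conjugate_set G g K \<subseteq> carrier G"
  by (auto simp: conjugate_set_image)

lemma card_conjugate_set:
  assumes "K \<subseteq> carrier G" "g \<in> carrier G"
  shows "card (conjugate_set G g K) = card K"
  unfolding conjugate_set_image
  by (rule card_image) (use assms in \<open>auto simp: inj_on_def subset_iff\<close>)

lemma inj_on_conjugate_set:
  assumes "g \<in> carrier G" "\<C> \<subseteq> Pow (carrier G)"
  shows "inj_on (conjugate_set G g) \<C>"
proof (rule inj_on_inverseI)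
  fix K assume "K \<in> \<C>"
  then show "conjugate_set G (inv g) (conjugate_set G g K) = K"
    using assms by (simp add: conjugate_set_conjugate_set conjugate_set_one subset_iff)
qed

lemma conjugate_mult:
  assumes "g \<in> carrier G" "x \<in> carrier G" "y \<in> carrier G"
  shows "g \<otimes> (x \<otimes> y) \<otimes> inv g = (g \<otimes> x \<otimes> inv g) \<otimes> (g \<otimes> y \<otimes> inv g)"
proof -
  have "inv g \<otimes> (g \<otimes> (y \<otimes> inv g)) = y \<otimes> inv g"
    using assms by (simp flip: m_assoc)
  then show ?thesis
    using assms by (simp add: m_assoc)
qed

lemma conjugate_set_set_mult:
  assumes "g \<in> carrier G" "H \<subseteq> carrier G" "K \<subseteq> carrier G"
  shows "conjugate_set G g (H <#> K) = conjugate_set G g H <#> conjugate_set G g K"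
proof -
  have "g \<otimes> (h \<otimes> k) \<otimes> inv g = (g \<otimes> h \<otimes> inv g) \<otimes> (g \<otimes> k \<otimes> inv g)" if "h \<in> H" "k \<in> K" for h k
    using assms that by (intro conjugate_mult) auto
  then show ?thesis
    unfolding set_mult_def conjugate_set_image by (simp add: image_UN)
qed

lemma normalized_set_mult_subgroup:
  assumes H: "subgroup H G" and Q: "subgroup Q G"
    and norm: "\<And>q. q \<in> Q \<Longrightarrow> conjugate_set G q H = H"
  shows "subgroup (H <#> Q) G"
proof -
  interpret H: subgroup H G by fact
  interpret Q: subgroup Q G by fact
  have conj: "q \<otimes> h \<otimes> inv q \<in> H" if "q \<in> Q" "h \<in> H" for q h
    using norm[OF that(1)] that(2) by (auto simp: conjugate_set_image)
  show ?thesis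
  proof (rule subgroupI)
    show "H <#> Q \<subseteq> carrier G"
      by (auto simp: set_mult_def)
    have "\<one> \<otimes> \<one> \<in> H <#> Q"
      unfolding set_mult_def using H.one_closed Q.one_closed by blast
    then show "H <#> Q \<noteq> {}"
      by blast
  next
    fix x assume "x \<in> H <#> Q"
    then obtain h q where x: "h \<in> H" "q \<in> Q" "x = h \<otimes> q"
      by (auto simp: set_mult_def)
    then have "inv x = (inv q \<otimes> inv h \<otimes> inv (inv q)) \<otimes> inv q"
      by (simp add: inv_mult_group m_assoc)
    moreover have "inv q \<otimes> inv h \<otimes> inv (inv q) \<in> H"
      using x by (intro conj) auto
    ultimately show "inv x \<in> H <#> Q"
      using x by (auto simp: set_mult_def)
  next
    fix x y assume "x \<in> H <#> Q" "y \<in> H <#> Q"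
    then obtain h q h' q' where x: "h \<in> H" "q \<in> Q" "x = h \<otimes> q" "h' \<in> H" "q' \<in> Q" "y = h' \<otimes> q'"
      by (auto simp: set_mult_def)
    have "inv q \<otimes> (q \<otimes> q') = q'"
      using x by (simp flip: m_assoc)
    then have "x \<otimes> y = (h \<otimes> (q \<otimes> h' \<otimes> inv q)) \<otimes> (q \<otimes> q')"
      using x by (simp add: m_assoc)
    moreover have "h \<otimes> (q \<otimes> h' \<otimes> inv q) \<in> H"
      using x conj by auto
    ultimately show "x \<otimes> y \<in> H <#> Q"
      using x by (auto simp: set_mult_def)
  qed
qed

text \<open>Every fiber of the multiplication \<open>H \<times> Q \<rightarrow> H <#> Q\<close> is
  in bijection with \<open>H \<inter> Q\<close>: given one factorization
  \<open>h \<otimes> q\<close>, the others are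
  \<open>(h \<otimes> d, inv d \<otimes> q)\<close>.\<close>

lemma card_set_mult:
  assumes H: "subgroup H G" and Q: "subgroup Q G" and fin: "finite (carrier G)"
  shows "card (H \<inter> Q) * card (H <#> Q) = card H * card Q"
proof -
  interpret H: subgroup H G by fact
  interpret Q: subgroup Q G by fact
  define fib where "fib x = {(h, q). h \<in> H \<and> q \<in> Q \<and> h \<otimes> q = x}" for x
  have "finite H" "finite Q"
    using fin by (auto intro: finite_subset[OF H.subset] finite_subset[OF Q.subset])
  have HQ: "H <#> Q = (\<lambda>(h, q). h \<otimes> q) ` (H \<times> Q)"
    by (auto simp: set_mult_def)
  have "card (fib x) = card (H \<inter> Q)" if "x \<in> H <#> Q" for x
  proof -
    obtain h q where hq: "h \<in> H" "q \<in> Q" "x = h \<otimes> q"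
      using \<open>x \<in> H <#> Q\<close> by (auto simp: set_mult_def)
    have "bij_betw (\<lambda>d. (h \<otimes> d, inv d \<otimes> q)) (H \<inter> Q) (fib x)"
      unfolding bij_betw_def
    proof
      show "inj_on (\<lambda>d. (h \<otimes> d, inv d \<otimes> q)) (H \<inter> Q)"
        by (rule inj_onI) (use hq in simp)
      show "(\<lambda>d. (h \<otimes> d, inv d \<otimes> q)) ` (H \<inter> Q) = fib x"
      proof (intro equalityI subsetI)
        fix u assume "u \<in> (\<lambda>d. (h \<otimes> d, inv d \<otimes> q)) ` (H \<inter> Q)"
        then obtain e where e: "e \<in> H" "e \<in> Q" "u = (h \<otimes> e, inv e \<otimes> q)"
          by auto
        have "e \<otimes> (inv e \<otimes> q) = q"
          using e hq by (simp flip: m_assoc)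
        then have "(h \<otimes> e) \<otimes> (inv e \<otimes> q) = x"
          using e hq by (simp add: m_assoc)
        then show "u \<in> fib x"
          using e hq by (simp add: fib_def)
      next
        fix u assume "u \<in> fib x"
        then obtain h' q' where u: "u = (h', q')" "h' \<in> H" "q' \<in> Q" "h' \<otimes> q' = h \<otimes> q"
          by (auto simp: fib_def hq)
        have c: "h \<in> carrier G" "q \<in> carrier G" "h' \<in> carrier G" "q' \<in> carrier G"
          using u hq by auto
        have "inv h \<otimes> h' = inv h \<otimes> (h' \<otimes> q') \<otimes> inv q'"
          using c by (simp add: m_assoc)
        also have "inv h \<otimes> (h' \<otimes> q') = q"
          unfolding u(4) using c by (simp flip: m_assoc)
        finally have eq: "inv h \<otimes> h' = q \<otimes> inv q'" .
        have "inv h \<otimes> h' \<in> H" "q \<otimes> inv q' \<in> Q"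
          using u(2,3) hq(1,2) by simp_all
        then have d: "inv h \<otimes> h' \<in> H \<inter> Q"
          using eq by simp
        have "h \<otimes> (inv h \<otimes> h') = h'"
          using c by (simp flip: m_assoc)
        moreover have "inv (inv h \<otimes> h') \<otimes> q = q'"
          unfolding eq using c by (simp add: inv_mult_group m_assoc)
        ultimately have "u = (h \<otimes> (inv h \<otimes> h'), inv (inv h \<otimes> h') \<otimes> q)"
          by (simp only: u(1))
        then show "u \<in> (\<lambda>d. (h \<otimes> d, inv d \<otimes> q)) ` (H \<inter> Q)"
          using d by (rule image_eqI)
      qed
    qed
    then show ?thesis
      by (rule bij_betw_same_card[symmetric])
  qed
  then have "(\<Sum>x\<in>H <#> Q. card (fib x)) = (\<Sum>x\<in>H <#> Q. card (H \<inter> Q))"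
    by (rule sum.cong[OF refl])
  also have "\<dots> = card (H \<inter> Q) * card (H <#> Q)"
    by simp
  finally have 1: "(\<Sum>x\<in>H <#> Q. card (fib x)) = card (H \<inter> Q) * card (H <#> Q)" .
  have 2: "(\<Sum>x\<in>H <#> Q. card (fib x)) = card (\<Union>x\<in>H <#> Q. fib x)"
  proof (rule card_UN_disjoint[symmetric])
    show "finite (H <#> Q)"
      unfolding HQ using \<open>finite H\<close> \<open>finite Q\<close> by simp
    show "\<forall>x\<in>H <#> Q. finite (fib x)"
      by (intro ballI, rule finite_subset[of _ "H \<times> Q"]) (auto simp: fib_def \<open>finite H\<close> \<open>finite Q\<close>)
    show "\<forall>x\<in>H <#> Q. \<forall>y\<in>H <#> Q. x \<noteq> y \<longrightarrow> fib x \<inter> fib y = {}"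
      by (auto simp: fib_def)
  qed
  have "(\<Union>x\<in>H <#> Q. fib x) = H \<times> Q"
    by (auto simp: fib_def set_mult_def)
  then show ?thesis
    unfolding 1[symmetric] 2 by (simp only: card_cartesian_product)
qed

section \<open>Subgroups, products and fixed points of p-subgroups\<close>

lemma p_subgroup_subset:
  assumes "prime p" "finite (carrier G)" "p_subgroup p H G" "subgroup K G" "K \<subseteq> H"
  shows "p_subgroup p K G"
proof -
  obtain n where H: "subgroup H G" "card H = p ^ n"
    using assms(3) by (auto simp: p_subgroup_def)
  have K: "subgroup K (G\<lparr>carrier := H\<rparr>)"
    by (rule subgroup_incl[OF assms(4) H(1) assms(5)])
  have "card K dvd Coset.order (G\<lparr>carrier := H\<rparr>)"
    unfolding group.lagrange[OF subgroup_imp_group[OF H(1)] K, symmetric] by (rule dvd_triv_right)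
  then have "card K dvd p ^ n"
    using H(2) by (simp add: Coset.order_def)
  then obtain i where "card K = p ^ i"
    using divides_primepow_nat[OF assms(1)] by blast
  then show ?thesis
    using assms(4) by (auto simp: p_subgroup_def)
qed

lemma p_subgroup_set_mult:
  assumes p: "prime p" and fin: "finite (carrier G)"
    and H: "p_subgroup p H G" and Q: "p_subgroup p Q G"
    and norm: "\<And>q. q \<in> Q \<Longrightarrow> conjugate_set G q H = H"
  shows "p_subgroup p (H <#> Q) G"
proof -
  obtain a b where ab: "card H = p ^ a" "card Q = p ^ b" "subgroup H G" "subgroup Q G"
    using H Q by (auto simp: p_subgroup_def)
  have "card (H <#> Q) dvd p ^ (a + b)"
    using card_set_mult[OF ab(3,4) fin] ab by (metis dvd_triv_right power_add)
  then obtain i where "card (H <#> Q) = p ^ i"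
    using divides_primepow_nat[OF p] by blast
  then show ?thesis
    using normalized_set_mult_subgroup[OF ab(3,4) norm] by (auto simp: p_subgroup_def)
qed

text \<open>Orbits of a \<open>p\<close>-group \<open>Q\<close> have \<open>p\<close>-power size, so if \<open>1\<close> were the only fixed point then
  \<open>|H|\<close> would be \<open>1\<close> modulo \<open>p\<close>.\<close>

lemma p_group_fixed_point:
  assumes p: "prime p" and fin: "finite (carrier G)"
    and H: "p_subgroup p H G" "H \<noteq> {\<one>}" and Q: "p_subgroup p Q G"
    and norm: "\<And>q. q \<in> Q \<Longrightarrow> conjugate_set G q H = H"
  shows "\<exists>x\<in>H. x \<noteq> \<one> \<and> (\<forall>q\<in>Q. q \<otimes> x \<otimes> inv q = x)"
proof (rule ccontr)
  assume no: "\<not> ?thesis"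
  obtain a b where ab: "card H = p ^ a" "card Q = p ^ b" and HG: "subgroup H G" and QG: "subgroup Q G"
    using H Q by (auto simp: p_subgroup_def)
  interpret H: subgroup H G by fact
  interpret Q: subgroup Q G by fact
  have finH: "finite H"
    by (rule finite_subset[OF H.subset fin])
  have conj: "q \<otimes> h \<otimes> inv q \<in> H" if "q \<in> Q" "h \<in> H" for q h
    using norm[OF that(1)] that(2) by (auto simp: conjugate_set_image)
  define \<phi> where "\<phi> = (\<lambda>g. \<lambda>h\<in>carrier G. g \<otimes> h \<otimes> inv g)"
  define GQ where "GQ = G\<lparr>carrier := Q\<rparr>"
  interpret act: group_action GQ "carrier G" \<phi>
    unfolding GQ_def \<phi>_def by (rule group_action.induced_action[OF action_by_conjugation QG])
  have orbit: "orbit GQ \<phi> x = {q \<otimes> x \<otimes> inv q | q. q \<in> Q}" if "x \<in> H" for x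
    using that by (auto simp: orbit_def GQ_def \<phi>_def)
  have orbit_H: "orbit GQ \<phi> x \<subseteq> H" if "x \<in> H" for x
    using that conj by (auto simp: orbit)
  have fin_orbit: "finite (orbit GQ \<phi> x)" if "x \<in> H" for x
    using orbit_H[OF that] finH by (rule finite_subset)
  have self: "x \<in> orbit GQ \<phi> x" if "x \<in> H" for x
    using act.orbit_refl[of x] that by auto
  have one: "orbit GQ \<phi> \<one> = {\<one>}"
    using Q.one_closed by (auto simp: orbit intro!: exI[of _ \<one>])
  have dvd: "p dvd card (orbit GQ \<phi> x)" if x: "x \<in> H" "x \<noteq> \<one>" for x
  proof -
    have "card (orbit GQ \<phi> x) * card (stabilizer GQ \<phi> x) = p ^ b"
      using act.orbit_stabilizer_theorem[of x] x ab by (simp add: Coset.order_def GQ_def)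
    then have "card (orbit GQ \<phi> x) dvd p ^ b"
      by (metis dvd_triv_left)
    then obtain i where i: "card (orbit GQ \<phi> x) = p ^ i"
      using divides_primepow_nat[OF p] by blast
    have "i \<noteq> 0"
    proof
      assume "i = 0"
      then obtain y where "orbit GQ \<phi> x = {y}"
        using i card_1_singletonE by (metis power_0)
      then have "orbit GQ \<phi> x = {x}"
        using self[OF x(1)] by simp
      moreover have "q \<otimes> x \<otimes> inv q \<in> orbit GQ \<phi> x" if "q \<in> Q" for q
        using that by (auto simp: orbit[OF x(1)])
      ultimately have "q \<otimes> x \<otimes> inv q = x" if "q \<in> Q" for q
        using that by simp
      then show False
        using no x by blast
    qed
    then show ?thesis
      using i by (cases i) auto
  qed
  define \<O> where "\<O> = orbit GQ \<phi> ` (H - {\<one>})"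
  have cover: "\<Union>\<O> = H - {\<one>}"
  proof
    show "H - {\<one>} \<subseteq> \<Union>\<O>"
      using self by (auto simp: \<O>_def)
    show "\<Union>\<O> \<subseteq> H - {\<one>}"
    proof
      fix y assume "y \<in> \<Union>\<O>"
      then obtain x where x: "x \<in> H" "x \<noteq> \<one>" "y \<in> orbit GQ \<phi> x"
        by (auto simp: \<O>_def)
      have "x \<in> orbit GQ \<phi> y"
        using act.orbit_sym[of x y] x orbit_H[OF x(1)] by auto
      then have "y \<noteq> \<one>"
        using x one by auto
      then show "y \<in> H - {\<one>}"
        using x orbit_H by auto
    qed
  qed
  have "p dvd card (\<Union>\<O>)"
  proof -
    have "card (\<Union>\<O>) = (\<Sum>A\<in>\<O>. card A)"
    proof (rule card_Union_disjoint)
      show "disjoint \<O>"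
      proof (clarsimp simp: pairwise_def disjnt_def)
        fix A B assume "A \<in> \<O>" "B \<in> \<O>" "A \<noteq> B"
        moreover have "\<O> \<subseteq> orbits GQ (carrier G) \<phi>"
          by (auto simp: \<O>_def orbits_def)
        ultimately show "A \<inter> B = {}"
          using act.disjoint_union by blast
      qed
    qed (auto simp: \<O>_def fin_orbit)
    also have "p dvd \<dots>"
      by (rule dvd_sum) (use dvd in \<open>auto simp: \<O>_def\<close>)
    finally show ?thesis .
  qed
  moreover have "p dvd card H"
  proof -
    have "card H \<noteq> 1"
      using H(2) H.one_closed by (metis card_1_singletonE singletonD)
    then show ?thesis
      using ab(1) by (cases a) auto
  qed
  moreover have "card H = Suc (card (\<Union>\<O>))"
    unfolding cover by (rule card.remove[OF finH H.one_closed])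
  ultimately have "p dvd 1"
    by (metis dvd_add_right_iff plus_1_eq_Suc add.commute)
  then show False
    using p by (simp add: prime_nat_iff)
qed

end

section \<open>Orbit and fusion categories of a collection\<close>

text \<open>A minimal or maximal member is comparable with all others, so it is least or greatest.
  Thus \<open>\<Inter>\<sigma>\<close> and \<open>\<Union>\<sigma>\<close> serve as the minimum and
  the maximum of the chain.\<close>

lemma chain_extrema:
  assumes "\<sigma> \<in> chains \<C>" "finite \<C>"
  shows "\<Inter>\<sigma> \<in> \<sigma>" "\<Union>\<sigma> \<in> \<sigma>"
proof -
  have \<sigma>: "finite \<sigma>" "\<sigma> \<noteq> {}" and cmp: "\<And>a b. a \<in> \<sigma> \<Longrightarrow> b \<in> \<sigma> \<Longrightarrow> a \<subseteq> b \<or> b \<subseteq> a"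
    using assms by (auto simp: chains_def intro: finite_subset)
  obtain m where m: "m \<in> \<sigma>" "\<forall>b\<in>\<sigma>. b \<subseteq> m \<longrightarrow> m = b"
    using finite_has_minimal[OF \<sigma>] by blast
  have "m \<subseteq> b" if "b \<in> \<sigma>" for b
    using cmp[OF m(1) that] m(2) that by blast
  then have "\<Inter>\<sigma> = m"
    using m(1) by blast
  with m show "\<Inter>\<sigma> \<in> \<sigma>"
    by simp
  obtain M where M: "M \<in> \<sigma>" "\<forall>b\<in>\<sigma>. M \<subseteq> b \<longrightarrow> M = b"
    using finite_has_maximal[OF \<sigma>] by blast
  have "b \<subseteq> M" if "b \<in> \<sigma>" for b
    using cmp[OF M(1) that] M(2) that by blast
  then have "\<Union>\<sigma> = M"
    using M(1) by blast
  with M show "\<Union>\<sigma> \<in> \<sigma>"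
    by simp
qed

locale p_collection = group G for G :: "('a, 'b) monoid_scheme" (structure) +
  fixes \<C> :: "'a set set" and S :: "'a set" and p :: nat
  assumes prime: "prime p" and finite_G: "finite (carrier G)" and collection: "collection G \<C>"
    and p_subgroups: "\<And>H. H \<in> \<C> \<Longrightarrow> p_subgroup p H G" and S: "p_subgroup p S G"
begin

text \<open>Taken member by member, so that it is visibly antitone in
  \<open>\<sigma>\<close>.\<close>

definition stab :: "'a set set \<Rightarrow> 'a set" where
  "stab \<sigma> = {s \<in> S. \<forall>H\<in>\<sigma>. conjugate_set G s H = H}"

lemma subgroup_S: "subgroup S G"
  using S by (simp add: p_subgroup_def)

lemma S_carrier: "s \<in> S \<Longrightarrow> s \<in> carrier G"
  by (rule subgroup.mem_carrier[OF subgroup_S])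

lemma subgroup_C: "H \<in> \<C> \<Longrightarrow> subgroup H G"
  using collection by (simp add: collection_def)

lemma C_carrier: "\<C> \<subseteq> Pow (carrier G)"
  using subgroup_C subgroup.subset by blast

lemma chain_carrier: "\<sigma> \<in> chains \<C> \<Longrightarrow> H \<in> \<sigma> \<Longrightarrow> H \<subseteq> carrier G"
  using C_carrier by (auto simp: chains_def)

lemma finite_C: "finite \<C>"
  by (rule finite_subset[OF C_carrier]) (simp add: finite_G)

lemma conj_C: "H \<in> \<C> \<Longrightarrow> g \<in> carrier G \<Longrightarrow> conjugate_set G g H \<in> \<C>"
  using collection by (simp add: collection_def)

lemma conj_chain:
  assumes "\<sigma> \<in> chains \<C>" "g \<in> carrier G"
  shows "conjugate_set G g ` \<sigma> \<in> chains \<C>"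
proof -
  have \<sigma>: "\<sigma> \<subseteq> \<C>" "\<sigma> \<noteq> {}" "\<forall>A\<in>\<sigma>. \<forall>B\<in>\<sigma>. A \<subseteq> B \<or> B \<subseteq> A"
    using assms(1) by (auto simp: chains_def)
  have "conjugate_set G g A \<subseteq> conjugate_set G g B" if "A \<subseteq> B" for A B
    unfolding conjugate_set_image using that by (rule image_mono)
  then have "\<forall>A\<in>\<sigma>. \<forall>B\<in>\<sigma>. conjugate_set G g A \<subseteq> conjugate_set G g B \<or>
      conjugate_set G g B \<subseteq> conjugate_set G g A"
    using \<sigma>(3) by meson
  moreover have "conjugate_set G g ` \<sigma> \<subseteq> \<C>"
    using \<sigma>(1) conj_C[OF _ assms(2)] by blast
  ultimately show ?thesis
    using \<sigma>(2) by (simp add: chains_def)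
qed

lemma subgroup_stab:
  assumes "\<sigma> \<subseteq> Pow (carrier G)"
  shows "subgroup (stab \<sigma>) G"
proof (rule subgroupI)
  interpret S: subgroup S G by (rule subgroup_S)
  show "stab \<sigma> \<subseteq> carrier G"
    by (auto simp: stab_def)
  have "\<one> \<in> stab \<sigma>"
    using assms by (auto simp: stab_def conjugate_set_one)
  then show "stab \<sigma> \<noteq> {}"
    by blast
  fix a assume a: "a \<in> stab \<sigma>"
  have "conjugate_set G (inv a) H = H" if H: "H \<in> \<sigma>" for H
  proof -
    have "H \<subseteq> carrier G" "a \<in> carrier G" "conjugate_set G a H = H"
      using assms a H by (auto simp: stab_def)
    then show ?thesis
      using conjugate_set_conjugate_set[of H "inv a" a] by (simp add: conjugate_set_one)
  qed
  then show "inv a \<in> stab \<sigma>"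
    using a by (simp add: stab_def)
  fix b assume b: "b \<in> stab \<sigma>"
  have "conjugate_set G (a \<otimes> b) H = H" if H: "H \<in> \<sigma>" for H
  proof -
    have "H \<subseteq> carrier G" "a \<in> carrier G" "b \<in> carrier G" "conjugate_set G a H = H" "conjugate_set G b H = H"
      using assms a b H by (auto simp: stab_def)
    then show ?thesis
      using conjugate_set_conjugate_set[of H a b] by simp
  qed
  then show "a \<otimes> b \<in> stab \<sigma>"
    using a b by (simp add: stab_def)
qed

lemma p_subgroup_stab: "\<sigma> \<subseteq> Pow (carrier G) \<Longrightarrow> p_subgroup p (stab \<sigma>) G"
  by (rule p_subgroup_subset[OF prime finite_G S subgroup_stab]) (auto simp: stab_def)

lemma stab_anti: "\<sigma> \<subseteq> \<tau> \<Longrightarrow> stab \<tau> \<subseteq> stab \<sigma>"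
  by (auto simp: stab_def)

lemma stab_conj:
  assumes \<sigma>: "\<sigma> \<subseteq> Pow (carrier G)" and g: "g \<in> S"
  shows "stab (conjugate_set G g ` \<sigma>) = conjugate_set G g (stab \<sigma>)"
proof -
  interpret S: subgroup S G by (rule subgroup_S)
  have gG: "g \<in> carrier G"
    using g by simp
  have eq: "s \<in> stab (conjugate_set G g ` \<sigma>) \<longleftrightarrow> inv g \<otimes> s \<otimes> g \<in> stab \<sigma>" if s: "s \<in> carrier G" for s
  proof -
    have "s \<in> S \<longleftrightarrow> inv g \<otimes> s \<otimes> g \<in> S"
    proof
      assume "inv g \<otimes> s \<otimes> g \<in> S"
      then have "g \<otimes> (inv g \<otimes> s \<otimes> g) \<otimes> inv g \<in> S"
        using g by simp
      moreover have "g \<otimes> (inv g \<otimes> s \<otimes> g) \<otimes> inv g = (g \<otimes> inv g) \<otimes> s \<otimes> (g \<otimes> inv g)"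
        using gG s by (simp only: m_assoc m_closed inv_closed)
      ultimately show "s \<in> S"
        using gG s by simp
    qed (use g in simp)
    moreover have "conjugate_set G s (conjugate_set G g H) = conjugate_set G g H \<longleftrightarrow>
        conjugate_set G (inv g \<otimes> s \<otimes> g) H = H" if "H \<in> \<sigma>" for H
    proof -
      have H: "H \<subseteq> carrier G"
        using \<sigma> that by auto
      let ?K = "conjugate_set G (inv g \<otimes> s \<otimes> g) H"
      have "conjugate_set G g ?K = conjugate_set G (g \<otimes> (inv g \<otimes> s \<otimes> g)) H"
        using H gG s by (simp add: conjugate_set_conjugate_set)
      also have "g \<otimes> (inv g \<otimes> s \<otimes> g) = (g \<otimes> inv g) \<otimes> (s \<otimes> g)"
        using gG s by (simp only: m_assoc m_closed inv_closed)
      also have "\<dots> = s \<otimes> g"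
        using gG s by simp
      finally have "conjugate_set G g ?K = conjugate_set G s (conjugate_set G g H)"
        using H gG s by (simp add: conjugate_set_conjugate_set)
      moreover have "conjugate_set G g ?K = conjugate_set G g H \<longleftrightarrow> ?K = H"
        by (rule inj_on_eq_iff[OF inj_on_conjugate_set[OF gG subset_refl]])
          (use H gG s conjugate_set_subset in auto)
      ultimately show ?thesis
        by simp
    qed
    ultimately show ?thesis
      by (auto simp: stab_def)
  qed
  have sub: "stab \<tau> \<subseteq> carrier G" for \<tau>
    by (auto simp: stab_def)
  have "s \<in> stab (conjugate_set G g ` \<sigma>) \<longleftrightarrow> s \<in> conjugate_set G g (stab \<sigma>)" if "s \<in> carrier G" for s
    unfolding conjugate_set_iff[OF sub gG that] by (rule eq[OF that])
  then show ?thesis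
    using sub conjugate_set_subset[OF sub gG] by blast
qed

text \<open>An element stabilizing a chain of finite sets normalizes each of its members, since
  conjugation preserves cardinalities.\<close>

lemma setwise_stab:
  assumes \<sigma>: "\<sigma> \<in> chains \<C>" and g: "g \<in> S" "conjugate_set G g ` \<sigma> = \<sigma>"
  shows "g \<in> stab \<sigma>"
proof -
  have "conjugate_set G g H = H" if H: "H \<in> \<sigma>" for H
  proof -
    have "conjugate_set G g H \<in> \<sigma>"
      using g H by blast
    then have "conjugate_set G g H \<subseteq> H \<or> H \<subseteq> conjugate_set G g H"
      using \<sigma> H by (auto simp: chains_def)
    moreover have "card (conjugate_set G g H) = card H"
      using card_conjugate_set chain_carrier[OF \<sigma> H] S_carrier[OF g(1)] by blast
    moreover have "finite H" "finite (conjugate_set G g H)"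
      using finite_subset[OF chain_carrier[OF \<sigma>] finite_G] \<open>conjugate_set G g H \<in> \<sigma>\<close> H by auto
    ultimately show ?thesis
      using card_subset_eq by metis
  qed
  then show ?thesis
    using g by (simp add: stab_def)
qed

text \<open>The choice \<open>base\<close> has to be fixed by stabilizers only, not to be
  equivariant: it is used at one chain per orbit and transported by \<open>S\<close>. Compatibility
  of \<open>f\<close> with conjugation then identifies the subgroup under each translate, which
  yields the order conditions for the transported choice.\<close>

lemma homotopy_equivalence_from_base:
  fixes E :: "('o, 'm) category" and P :: "('o, 'm, 'a set, unit) cat_functor"
  assumes thin: "thin E" and P: "is_functor E (poset_cat \<C>) P"
    and full: "\<And>x y. x \<in> objs E \<Longrightarrow> y \<in> objs E \<Longrightarrow> fobj P x \<subseteq> fobj P y \<Longrightarrow> leq E x y"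
    and \<mu>: "\<And>g. g \<in> carrier G \<Longrightarrow> is_functor E E (\<mu> g)"
    and P_equivariant: "\<And>g x. g \<in> carrier G \<Longrightarrow> x \<in> objs E \<Longrightarrow>
        fobj P (fobj (\<mu> g) x) = fobj (poset_act G g) (fobj P x)"
    and \<mu>_mult: "\<And>g k x. g \<in> carrier G \<Longrightarrow> k \<in> carrier G \<Longrightarrow> x \<in> objs E \<Longrightarrow>
        fobj (\<mu> (g \<otimes> k)) x = fobj (\<mu> g) (fobj (\<mu> k) x)"
    and base: "\<And>\<sigma>. \<sigma> \<in> chains \<C> \<Longrightarrow> base \<sigma> \<in> objs E \<and> fobj P (base \<sigma>) = f \<sigma>"
    and fixed: "\<And>\<sigma> g. \<sigma> \<in> chains \<C> \<Longrightarrow> g \<in> stab \<sigma> \<Longrightarrow> fobj (\<mu> g) (base \<sigma>) = base \<sigma>"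
    and f_conj: "\<And>\<sigma> g. \<sigma> \<in> chains \<C> \<Longrightarrow> g \<in> S \<Longrightarrow>
        f (conjugate_set G g ` \<sigma>) = conjugate_set G g (f \<sigma>)"
    and f_mono: "\<And>\<sigma> \<tau>. \<sigma> \<in> chains \<C> \<Longrightarrow> \<tau> \<in> chains \<C> \<Longrightarrow> \<sigma> \<subseteq> \<tau> \<Longrightarrow>
        if d then f \<tau> \<subseteq> f \<sigma> else f \<sigma> \<subseteq> f \<tau>"
    and f_bound: "\<And>\<sigma>. \<sigma> \<in> chains \<C> \<Longrightarrow> if d then \<Inter>\<sigma> \<subseteq> f \<sigma> else f \<sigma> \<subseteq> \<Union>\<sigma>"
  shows "nerve_equivariant_homotopy_equivalence S E \<mu> (poset_cat \<C>) (poset_act G) P"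
proof -
  have \<mu>_in: "fobj (\<mu> g) x \<in> objs E" if "g \<in> carrier G" "x \<in> objs E" for g x
    using \<mu>[OF that(1)] that(2) by (simp add: is_functor_def)
  have conj_mult: "conjugate_set G (g \<otimes> k) ` \<sigma> = conjugate_set G g ` conjugate_set G k ` \<sigma>"
    if "g \<in> S" "k \<in> S" "\<sigma> \<in> chains \<C>" for g k \<sigma>
    unfolding image_image
  proof (rule image_cong[OF refl])
    fix H assume "H \<in> \<sigma>"
    from conjugate_set_conjugate_set[OF chain_carrier[OF that(3) this] that(1,2)[THEN S_carrier]]
    show "conjugate_set G (g \<otimes> k) H = conjugate_set G g (conjugate_set G k H)" ..
  qed
  have conj_one: "conjugate_set G \<one> ` \<sigma> = \<sigma>" if "\<sigma> \<in> chains \<C>" for \<sigma>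
  proof -
    have "conjugate_set G \<one> ` \<sigma> = id ` \<sigma>"
      by (rule image_cong[OF refl]) (simp add: conjugate_set_one chain_carrier[OF that])
    then show ?thesis
      by simp
  qed
  have "\<exists>F. (\<forall>\<sigma>\<in>chains \<C>. \<exists>g\<in>S. \<exists>\<tau>\<in>chains \<C>. \<sigma> = conjugate_set G g ` \<tau> \<and> F \<sigma> = fobj (\<mu> g) (base \<tau>)) \<and>
    (\<forall>g\<in>S. \<forall>\<sigma>\<in>chains \<C>. F (conjugate_set G g ` \<sigma>) = fobj (\<mu> g) (F \<sigma>))"
  proof (rule equivariant_lift[OF subgroup_S, where a = "\<lambda>g \<sigma>. conjugate_set G g ` \<sigma>" and B = "objs E"])
    show "fobj (\<mu> (g \<otimes> h)) y = fobj (\<mu> g) (fobj (\<mu> h) y)" if "g \<in> S" "h \<in> S" "y \<in> objs E" for g h y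
      using that S_carrier by (intro \<mu>_mult) auto
    show "fobj (\<mu> g) (base \<sigma>) = base \<sigma>" if "g \<in> S" "\<sigma> \<in> chains \<C>" "conjugate_set G g ` \<sigma> = \<sigma>" for g \<sigma>
      by (rule fixed[OF that(2) setwise_stab[OF that(2,1,3)]])
    show "conjugate_set G g ` \<sigma> \<in> chains \<C>" if "g \<in> S" "\<sigma> \<in> chains \<C>" for g \<sigma>
      by (rule conj_chain[OF that(2) S_carrier[OF that(1)]])
    show "base \<sigma> \<in> objs E" if "\<sigma> \<in> chains \<C>" for \<sigma>
      using base[OF that] ..
  qed (fact conj_one conj_mult)+
  then obtain F
    where "(\<forall>\<sigma>\<in>chains \<C>. \<exists>g\<in>S. \<exists>\<tau>\<in>chains \<C>.
        \<sigma> = conjugate_set G g ` \<tau> \<and> F \<sigma> = fobj (\<mu> g) (base \<tau>)) \<and>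
      (\<forall>g\<in>S. \<forall>\<sigma>\<in>chains \<C>. F (conjugate_set G g ` \<sigma>) = fobj (\<mu> g) (F \<sigma>))" ..
  note F = conjunct1[OF this] and F_equivariant = conjunct2[OF this]
  have P_F: "F \<sigma> \<in> objs E \<and> fobj P (F \<sigma>) = f \<sigma>" if \<sigma>: "\<sigma> \<in> chains \<C>" for \<sigma>
  proof -
    obtain g \<tau> where g: "g \<in> S" "\<tau> \<in> chains \<C>" "\<sigma> = conjugate_set G g ` \<tau>" "F \<sigma> = fobj (\<mu> g) (base \<tau>)"
      using bspec[OF F \<sigma>] by blast
    have gG: "g \<in> carrier G" and b: "base \<tau> \<in> objs E" "fobj P (base \<tau>) = f \<tau>"
      using base[OF g(2)] S_carrier[OF g(1)] by auto
    have "fobj P (F \<sigma>) = conjugate_set G g (f \<tau>)"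
      unfolding g(4) P_equivariant[OF gG b(1)] b(2) by (simp add: poset_act_def)
    then show ?thesis
      using \<mu>_in[OF gG b(1)] f_conj[OF g(2,1)] g(3,4) by simp
  qed
  show ?thesis
  proof (rule equivariant_sweep.homotopy_equivalence, unfold_locales)
    show "thin E" "finite \<C>" "is_functor E (poset_cat \<C>) P"
      by (fact thin finite_C P)+
    fix g assume g: "g \<in> S"
    show "is_functor E E (\<mu> g)" "is_functor (poset_cat \<C>) (poset_cat \<C>) (poset_act G g)"
      using g S_carrier \<mu> is_functor_poset_act[OF collection] by auto
    show "inj_on (fobj (poset_act G g)) \<C>"
      using inj_on_conjugate_set[OF S_carrier[OF g] C_carrier] by (simp add: poset_act_def)
    show "fobj P (fobj (\<mu> g) x) = fobj (poset_act G g) (fobj P x)" if "x \<in> objs E" for x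
      by (rule P_equivariant[OF S_carrier[OF g] that])
    show "F (fobj (poset_act G g) ` \<sigma>) = fobj (\<mu> g) (F \<sigma>)" if "\<sigma> \<in> chains \<C>" for \<sigma>
      using F_equivariant g that by (simp add: poset_act_def)
  next
    show "F \<sigma> \<in> objs E" if "\<sigma> \<in> chains \<C>" for \<sigma>
      using P_F[OF that] by blast
    show "if d then fobj P (F \<tau>) \<subseteq> fobj P (F \<sigma>) else fobj P (F \<sigma>) \<subseteq> fobj P (F \<tau>)"
      if "\<sigma> \<in> chains \<C>" "\<tau> \<in> chains \<C>" "\<sigma> \<subseteq> \<tau>" for \<sigma> \<tau>
      using f_mono[OF that] P_F[OF that(1)] P_F[OF that(2)] by simp
    show "if d then \<Inter>\<sigma> \<subseteq> fobj P (F \<sigma>) else fobj P (F \<sigma>) \<subseteq> \<Union>\<sigma>" if "\<sigma> \<in> chains \<C>" for \<sigma>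
      using f_bound[OF that] P_F[OF that] by simp
    show "leq E x y" if "x \<in> objs E" "y \<in> objs E" "fobj P x \<subseteq> fobj P y" for x y
      by (rule full[OF that])
  qed
qed

section \<open>The category EO: pointed transitive G-sets\<close>

lemma lcosets_transitive:
  assumes "subgroup H G" "c \<in> lcosets H" "z \<in> lcosets H"
  shows "\<exists>g\<in>carrier G. z = g <# c"
proof -
  obtain a b where ab: "a \<in> carrier G" "b \<in> carrier G" "c = a <# H" "z = b <# H"
    using assms(2,3) by (auto simp: LCOSETS_def)
  then have "(b \<otimes> inv a) <# c = z"
    using subgroup.subset[OF assms(1)] by (simp add: lcos_m_assoc m_assoc)
  then show ?thesis
    using ab by (intro bexI[of _ "b \<otimes> inv a"]) auto
qed

lemma lcosets_carrier: "subgroup H G \<Longrightarrow> c \<in> lcosets H \<Longrightarrow> c \<subseteq> carrier G"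
  using lcosets_subset_PowG by blast

lemma EO_objE:
  assumes "x \<in> objs (EO G \<C>)"
  obtains H c where "H \<in> \<C>" "subgroup H G" "c \<in> lcosets H" "x = (lcosets H, c)"
  using assms subgroup_C by (auto simp: EO_def)

text \<open>An equivariant map out of a transitive set is determined by the image of one
  point.\<close>

lemma thin_EO: "thin (EO G \<C>)"
  unfolding thin_def
proof (intro conjI ballI)
  show "is_category (EO G \<C>)"
    by (rule is_category_EO[OF collection])
  fix x y \<phi> \<psi>
  assume x: "x \<in> objs (EO G \<C>)" and "y \<in> objs (EO G \<C>)"
    and \<phi>: "\<phi> \<in> arrs (EO G \<C>) x y" "\<psi> \<in> arrs (EO G \<C>) x y"
  obtain H c where H: "subgroup H G" "c \<in> lcosets H" "x = (lcosets H, c)"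
    using x by (rule EO_objE)
  obtain Y d where y: "y = (Y, d)"
    by fastforce
  have arr: "\<xi> \<in> lcosets H \<rightarrow>\<^sub>E Y" "\<And>g z. g \<in> carrier G \<Longrightarrow> z \<in> lcosets H \<Longrightarrow> \<xi> (g <# z) = g <# \<xi> z" "\<xi> c = d"
    if "\<xi> \<in> arrs (EO G \<C>) x y" for \<xi>
    using that unfolding H(3) y by (auto simp: EO_def)
  show "\<phi> = \<psi>"
  proof (rule PiE_ext[OF arr(1)[OF \<phi>(1)] arr(1)[OF \<phi>(2)]])
    fix z assume "z \<in> lcosets H"
    then obtain g where "g \<in> carrier G" "z = g <# c"
      using lcosets_transitive[OF H(1,2)] by blast
    then show "\<phi> z = \<psi> z"
      using arr(2,3)[OF \<phi>(1)] arr(2,3)[OF \<phi>(2)] H(2) by simp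
  qed
qed

text \<open>The assignment \<open>g <# c \<mapsto> g <# d\<close> is well defined exactly because
  the stabilizer of \<open>c\<close> fixes \<open>d\<close>.\<close>

lemma leq_EO:
  assumes x: "x \<in> objs (EO G \<C>)" and y: "y \<in> objs (EO G \<C>)"
    and sub: "fobj (EO_to_poset G) x \<subseteq> fobj (EO_to_poset G) y"
  shows "leq (EO G \<C>) x y"
proof -
  obtain H c where H: "subgroup H G" "c \<in> lcosets H" "x = (lcosets H, c)"
    using x by (rule EO_objE)
  obtain K d where K: "subgroup K G" "d \<in> lcosets K" "y = (lcosets K, d)"
    using y by (rule EO_objE)
  have c: "c \<subseteq> carrier G" and d: "d \<subseteq> carrier G"
    using lcosets_carrier H K by auto
  have sub': "g <# d = d" if "g \<in> carrier G" "g <# c = c" for g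
    using sub that by (auto simp: H(3) K(3) EO_to_poset_def stabilizer_def)
  have well: "g <# d = k <# d" if gk: "g \<in> carrier G" "k \<in> carrier G" "g <# c = k <# c" for g k
  proof -
    have "(inv k \<otimes> g) <# c = inv k <# (g <# c)"
      using gk(1,2) c by (simp add: lcos_m_assoc)
    also have "\<dots> = inv k <# (k <# c)"
      by (simp only: gk(3))
    also have "\<dots> = c"
      using gk(1,2) c by (simp add: lcos_m_assoc lcos_mult_one)
    finally have "(inv k \<otimes> g) <# d = d"
      using gk(1,2) by (intro sub') auto
    then have "k <# ((inv k \<otimes> g) <# d) = k <# d"
      by simp
    moreover have "k \<otimes> (inv k \<otimes> g) = g"
      using gk(1,2) by (simp flip: m_assoc)
    ultimately show ?thesis
      using gk(1,2) d by (simp add: lcos_m_assoc)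
  qed
  define \<phi> where "\<phi> = (\<lambda>z\<in>lcosets H. (SOME g. g \<in> carrier G \<and> z = g <# c) <# d)"
  have \<phi>: "\<phi> (g <# c) = g <# d" if g: "g \<in> carrier G" for g
  proof -
    let ?k = "SOME k. k \<in> carrier G \<and> g <# c = k <# c"
    have k: "?k \<in> carrier G \<and> g <# c = ?k <# c"
      by (rule someI[of _ g]) (simp add: g)
    have "g <# d = ?k <# d"
      by (rule well[OF g conjunct1[OF k] conjunct2[OF k]])
    then show ?thesis
      using lcoset_act_closed[OF H(1) g H(2)] by (simp add: \<phi>_def)
  qed
  have "\<phi> \<in> arrs (EO G \<C>) x y"
  proof -
    have "\<phi> \<in> lcosets H \<rightarrow>\<^sub>E lcosets K"
    proof (rule PiE_I)
      fix z assume "z \<in> lcosets H"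
      then obtain g where "g \<in> carrier G" "z = g <# c"
        using lcosets_transitive[OF H(1,2)] by blast
      then show "\<phi> z \<in> lcosets K"
        using \<phi> lcoset_act_closed[OF K(1) _ K(2)] by simp
    qed (simp add: \<phi>_def)
    moreover have "\<phi> (g <# z) = g <# \<phi> z" if g: "g \<in> carrier G" "z \<in> lcosets H" for g z
    proof -
      obtain k where "k \<in> carrier G" "z = k <# c"
        using lcosets_transitive[OF H(1,2) g(2)] by blast
      then show ?thesis
        using g(1) c d \<phi> by (simp add: lcos_m_assoc)
    qed
    moreover have "\<phi> c = d"
      using \<phi>[of \<one>] c d by (simp add: lcos_mult_one)
    ultimately show ?thesis
      by (simp add: EO_def H(3) K(3))
  qed
  then show ?thesis
    by (auto simp: leq_def)
qed

text \<open>A subgroup, viewed as a coset of itself, is fixed precisely by its own elements, so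
  containing \<open>stab \<sigma>\<close> is what invariance of the base object asks for. Minimum
  and stabilizer both shrink as the chain grows, whence \<open>d = True\<close>.\<close>

theorem EO_equivalence:
  assumes closed: "closed_p_overgroups p G \<C>"
  shows "nerve_equivariant_homotopy_equivalence S (EO G \<C>) (EO_act G) (poset_cat \<C>) (poset_act G) (EO_to_poset G)"
proof (rule homotopy_equivalence_from_base[where d = True
      and f = "\<lambda>\<sigma>. \<Inter>\<sigma> <#> stab \<sigma>" and base = "\<lambda>\<sigma>. (lcosets (\<Inter>\<sigma> <#> stab \<sigma>), \<Inter>\<sigma> <#> stab \<sigma>)"])
  show "thin (EO G \<C>)"
    by (rule thin_EO)
  show "is_functor (EO G \<C>) (poset_cat \<C>) (EO_to_poset G)"
    by (rule is_functor_EO_to_poset[OF collection])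
  show "is_functor (EO G \<C>) (EO G \<C>) (EO_act G g)" if "g \<in> carrier G" for g
    by (rule is_functor_EO_act[OF collection that])
  show "fobj (EO_to_poset G) (fobj (EO_act G g) x) = fobj (poset_act G g) (fobj (EO_to_poset G) x)"
    if "g \<in> carrier G" "x \<in> objs (EO G \<C>)" for g x
    by (rule EO_to_poset_equivariant[OF collection that])
  show "fobj (EO_act G (g \<otimes> k)) x = fobj (EO_act G g) (fobj (EO_act G k) x)"
    if gk: "g \<in> carrier G" "k \<in> carrier G" "x \<in> objs (EO G \<C>)" for g k x
  proof -
    obtain H c where "subgroup H G" "c \<in> lcosets H" "x = (lcosets H, c)"
      using gk(3) by (rule EO_objE)
    then show ?thesis
      using gk(1,2) lcosets_carrier by (simp add: EO_act_def lcos_m_assoc)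
  qed
  fix \<sigma> assume \<sigma>: "\<sigma> \<in> chains \<C>"
  have \<sigma>G: "\<sigma> \<subseteq> Pow (carrier G)"
    using chain_carrier[OF \<sigma>] by blast
  have M: "\<Inter>\<sigma> \<in> \<sigma>" "\<Inter>\<sigma> \<in> \<C>"
    using chain_extrema(1)[OF \<sigma> finite_C] \<sigma> by (auto simp: chains_def)
  have MG: "\<Inter>\<sigma> \<subseteq> carrier G"
    using M(2) C_carrier by blast
  have stabG: "stab \<tau> \<subseteq> carrier G" for \<tau>
    using S_carrier by (auto simp: stab_def)
  \<comment> \<open>The minimum is itself a member of the chain, so the stabilizer normalizes
    it.\<close>
  have pf: "p_subgroup p (\<Inter>\<sigma> <#> stab \<sigma>) G"
    by (rule p_subgroup_set_mult[OF prime finite_G p_subgroups[OF M(2)] p_subgroup_stab[OF \<sigma>G]])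
      (use M(1) in \<open>auto simp: stab_def\<close>)
  then have sf: "subgroup (\<Inter>\<sigma> <#> stab \<sigma>) G"
    by (simp add: p_subgroup_def)
  have "\<one> \<in> stab \<sigma>" "\<one> \<in> \<Inter>\<sigma>"
    using subgroup.one_closed[OF subgroup_stab[OF \<sigma>G]] subgroup.one_closed[OF subgroup_C[OF M(2)]] .
  have le: "\<Inter>\<sigma> \<subseteq> \<Inter>\<sigma> <#> stab \<sigma>"
  proof
    fix x assume "x \<in> \<Inter>\<sigma>"
    then have "x \<otimes> \<one> \<in> \<Inter>\<sigma> <#> stab \<sigma>"
      unfolding set_mult_def using \<open>\<one> \<in> stab \<sigma>\<close> by blast
    then show "x \<in> \<Inter>\<sigma> <#> stab \<sigma>"
      using \<open>x \<in> \<Inter>\<sigma>\<close> MG by (simp add: subset_iff)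
  qed
  then show "if True then \<Inter>\<sigma> \<subseteq> \<Inter>\<sigma> <#> stab \<sigma> else \<Inter>\<sigma> <#> stab \<sigma> \<subseteq> \<Union>\<sigma>"
    by simp
  \<comment> \<open>Here closure under p-overgroups enters, applied to the minimum of the
    chain.\<close>
  have fC: "\<Inter>\<sigma> <#> stab \<sigma> \<in> \<C>"
    using closed pf le M(2) by (auto simp: closed_p_overgroups_def)
  have one: "\<one> <# (\<Inter>\<sigma> <#> stab \<sigma>) = \<Inter>\<sigma> <#> stab \<sigma>"
    by (rule lcos_mult_one[OF subgroup.subset[OF sf]])
  show "(lcosets (\<Inter>\<sigma> <#> stab \<sigma>), \<Inter>\<sigma> <#> stab \<sigma>) \<in> objs (EO G \<C>) \<and>
      fobj (EO_to_poset G) (lcosets (\<Inter>\<sigma> <#> stab \<sigma>), \<Inter>\<sigma> <#> stab \<sigma>) = \<Inter>\<sigma> <#> stab \<sigma>"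
  proof
    have "\<Inter>\<sigma> <#> stab \<sigma> \<in> lcosets (\<Inter>\<sigma> <#> stab \<sigma>)"
      unfolding LCOSETS_def using one by (auto intro!: bexI[of _ \<one>])
    then show "(lcosets (\<Inter>\<sigma> <#> stab \<sigma>), \<Inter>\<sigma> <#> stab \<sigma>) \<in> objs (EO G \<C>)"
      using fC by (auto simp: EO_def)
    have "stabilizer G (\<lambda>g z. g <# z) (\<one> <# (\<Inter>\<sigma> <#> stab \<sigma>)) = conjugate_set G \<one> (\<Inter>\<sigma> <#> stab \<sigma>)"
      by (rule stabilizer_lcoset[OF sf one_closed])
    then show "fobj (EO_to_poset G) (lcosets (\<Inter>\<sigma> <#> stab \<sigma>), \<Inter>\<sigma> <#> stab \<sigma>) = \<Inter>\<sigma> <#> stab \<sigma>"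
      by (simp add: one EO_to_poset_def conjugate_set_one[OF subgroup.subset[OF sf]])
  qed
  show "fobj (EO_act G g) (lcosets (\<Inter>\<sigma> <#> stab \<sigma>), \<Inter>\<sigma> <#> stab \<sigma>) =
      (lcosets (\<Inter>\<sigma> <#> stab \<sigma>), \<Inter>\<sigma> <#> stab \<sigma>)" if g: "g \<in> stab \<sigma>" for g
  proof -
    have "\<one> \<otimes> g \<in> \<Inter>\<sigma> <#> stab \<sigma>"
      unfolding set_mult_def using g \<open>\<one> \<in> \<Inter>\<sigma>\<close> by blast
    then have "g \<in> \<Inter>\<sigma> <#> stab \<sigma>"
      using g stabG by (simp add: subset_iff)
    then have "\<one> <# (\<Inter>\<sigma> <#> stab \<sigma>) = g <# (\<Inter>\<sigma> <#> stab \<sigma>)"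
      using one by (intro l_repr_independence[OF _ _ sf]) auto
    then show ?thesis
      by (simp add: EO_act_def one)
  qed
  show "\<Inter>(conjugate_set G g ` \<sigma>) <#> stab (conjugate_set G g ` \<sigma>) =
      conjugate_set G g (\<Inter>\<sigma> <#> stab \<sigma>)" if g: "g \<in> S" for g
  proof -
    have "\<Inter>(conjugate_set G g ` \<sigma>) = conjugate_set G g (\<Inter>\<sigma>)"
    proof
      \<comment> \<open>Since the minimum belongs to the chain, its conjugate is among the sets
        being intersected.\<close>
      show "\<Inter>(conjugate_set G g ` \<sigma>) \<subseteq> conjugate_set G g (\<Inter>\<sigma>)"
        using M(1) by blast
      show "conjugate_set G g (\<Inter>\<sigma>) \<subseteq> \<Inter>(conjugate_set G g ` \<sigma>)"
        by (auto simp: conjugate_set_image)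
    qed
    then show ?thesis
      using conjugate_set_set_mult[OF S_carrier[OF g] MG stabG] stab_conj[OF \<sigma>G g] by simp
  qed
  show "if True then \<Inter>\<tau> <#> stab \<tau> \<subseteq> \<Inter>\<sigma> <#> stab \<sigma> else \<Inter>\<sigma> <#> stab \<sigma> \<subseteq> \<Inter>\<tau> <#> stab \<tau>"
    if "\<sigma> \<subseteq> \<tau>" for \<tau>
    using Inter_anti_mono[OF that] stab_anti[OF that] by (simp add: set_mult_def) blast
qed (rule leq_EO)

section \<open>The category EA: monomorphisms into G\<close>

lemma EA_objE:
  assumes "x \<in> objs (EA G \<C>)"
  obtains H i where "H \<in> \<C>" "subgroup H G" "x = (H, i)" "inj_on i H" "i \<in> H \<rightarrow> carrier G"
    "\<forall>h\<in>H. \<forall>k\<in>H. i (h \<otimes> k) = i h \<otimes> i k" "i ` H \<in> \<C>"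
  using assms subgroup_C by (auto simp: EA_def mon_def hom_def)

text \<open>The target object is a monomorphism, so a factorization through it is unique.\<close>

lemma thin_EA: "thin (EA G \<C>)"
  unfolding thin_def
proof (intro conjI ballI)
  show "is_category (EA G \<C>)"
    by (rule is_category_EA[OF collection])
  fix x y \<phi> \<psi>
  assume "x \<in> objs (EA G \<C>)" and y: "y \<in> objs (EA G \<C>)"
    and \<phi>: "\<phi> \<in> arrs (EA G \<C>) x y" "\<psi> \<in> arrs (EA G \<C>) x y"
  obtain H i where x: "x = (H, i)"
    by fastforce
  obtain K j where K: "y = (K, j)" "inj_on j K"
    using y by (rule EA_objE)
  have arr: "\<xi> \<in> H \<rightarrow> K" "\<xi> \<in> extensional H" "\<And>h. h \<in> H \<Longrightarrow> j (\<xi> h) = i h"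
    if "\<xi> \<in> arrs (EA G \<C>) x y" for \<xi>
    using that unfolding x K(1) by (auto simp: EA_def hom_def)
  show "\<phi> = \<psi>"
  proof (rule extensionalityI[OF arr(2)[OF \<phi>(1)] arr(2)[OF \<phi>(2)]])
    fix h assume h: "h \<in> H"
    have "j (\<phi> h) = j (\<psi> h)" "\<phi> h \<in> K" "\<psi> h \<in> K"
      using h arr(1,3)[OF \<phi>(1)] arr(1,3)[OF \<phi>(2)] by auto
    then show "\<phi> h = \<psi> h"
      by (rule inj_onD[OF K(2)])
  qed
qed

text \<open>The factorization is the inverse of \<open>j\<close> on its image after
  \<open>i\<close>; it is multiplicative because \<open>j\<close> is injective and
  multiplicative.\<close>

lemma leq_EA:
  assumes x: "x \<in> objs (EA G \<C>)" and y: "y \<in> objs (EA G \<C>)"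
    and sub: "fobj EA_to_poset x \<subseteq> fobj EA_to_poset y"
  shows "leq (EA G \<C>) x y"
proof -
  obtain H i where H: "x = (H, i)" "subgroup H G" "\<forall>h\<in>H. \<forall>k\<in>H. i (h \<otimes> k) = i h \<otimes> i k"
    using x by (rule EA_objE)
  obtain K j where K: "y = (K, j)" "subgroup K G" "inj_on j K"
    "\<forall>h\<in>K. \<forall>k\<in>K. j (h \<otimes> k) = j h \<otimes> j k"
    using y by (rule EA_objE)
  have im: "i h \<in> j ` K" if "h \<in> H" for h
    using sub that by (auto simp: H(1) K(1) EA_to_poset_def)
  define \<phi> where "\<phi> = (\<lambda>h\<in>H. inv_into K j (i h))"
  have \<phi>: "\<phi> h \<in> K" "j (\<phi> h) = i h" if "h \<in> H" for h
    using that im by (auto simp: \<phi>_def inv_into_into f_inv_into_f)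
  have "\<phi> (h \<otimes> k) = \<phi> h \<otimes> \<phi> k" if "h \<in> H" "k \<in> H" for h k
  proof (rule inj_onD[OF K(3)])
    have "h \<otimes> k \<in> H"
      using that H(2) by (simp add: subgroup.m_closed)
    then show "j (\<phi> (h \<otimes> k)) = j (\<phi> h \<otimes> \<phi> k)" "\<phi> (h \<otimes> k) \<in> K"
      using that \<phi> H(3) K(4) by auto
    show "\<phi> h \<otimes> \<phi> k \<in> K"
      using that \<phi> K(2) by (simp add: subgroup.m_closed)
  qed
  then have "\<phi> \<in> arrs (EA G \<C>) x y"
    using \<phi> by (auto simp: EA_def H(1) K(1) hom_def) (simp add: \<phi>_def)
  then show ?thesis
    by (auto simp: leq_def)
qed

definition fixed_part :: "'a set set \<Rightarrow> 'a set" where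
  "fixed_part \<sigma> = {x \<in> \<Union>\<sigma>. \<forall>s\<in>stab \<sigma>. s \<otimes> x \<otimes> inv s = x}"

text \<open>The \<open>p\<close>-group \<open>stab \<sigma>\<close> normalizes the maximum of the
  chain, so it centralizes a nontrivial element of a nontrivial maximum, and closure under
  nontrivial subgroups applies.\<close>

lemma fixed_part_in:
  assumes closed: "closed_nontrivial_subgroups G \<C>" and \<sigma>: "\<sigma> \<in> chains \<C>"
  shows "fixed_part \<sigma> \<in> \<C>"
proof -
  have M: "\<Union>\<sigma> \<in> \<sigma>" "\<Union>\<sigma> \<in> \<C>"
    using chain_extrema(2)[OF \<sigma> finite_C] \<sigma> by (auto simp: chains_def)
  interpret M: subgroup "\<Union>\<sigma>" G
    by (rule subgroup_C[OF M(2)])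
  have \<sigma>G: "\<sigma> \<subseteq> Pow (carrier G)"
    using chain_carrier[OF \<sigma>] by blast
  have norm: "conjugate_set G q (\<Union>\<sigma>) = \<Union>\<sigma>" if "q \<in> stab \<sigma>" for q
    using that M(1) by (simp add: stab_def)
  show ?thesis
  \<comment> \<open>Closure says nothing about trivial subgroups, but if the maximum is trivial, the
    fixed part equals it and is a member already.\<close>
  proof (cases "\<Union>\<sigma> = {\<one>}")
    case True
    then have "fixed_part \<sigma> = \<Union>\<sigma>"
      using S_carrier by (auto simp: fixed_part_def stab_def)
    then show ?thesis
      using M(2) by simp
  next
    case False
    have "subgroup (fixed_part \<sigma>) G"
    proof (rule subgroupI)
      show "fixed_part \<sigma> \<subseteq> carrier G"
        using M.subset by (auto simp: fixed_part_def)
      have "\<one> \<in> fixed_part \<sigma>"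
        using M.one_closed S_carrier by (auto simp: fixed_part_def stab_def)
      then show "fixed_part \<sigma> \<noteq> {}"
        by blast
      fix a assume a: "a \<in> fixed_part \<sigma>"
      have aG: "a \<in> carrier G" "a \<in> \<Union>\<sigma>"
        using a M.subset by (auto simp: fixed_part_def)
      have "s \<otimes> inv a \<otimes> inv s = inv a" if s: "s \<in> stab \<sigma>" for s
      proof -
        have sG: "s \<in> carrier G"
          using s S_carrier by (simp add: stab_def)
        then have "s \<otimes> inv a \<otimes> inv s = inv (s \<otimes> a \<otimes> inv s)"
          using aG by (simp add: inv_mult_group m_assoc)
        then show ?thesis
          using a s by (simp add: fixed_part_def)
      qed
      then show "inv a \<in> fixed_part \<sigma>"
        using M.m_inv_closed[OF aG(2)] by (simp add: fixed_part_def)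
      fix b assume b: "b \<in> fixed_part \<sigma>"
      have bG: "b \<in> carrier G" "b \<in> \<Union>\<sigma>"
        using b M.subset by (auto simp: fixed_part_def)
      have "s \<otimes> (a \<otimes> b) \<otimes> inv s = a \<otimes> b" if s: "s \<in> stab \<sigma>" for s
      proof -
        have sG: "s \<in> carrier G"
          using s S_carrier by (simp add: stab_def)
        show ?thesis
          unfolding conjugate_mult[OF sG aG(1) bG(1)] using a b s by (simp add: fixed_part_def)
      qed
      then show "a \<otimes> b \<in> fixed_part \<sigma>"
        using M.m_closed[OF aG(2) bG(2)] by (simp add: fixed_part_def)
    qed
    moreover have "fixed_part \<sigma> \<noteq> {\<one>}"
      using p_group_fixed_point[OF prime finite_G p_subgroups[OF M(2)] False p_subgroup_stab[OF \<sigma>G] norm]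
      by (auto simp: fixed_part_def)
    moreover have "fixed_part \<sigma> \<subseteq> \<Union>\<sigma>"
      by (auto simp: fixed_part_def)
    ultimately show ?thesis
      using closed M(2) unfolding closed_nontrivial_subgroups_def by blast
  qed
qed

lemma fixed_part_conj:
  assumes \<sigma>: "\<sigma> \<in> chains \<C>" and g: "g \<in> S"
  shows "fixed_part (conjugate_set G g ` \<sigma>) = conjugate_set G g (fixed_part \<sigma>)"
proof -
  have gG: "g \<in> carrier G"
    by (rule S_carrier[OF g])
  have \<sigma>G: "\<sigma> \<subseteq> Pow (carrier G)"
    using chain_carrier[OF \<sigma>] by blast
  have st: "stab (conjugate_set G g ` \<sigma>) = (\<lambda>s. g \<otimes> s \<otimes> inv g) ` stab \<sigma>"
    using stab_conj[OF \<sigma>G g] by (simp only: conjugate_set_image)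
  have un: "\<Union>(conjugate_set G g ` \<sigma>) = (\<lambda>x. g \<otimes> x \<otimes> inv g) ` \<Union>\<sigma>"
    unfolding conjugate_set_image by blast
  have key: "(g \<otimes> s \<otimes> inv g) \<otimes> (g \<otimes> x \<otimes> inv g) \<otimes> inv (g \<otimes> s \<otimes> inv g) = g \<otimes> x \<otimes> inv g \<longleftrightarrow>
      s \<otimes> x \<otimes> inv s = x" if s: "s \<in> carrier G" and x: "x \<in> carrier G" for s x
  proof -
    have "inv (g \<otimes> s \<otimes> inv g) = g \<otimes> inv s \<otimes> inv g"
      using s gG by (simp add: inv_mult_group m_assoc)
    then have "(g \<otimes> s \<otimes> inv g) \<otimes> (g \<otimes> x \<otimes> inv g) \<otimes> inv (g \<otimes> s \<otimes> inv g) = g \<otimes> (s \<otimes> x \<otimes> inv s) \<otimes> inv g"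
      using s x gG by (simp only: conjugate_mult m_closed inv_closed)
    then show ?thesis
      using s x gG by simp
  qed
  have "(\<forall>s\<in>stab (conjugate_set G g ` \<sigma>). s \<otimes> (g \<otimes> x \<otimes> inv g) \<otimes> inv s = g \<otimes> x \<otimes> inv g) \<longleftrightarrow>
      (\<forall>s\<in>stab \<sigma>. s \<otimes> x \<otimes> inv s = x)" if "x \<in> carrier G" for x
    unfolding st using key[OF _ that] S_carrier by (simp add: stab_def)
  moreover have "x \<in> carrier G" if "x \<in> \<Union>\<sigma>" for x
    using that \<sigma>G by auto
  ultimately show ?thesis
    unfolding fixed_part_def un conjugate_set_image by auto
qed

text \<open>An inclusion is fixed under conjugation precisely by the centralizer of its image, so
  being centralized by \<open>stab \<sigma>\<close> is what invariance asks for. As the chain grows,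
  its maximum grows and the centralizing condition weakens, whence \<open>d = False\<close>.\<close>

theorem EA_equivalence:
  assumes closed: "closed_nontrivial_subgroups G \<C>"
  shows "nerve_equivariant_homotopy_equivalence S (EA G \<C>) (EA_act G) (poset_cat \<C>) (poset_act G) EA_to_poset"
proof (rule homotopy_equivalence_from_base[where d = False
      and f = fixed_part and base = "\<lambda>\<sigma>. (fixed_part \<sigma>, \<lambda>h\<in>fixed_part \<sigma>. h)"])
  show "thin (EA G \<C>)"
    by (rule thin_EA)
  show "is_functor (EA G \<C>) (poset_cat \<C>) EA_to_poset"
    by (rule is_functor_EA_to_poset)
  show "is_functor (EA G \<C>) (EA G \<C>) (EA_act G g)" if "g \<in> carrier G" for g
    by (rule is_functor_EA_act[OF collection that])
  show "fobj EA_to_poset (fobj (EA_act G g) x) = fobj (poset_act G g) (fobj EA_to_poset x)" for g x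
    by (rule EA_to_poset_equivariant)
  show "fobj (EA_act G (g \<otimes> k)) x = fobj (EA_act G g) (fobj (EA_act G k) x)"
    if gk: "g \<in> carrier G" "k \<in> carrier G" "x \<in> objs (EA G \<C>)" for g k x
  proof -
    obtain H i where x: "x = (H, i)" "i \<in> H \<rightarrow> carrier G"
      using gk(3) by (rule EA_objE)
    have "g \<otimes> k \<otimes> i h \<otimes> inv (g \<otimes> k) = g \<otimes> (k \<otimes> i h \<otimes> inv k) \<otimes> inv g" if "h \<in> H" for h
    proof -
      have "i h \<in> carrier G"
        using x(2) that by auto
      then show ?thesis
        using gk(1,2) by (simp add: inv_mult_group m_assoc)
    qed
    then show ?thesis
      by (auto simp: x(1) EA_act_def)
  qed
  fix \<sigma> assume \<sigma>: "\<sigma> \<in> chains \<C>"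
  have f: "fixed_part \<sigma> \<in> \<C>"
    by (rule fixed_part_in[OF closed \<sigma>])
  show "(fixed_part \<sigma>, \<lambda>h\<in>fixed_part \<sigma>. h) \<in> objs (EA G \<C>) \<and>
      fobj EA_to_poset (fixed_part \<sigma>, \<lambda>h\<in>fixed_part \<sigma>. h) = fixed_part \<sigma>"
    using f subgroup.subset[OF subgroup_C[OF f]] subgroup.m_closed[OF subgroup_C[OF f]]
    by (auto simp: EA_def EA_to_poset_def mon_def hom_def inj_on_def)
  \<comment> \<open>Conjugation by \<open>g\<close> is the identity on the fixed part, so the
    inclusion composed with it is the same extensional function.\<close>
  show "fobj (EA_act G g) (fixed_part \<sigma>, \<lambda>h\<in>fixed_part \<sigma>. h) = (fixed_part \<sigma>, \<lambda>h\<in>fixed_part \<sigma>. h)"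
    if "g \<in> stab \<sigma>" for g
    using that by (auto simp: EA_act_def fixed_part_def)
  show "fixed_part (conjugate_set G g ` \<sigma>) = conjugate_set G g (fixed_part \<sigma>)" if "g \<in> S" for g
    by (rule fixed_part_conj[OF \<sigma> that])
  show "if False then \<Inter>\<sigma> \<subseteq> fixed_part \<sigma> else fixed_part \<sigma> \<subseteq> \<Union>\<sigma>"
    by (auto simp: fixed_part_def)
  show "if False then fixed_part \<tau> \<subseteq> fixed_part \<sigma> else fixed_part \<sigma> \<subseteq> fixed_part \<tau>" if "\<sigma> \<subseteq> \<tau>" for \<tau>
    using that stab_anti[OF that] by (auto simp: fixed_part_def)
qed (rule leq_EA)

end

theorem lemma2p7:
  fixes G :: "('a, 'b) monoid_scheme" (structure)
    and \<C> :: "'a set set" and S :: "'a set" and p :: nat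
  assumes "prime p"
    and "group G" and "finite (carrier G)"
    and "collection G \<C>" and "\<forall>H\<in>\<C>. p_subgroup p H G"
    and "sylow_subgroup p S G"
  shows "(closed_p_overgroups p G \<C> \<longrightarrow>
            nerve_equivariant_homotopy_equivalence S
              (EO G \<C>) (EO_act G) (poset_cat \<C>) (poset_act G) (EO_to_poset G)) \<and>
         (closed_nontrivial_subgroups G \<C> \<longrightarrow>
            nerve_equivariant_homotopy_equivalence S
              (EA G \<C>) (EA_act G) (poset_cat \<C>) (poset_act G) EA_to_poset)"
proof -
  have "p_subgroup p S G"
    using assms(6) by (auto simp: sylow_subgroup_def p_subgroup_def)
  then interpret p_collection G \<C> S p
    using assms by (intro p_collection.intro p_collection_axioms.intro) auto
  show ?thesis
    using EO_equivalence EA_equivalence by blast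
qed

end
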